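(* Let $p$ be an odd prime and let $k$ be a field of characteristic not $p$ containing a primitive $p^3$-th root of unity $\zeta_{p^3}$; put $\zeta=\zeta_{p^3}^{p^2}$. The group $$\Phi_2(41)=\langle\alpha,\alpha_1,\alpha_2:\ [\alpha_1,\alpha]=\alpha^{p^3}=\alpha_2,\ \alpha_1^p=\alpha_2^p=1,\ [\alpha_2,\alpha]=[\alpha_2,\alpha_1]=1\rangle$$ of order $p^5$ is realizable as a Galois group over $k$ if and only if there exist elements $a_1,a_2\in k^\times$, independent modulo $k^{\times p}$, such that $(\zeta_{p^3}^{-1}a_1,a_2;\zeta)=1\in\mathrm{Br}(k)$.
   Context: $[x,y]=x^{-1}y^{-1}xy$. A finite group $G$ is realizable as a Galois group over $k$ if there is a Galois field extension $M/k$ with $\mathrm{Gal}(M/k)\cong G$. Elements of $k^\times$ are independent modulo $k^{\times p}$ if their classes are linearly independent in the $\mathbb F_p$-vector space $k^\times/k^{\times p}$. For $a,b\in k^\times$, $(a,b;\zeta)\in\mathrm{Br}(k)$ is the class of the $p$-cyclic $k$-algebra generated by $i_1,i_2$ with $i_1^p=b$, $i_2^p=a$, $i_1i_2=\zeta i_2i_1$. *)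

theory Defs
  imports "HOL-Algebra.Algebra" "HOL-Algebra.Algebraic_Closure_Type"
begin

section \<open>Groups given by generators and relations\<close>

text \<open>A letter \<open>(g, True)\<close> stands for the generator \<open>g\<close> and \<open>(g, False)\<close> for its inverse.\<close>

type_synonym 'g word = "('g \<times> bool) list"

definition gen_word :: "'g \<Rightarrow> 'g word" where
  "gen_word g = [(g, True)]"

definition inv_word :: "'g word \<Rightarrow> 'g word" where
  "inv_word w = rev (map (\<lambda>(g, s). (g, \<not> s)) w)"

definition pow_word :: "'g word \<Rightarrow> nat \<Rightarrow> 'g word" where
  "pow_word w n = concat (replicate n w)"

definition comm_word :: "'g word \<Rightarrow> 'g word \<Rightarrow> 'g word" where
  "comm_word x y = inv_word x @ inv_word y @ x @ y"

text \<open>The least congruence on words that contains the free cancellations and the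
  relations \<open>u = v\<close> for \<open>(u, v) \<in> E\<close>.\<close>

inductive pres_eq :: "('g word \<times> 'g word) set \<Rightarrow> 'g word \<Rightarrow> 'g word \<Rightarrow> bool"
  for E :: "('g word \<times> 'g word) set" where
  refl: "pres_eq E w w"
| sym: "pres_eq E u v \<Longrightarrow> pres_eq E v u"
| trans: "pres_eq E u v \<Longrightarrow> pres_eq E v w \<Longrightarrow> pres_eq E u w"
| cong: "pres_eq E u u' \<Longrightarrow> pres_eq E v v' \<Longrightarrow> pres_eq E (u @ v) (u' @ v')"
| cancel: "pres_eq E [(g, s), (g, \<not> s)] []"
| relation: "(u, v) \<in> E \<Longrightarrow> pres_eq E u v"

definition pres_class :: "('g word \<times> 'g word) set \<Rightarrow> 'g word \<Rightarrow> 'g word set" where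
  "pres_class E w = {v. pres_eq E w v}"

definition presented_group :: "('g word \<times> 'g word) set \<Rightarrow> 'g word set monoid" where
  "presented_group E =
    \<lparr>carrier = range (pres_class E),
     monoid.mult = (\<lambda>A B. \<Union>u\<in>A. \<Union>v\<in>B. pres_class E (u @ v)),
     one = pres_class E []\<rparr>"

lemma pres_class_eq_iff: "pres_class E u = pres_class E v \<longleftrightarrow> pres_eq E u v"
  unfolding pres_class_def by (blast intro: pres_eq.intros)

lemma presented_group_mult [simp]:
  "pres_class E u \<otimes>\<^bsub>presented_group E\<^esub> pres_class E v = pres_class E (u @ v)"
  unfolding presented_group_def pres_class_def by (auto intro: pres_eq.intros)

lemma presented_group_carrier: "carrier (presented_group E) = range (pres_class E)"
  and presented_group_one: "\<one>\<^bsub>presented_group E\<^esub> = pres_class E []"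
  by (simp_all add: presented_group_def)

lemma inv_word_Cons: "inv_word (x # w) = inv_word w @ [(fst x, \<not> snd x)]"
  by (cases x) (simp add: inv_word_def)

lemma pres_eq_inv_word: "pres_eq E (inv_word w @ w) []"
proof (induction w)
  case Nil
  show ?case by (simp add: inv_word_def pres_eq.refl)
next
  case (Cons x w)
  have "pres_eq E [(fst x, \<not> snd x), (fst x, \<not> \<not> snd x)] []"
    by (rule pres_eq.cancel)
  then have "pres_eq E ([(fst x, \<not> snd x), x] @ w) ([] @ w)"
    by (intro pres_eq.cong pres_eq.refl) simp
  then have "pres_eq E (inv_word w @ [(fst x, \<not> snd x), x] @ w) (inv_word w @ w)"
    by (intro pres_eq.cong pres_eq.refl) simp
  then show ?case
    using Cons.IH by (auto simp: inv_word_Cons intro: pres_eq.trans)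
qed

lemma group_presented_group: "group (presented_group E)"
proof (rule groupI)
  fix x assume "x \<in> carrier (presented_group E)"
  then obtain w where "x = pres_class E w" by (auto simp: presented_group_carrier)
  then show "\<exists>y\<in>carrier (presented_group E). y \<otimes>\<^bsub>presented_group E\<^esub> x = \<one>\<^bsub>presented_group E\<^esub>"
    by (intro bexI[of _ "pres_class E (inv_word w)"])
       (auto simp: presented_group_carrier presented_group_one pres_class_eq_iff pres_eq_inv_word)
qed (auto simp: presented_group_carrier presented_group_one)

definition word_value :: "('a, 'm) monoid_scheme \<Rightarrow> ('g \<Rightarrow> 'a) \<Rightarrow> 'g word \<Rightarrow> 'a" where
  "word_value H f w =
    foldr (\<lambda>(g, s) y. (if s then f g else inv\<^bsub>H\<^esub> (f g)) \<otimes>\<^bsub>H\<^esub> y) w \<one>\<^bsub>H\<^esub>"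

context group
begin

lemma word_value_closed [simp]: "range f \<subseteq> carrier G \<Longrightarrow> word_value G f w \<in> carrier G"
  by (induction w) (auto simp: word_value_def image_subset_iff)

lemma word_value_append:
  "range f \<subseteq> carrier G \<Longrightarrow> word_value G f (u @ v) = word_value G f u \<otimes> word_value G f v"
proof (induction u)
  case Nil
  then show ?case using word_value_closed[of f v] by (simp add: word_value_def)
next
  case (Cons x u)
  have "f (fst x) \<in> carrier G" using Cons.prems by auto
  then show ?case using Cons word_value_closed[of f u] word_value_closed[of f v]
    by (cases x) (auto simp: word_value_def m_assoc)
qed

lemma word_value_gen: "range f \<subseteq> carrier G \<Longrightarrow> word_value G f (gen_word g) = f g"
  by (simp add: word_value_def gen_word_def image_subset_iff)

lemma word_value_inv:
  assumes "range f \<subseteq> carrier G"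
  shows "word_value G f (inv_word w) = inv (word_value G f w)"
proof (induction w)
  case Nil
  show ?case by (simp add: word_value_def inv_word_def)
next
  case (Cons x w)
  have f: "f (fst x) \<in> carrier G" using assms by auto
  have x: "word_value G f [(fst x, \<not> snd x)] = inv (word_value G f [x])"
    using f by (cases x) (auto simp: word_value_def)
  have "word_value G f (x # w) = word_value G f [x] \<otimes> word_value G f w"
    using word_value_append[OF assms, of "[x]" w] by simp
  then show ?case
    using Cons assms by (simp add: inv_word_Cons word_value_append x inv_mult_group)
qed

lemma word_value_pow:
  assumes "range f \<subseteq> carrier G"
  shows "word_value G f (pow_word w n) = word_value G f w [^] n"
proof (induction n)
  case 0
  show ?case by (simp add: word_value_def pow_word_def)
next
  case (Suc n)
  have "word_value G f (pow_word w (Suc n)) = word_value G f w \<otimes> word_value G f w [^] n"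
    using Suc assms by (simp add: pow_word_def word_value_append)
  also have "\<dots> = word_value G f w [^] Suc n"
    using assms by (simp add: nat_pow_Suc2[symmetric])
  finally show ?case .
qed

lemma word_value_comm:
  assumes "range f \<subseteq> carrier G"
  shows "word_value G f (comm_word u v) =
    inv (word_value G f u) \<otimes> (inv (word_value G f v) \<otimes> (word_value G f u \<otimes> word_value G f v))"
  using assms by (simp add: comm_word_def word_value_append word_value_inv)

lemma word_value_Nil: "word_value G f [] = \<one>"
  by (simp add: word_value_def)

lemma word_value_pres_eq:
  assumes "range f \<subseteq> carrier G"
    and "\<And>u v. (u, v) \<in> E \<Longrightarrow> word_value G f u = word_value G f v"
    and "pres_eq E u v"
  shows "word_value G f u = word_value G f v"
  using assms(3)
proof induction
  case (cancel g s)
  have "f g \<in> carrier G" using assms(1) by auto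
  then show ?case by (cases s) (auto simp: word_value_def)
qed (use assms in \<open>auto simp: word_value_append\<close>)

end

text \<open>The universal property of the presentation.\<close>

lemma presented_group_universal:
  assumes "group H" "range f \<subseteq> carrier H"
    and "\<And>u v. (u, v) \<in> E \<Longrightarrow> word_value H f u = word_value H f v"
  obtains h where "h \<in> hom (presented_group E) H"
    and "\<And>w. h (pres_class E w) = word_value H f w"
proof
  interpret H: group H by fact
  define h where "h = (\<lambda>A. word_value H f (SOME w. w \<in> A))"
  show h: "h (pres_class E w) = word_value H f w" for w
  proof -
    have "w \<in> pres_class E w" by (simp add: pres_class_def pres_eq.refl)
    then have "(SOME v. v \<in> pres_class E w) \<in> pres_class E w" by (rule someI)
    then have "pres_eq E w (SOME v. v \<in> pres_class E w)" by (simp add: pres_class_def)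
    then show ?thesis
      unfolding h_def using H.word_value_pres_eq[OF assms(2,3)] by metis
  qed
  show "h \<in> hom (presented_group E) H"
    by (auto simp: hom_def presented_group_carrier h H.word_value_append assms(2)
          H.word_value_closed)
qed

lemma presented_group_word_value:
  "word_value (presented_group E) (\<lambda>g. pres_class E (gen_word g)) w = pres_class E w"
proof (induction w)
  case Nil
  show ?case by (simp add: word_value_def presented_group_one)
next
  case (Cons x w)
  interpret group "presented_group E" by (rule group_presented_group)
  obtain g s where x: "x = (g, s)" by (cases x)
  have "inv\<^bsub>presented_group E\<^esub> (pres_class E [(g, True)]) = pres_class E [(g, False)]"
    using pres_eq.cancel[of E g False]
    by (intro inv_equality) (auto simp: presented_group_carrier presented_group_one pres_class_eq_iff)
  then show ?case
    using Cons by (cases s) (simp_all add: x word_value_def gen_word_def)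
qed

subsection \<open>The group \<open>\<Phi>\<^sub>2(41)\<close>\<close>

datatype Phi2_41_gen = gen_\<alpha> | gen_\<alpha>1 | gen_\<alpha>2

definition Phi2_41_relations :: "nat \<Rightarrow> (Phi2_41_gen word \<times> Phi2_41_gen word) set" where
  "Phi2_41_relations p =
    (let \<alpha> = gen_word gen_\<alpha>; \<alpha>1 = gen_word gen_\<alpha>1; \<alpha>2 = gen_word gen_\<alpha>2 in
      {(comm_word \<alpha>1 \<alpha>, pow_word \<alpha> (p ^ 3)), (pow_word \<alpha> (p ^ 3), \<alpha>2),
       (pow_word \<alpha>1 p, []), (pow_word \<alpha>2 p, []),
       (comm_word \<alpha>2 \<alpha>, []), (comm_word \<alpha>2 \<alpha>1, [])})"

definition Phi2_41 :: "nat \<Rightarrow> Phi2_41_gen word set monoid" where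
  "Phi2_41 p = presented_group (Phi2_41_relations p)"

text \<open>Normal form: \<open>(i, j)\<close> stands for \<open>\<alpha>\<^sup>i \<alpha>\<^sub>1\<^sup>j\<close>.\<close>

definition Phi2_41_model :: "int \<Rightarrow> (int \<times> int) monoid" where
  "Phi2_41_model p =
    \<lparr>carrier = {0..<p ^ 4} \<times> {0..<p},
     monoid.mult = (\<lambda>(i, j) (u, v). ((i + u + j * u * p ^ 3) mod p ^ 4, (j + v) mod p)),
     one = (0, 0)\<rparr>"

lemma p34_mod: fixes p :: int shows "(x + y mod p * w * p ^ 3) mod p ^ 4 = (x + y * w * p ^ 3) mod p ^ 4"
proof -
  have "p * (y div p) + y mod p = y" by simp
  then have "x + y * w * p ^ 3 = x + (p * (y div p) + y mod p) * w * p ^ 3" by simp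
  also have "\<dots> = (x + y mod p * w * p ^ 3) + (y div p) * w * p ^ 4"
    unfolding distrib_right by (simp add: power3_eq_cube power4_eq_xxxx mult_ac)
  finally show ?thesis by (metis mod_mult_self1)
qed

lemma p4_mod: "(i + s mod q + j * (s mod q) * c) mod q = (i + s + j * s * c) mod (q :: int)"
  by (intro mod_add_cong mod_mult_cong mod_mod_trivial HOL.refl)

lemma group_Phi2_41_model:
  assumes "p > 1" shows "group (Phi2_41_model p)"
proof (rule groupI)
  show "x \<otimes>\<^bsub>Phi2_41_model p\<^esub> y \<otimes>\<^bsub>Phi2_41_model p\<^esub> z = x \<otimes>\<^bsub>Phi2_41_model p\<^esub> (y \<otimes>\<^bsub>Phi2_41_model p\<^esub> z)"
    for x y z
  proof -
    obtain i j u v w t where xyz: "x = (i, j)" "y = (u, v)" "z = (w, t)" by (metis surj_pair)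
    have "((i + u + j * u * p ^ 3) mod p ^ 4 + w + (j + v) mod p * w * p ^ 3) mod p ^ 4
        = (i + u + j * u * p ^ 3 + w + (j + v) * w * p ^ 3) mod p ^ 4"
    proof -
      have "((i + u + j * u * p ^ 3) mod p ^ 4 + w + (j + v) mod p * w * p ^ 3) mod p ^ 4
          = ((i + u + j * u * p ^ 3) mod p ^ 4 + (w + (j + v) mod p * w * p ^ 3)) mod p ^ 4"
        by (simp only: add.assoc)
      also have "\<dots> = ((i + u + j * u * p ^ 3) + (w + (j + v) mod p * w * p ^ 3)) mod p ^ 4"
        by (rule mod_add_left_eq)
      also have "\<dots> = (i + u + j * u * p ^ 3 + w + (j + v) mod p * w * p ^ 3) mod p ^ 4"
        by (simp only: add.assoc)
      finally show ?thesis unfolding p34_mod .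
    qed
    also have "\<dots> = (i + (u + w + v * w * p ^ 3) + j * (u + w + v * w * p ^ 3) * p ^ 3) mod p ^ 4"
    proof -
      have "i + (u + w + v * w * p ^ 3) + j * (u + w + v * w * p ^ 3) * p ^ 3
          = (i + u + j * u * p ^ 3 + w + (j + v) * w * p ^ 3) + j * v * w * p ^ 2 * p ^ 4"
        by (simp add: algebra_simps eval_nat_numeral)
      then show ?thesis by (simp only: mod_mult_self1)
    qed
    also have "\<dots> = (i + (u + w + v * w * p ^ 3) mod p ^ 4 + j * ((u + w + v * w * p ^ 3) mod p ^ 4) * p ^ 3) mod p ^ 4"
      by (rule p4_mod[symmetric])
    finally have 1: "((i + u + j * u * p ^ 3) mod p ^ 4 + w + (j + v) mod p * w * p ^ 3) mod p ^ 4
        = (i + (u + w + v * w * p ^ 3) mod p ^ 4 + j * ((u + w + v * w * p ^ 3) mod p ^ 4) * p ^ 3) mod p ^ 4" .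
    have 2: "((j + v) mod p + t) mod p = (j + (v + t) mod p) mod p"
      by (simp only: mod_add_left_eq mod_add_right_eq add.assoc)
    show ?thesis
      unfolding Phi2_41_model_def xyz by (simp only: monoid.simps prod.case 1 2)
  qed
  show "\<exists>y\<in>carrier (Phi2_41_model p). y \<otimes>\<^bsub>Phi2_41_model p\<^esub> x = \<one>\<^bsub>Phi2_41_model p\<^esub>"
    if "x \<in> carrier (Phi2_41_model p)" for x
  proof -
    obtain u v where x: "x = (u, v)" by (cases x)
    define y where "y = ((- (u + (-v) * u * p ^ 3)) mod p ^ 4, (-v) mod p)"
    have "((- (u + (-v) * u * p ^ 3)) mod p ^ 4 + u + (-v) mod p * u * p ^ 3) mod p ^ 4
        = (- (u + (-v) * u * p ^ 3) + u + (-v) * u * p ^ 3) mod p ^ 4"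
    proof -
      have "((- (u + (-v) * u * p ^ 3)) mod p ^ 4 + u + (-v) mod p * u * p ^ 3) mod p ^ 4
          = ((- (u + (-v) * u * p ^ 3)) mod p ^ 4 + (u + (-v) mod p * u * p ^ 3)) mod p ^ 4"
        by (simp only: add.assoc)
      also have "\<dots> = (- (u + (-v) * u * p ^ 3) + (u + (-v) mod p * u * p ^ 3)) mod p ^ 4"
        by (rule mod_add_left_eq)
      also have "\<dots> = (- (u + (-v) * u * p ^ 3) + u + (-v) mod p * u * p ^ 3) mod p ^ 4"
        by (simp only: add.assoc)
      finally show ?thesis unfolding p34_mod .
    qed
    also have "- (u + (-v) * u * p ^ 3) + u + (-v) * u * p ^ 3 = 0" by simp
    finally have 1: "((- (u + (-v) * u * p ^ 3)) mod p ^ 4 + u + (-v) mod p * u * p ^ 3) mod p ^ 4 = 0"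
      by (simp only: mod_0)
    have 2: "((-v) mod p + v) mod p = 0"
      by (simp only: mod_add_left_eq) simp
    have "y \<otimes>\<^bsub>Phi2_41_model p\<^esub> x = \<one>\<^bsub>Phi2_41_model p\<^esub>"
      unfolding Phi2_41_model_def y_def x by (simp only: monoid.simps prod.case 1 2)
    moreover have "y \<in> carrier (Phi2_41_model p)"
      using assms by (simp add: Phi2_41_model_def y_def)
    ultimately show ?thesis by blast
  qed
qed (use assms in \<open>auto simp: Phi2_41_model_def\<close>)


lemma order_Phi2_41_model: "p > 0 \<Longrightarrow> card (carrier (Phi2_41_model (int p))) = p ^ 5"
proof -
  have "card (carrier (Phi2_41_model (int p))) = nat (int p ^ 4) * p"
    by (simp add: Phi2_41_model_def card_cartesian_product)
  also have "nat (int p ^ 4) = p ^ 4"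
    by (metis nat_int of_nat_power)
  finally show ?thesis by (simp add: eval_nat_numeral)
qed

lemma Phi2_41_group: "group (Phi2_41 p)"
  unfolding Phi2_41_def by (rule group_presented_group)

lemma Phi2_41_facts:
  fixes p :: nat and G (structure)
  defines "G \<equiv> Phi2_41 p"
  defines "a \<equiv> pres_class (Phi2_41_relations p) (gen_word gen_\<alpha>)"
    and "b \<equiv> pres_class (Phi2_41_relations p) (gen_word gen_\<alpha>1)"
    and "c \<equiv> pres_class (Phi2_41_relations p) (gen_word gen_\<alpha>2)"
  shows "a \<in> carrier G" "b \<in> carrier G" "c \<in> carrier G"
    "b \<otimes>\<^bsub>G\<^esub> a = a \<otimes>\<^bsub>G\<^esub> (b \<otimes>\<^bsub>G\<^esub> c)" "a [^]\<^bsub>G\<^esub> (p ^ 3) = c"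
    "b [^]\<^bsub>G\<^esub> p = \<one>\<^bsub>G\<^esub>" "c [^]\<^bsub>G\<^esub> p = \<one>\<^bsub>G\<^esub>"
    "c \<otimes>\<^bsub>G\<^esub> a = a \<otimes>\<^bsub>G\<^esub> c" "c \<otimes>\<^bsub>G\<^esub> b = b \<otimes>\<^bsub>G\<^esub> c"
proof -
  interpret group G unfolding G_def by (rule Phi2_41_group)
  define f where "f = (\<lambda>g. pres_class (Phi2_41_relations p) (gen_word g))"
  have f: "range f \<subseteq> carrier G"
    by (auto simp: f_def G_def Phi2_41_def presented_group_carrier)
  have [simp]: "word_value G f (gen_word gen_\<alpha>) = a" "word_value G f (gen_word gen_\<alpha>1) = b"
    "word_value G f (gen_word gen_\<alpha>2) = c"
    using f by (simp_all add: word_value_gen) (simp_all add: f_def a_def b_def c_def)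
  have E: "word_value G f u = word_value G f v" if "(u, v) \<in> Phi2_41_relations p" for u v
    using pres_eq.relation[OF that]
    unfolding f_def G_def Phi2_41_def presented_group_word_value pres_class_eq_iff .
  show abc: "a \<in> carrier G" "b \<in> carrier G" "c \<in> carrier G"
    using f by (auto simp: f_def a_def b_def c_def)
  have comm: "x \<otimes> y = y \<otimes> (x \<otimes> z)" if "inv x \<otimes> (inv y \<otimes> (x \<otimes> y)) = z"
    "x \<in> carrier G" "y \<in> carrier G" for x y z
  proof -
    have cancel: "w \<otimes> (inv w \<otimes> t) = t" if "w \<in> carrier G" "t \<in> carrier G" for w t
      using that by (simp add: m_assoc[symmetric])
    show ?thesis
      using that(2,3) by (simp add: that(1)[symmetric] cancel)
  qed
  note R = E[unfolded Phi2_41_relations_def Let_def]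
  have 1: "inv b \<otimes> (inv a \<otimes> (b \<otimes> a)) = a [^] (p ^ 3)"
    using R[of "comm_word (gen_word gen_\<alpha>1) (gen_word gen_\<alpha>)" "pow_word (gen_word gen_\<alpha>) (p ^ 3)"] f
    by (simp add: word_value_comm word_value_pow)
  show 2: "a [^] (p ^ 3) = c"
    using R[of "pow_word (gen_word gen_\<alpha>) (p ^ 3)" "gen_word gen_\<alpha>2"] f
    by (simp add: word_value_pow)
  show "b \<otimes> a = a \<otimes> (b \<otimes> c)"
    using comm[OF 1] abc 2 by simp
  show "b [^] p = \<one>"
    using R[of "pow_word (gen_word gen_\<alpha>1) p" "[]"] f
    by (simp add: word_value_pow word_value_Nil)
  show "c [^] p = \<one>"
    using R[of "pow_word (gen_word gen_\<alpha>2) p" "[]"] f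
    by (simp add: word_value_pow word_value_Nil)
  have 3: "inv c \<otimes> (inv a \<otimes> (c \<otimes> a)) = \<one>"
    using R[of "comm_word (gen_word gen_\<alpha>2) (gen_word gen_\<alpha>)" "[]"] f
    by (simp add: word_value_comm word_value_Nil)
  show "c \<otimes> a = a \<otimes> c"
    using comm[OF 3] abc by simp
  have 4: "inv c \<otimes> (inv b \<otimes> (c \<otimes> b)) = \<one>"
    using R[of "comm_word (gen_word gen_\<alpha>2) (gen_word gen_\<alpha>1)" "[]"] f
    by (simp add: word_value_comm word_value_Nil)
  show "c \<otimes> b = b \<otimes> c"
    using comm[OF 4] abc by simp
qed

lemma Phi2_41_normal_form:
  fixes p :: nat and G (structure)
  defines "G \<equiv> Phi2_41 p"
  defines "a \<equiv> pres_class (Phi2_41_relations p) (gen_word gen_\<alpha>)"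
    and "b \<equiv> pres_class (Phi2_41_relations p) (gen_word gen_\<alpha>1)"
  assumes "p > 0"
  shows "carrier G = (\<lambda>(i, j). a [^]\<^bsub>G\<^esub> i \<otimes>\<^bsub>G\<^esub> b [^]\<^bsub>G\<^esub> j) ` ({..<p ^ 4} \<times> {..<p})"
proof -
  interpret group G unfolding G_def by (rule Phi2_41_group)
  define c where "c = pres_class (Phi2_41_relations p) (gen_word gen_\<alpha>2)"
  note facts = Phi2_41_facts[of p, folded G_def a_def b_def c_def]
  note [simp] = facts(1-3)
  have a4: "a [^] (p ^ 4) = \<one>"
  proof -
    have "a [^] (p ^ 4) = (a [^] (p ^ 3)) [^] p"
      by (simp add: nat_pow_pow eval_nat_numeral mult.commute)
    then show ?thesis using facts by simp
  qed
  define S where "S = {a [^] i \<otimes> b [^] j | (i :: nat) (j :: nat). True}"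
  have S_b: "x \<otimes> b \<in> S" if "x \<in> S" for x
  proof -
    obtain i j :: nat where "x = a [^] i \<otimes> b [^] j" using \<open>x \<in> S\<close> by (auto simp: S_def)
    then have "x \<otimes> b = a [^] i \<otimes> b [^] Suc j" by (simp add: m_assoc)
    then show ?thesis unfolding S_def by blast
  qed
  have bj: "b [^] j \<otimes> a = a [^] (1 + j * p ^ 3) \<otimes> b [^] j" for j :: nat
  proof (induction j)
    case (Suc j)
    have cb: "b [^] j \<otimes> c = c \<otimes> b [^] j"
      by (rule group_commutes_pow[OF facts(9)[symmetric] facts(2,3)])
    have "b [^] Suc j \<otimes> a = b [^] j \<otimes> (b \<otimes> a)" by (simp add: m_assoc)
    also have "b \<otimes> a = a \<otimes> (c \<otimes> b)" using facts by simp
    also have "b [^] j \<otimes> (a \<otimes> (c \<otimes> b)) = (b [^] j \<otimes> a) \<otimes> (c \<otimes> b)" by (simp add: m_assoc)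
    also have "\<dots> = a [^] (1 + j * p ^ 3) \<otimes> (b [^] j \<otimes> c) \<otimes> b"
      by (simp only: Suc) (simp add: m_assoc del: nat_pow_Suc)
    also have "\<dots> = (a [^] (1 + j * p ^ 3) \<otimes> a [^] (p ^ 3)) \<otimes> b [^] Suc j"
      by (simp only: cb facts(5)) (simp add: m_assoc)
    also have "a [^] (1 + j * p ^ 3) \<otimes> a [^] (p ^ 3) = a [^] (1 + Suc j * p ^ 3)"
      by (subst nat_pow_mult) (simp_all add: algebra_simps)
    finally show ?case .
  qed simp
  have S_a: "x \<otimes> a \<in> S" if "x \<in> S" for x
  proof -
    obtain i j :: nat where "x = a [^] i \<otimes> b [^] j" using \<open>x \<in> S\<close> by (auto simp: S_def)
    then have "x \<otimes> a = a [^] i \<otimes> (b [^] j \<otimes> a)" by (simp add: m_assoc)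
    also have "\<dots> = (a [^] i \<otimes> a [^] (1 + j * p ^ 3)) \<otimes> b [^] j"
      unfolding bj by (simp add: m_assoc del: One_nat_def)
    also have "\<dots> = a [^] (i + (1 + j * p ^ 3)) \<otimes> b [^] j"
      by (simp only: nat_pow_mult facts(1))
    finally show ?thesis unfolding S_def by blast
  qed
  have S_carrier: "S \<subseteq> carrier G" by (auto simp: S_def)
  have S_pow: "x \<otimes> y [^] n \<in> S"
    if "y \<in> carrier G" "\<And>x. x \<in> S \<Longrightarrow> x \<otimes> y \<in> S" "x \<in> S" for x y and n :: nat
    using that(3)
  proof (induction n arbitrary: x)
    case 0
    then show ?case using S_carrier by auto
  next
    case (Suc n)
    have "x \<in> carrier G" using Suc.prems S_carrier by blast
    then have "x \<otimes> y [^] Suc n = (x \<otimes> y [^] n) \<otimes> y" using that(1) by (simp add: m_assoc)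
    then show ?case using Suc that(2) by simp
  qed
  have S_c: "x \<otimes> c \<in> S" if "x \<in> S" for x
    using S_pow[of a x "p ^ 3"] S_a that facts by simp
  have inv_pow: "inv y = y [^] (n - 1)" if "y \<in> carrier G" "y [^] n = \<one>" "n > 0" for y and n :: nat
  proof (rule inv_equality)
    show "y [^] (n - 1) \<otimes> y = \<one>" using that by (cases n) auto
  qed (use that in auto)
  have S_all: "pres_class (Phi2_41_relations p) w \<in> S" for w
  proof (induction w rule: rev_induct)
    case Nil
    have "\<one> = a [^] (0 :: nat) \<otimes> b [^] (0 :: nat)" by simp
    then show ?case
      unfolding S_def G_def Phi2_41_def presented_group_one by blast
  next
    case (snoc x w)
    obtain g s where x: "x = (g, s)" by (cases x)
    define y where "y = pres_class (Phi2_41_relations p) (gen_word g)"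
    have y: "y \<in> carrier G"
      by (simp add: y_def G_def Phi2_41_def presented_group_carrier)
    have y_cases: "y = a \<or> y = b \<or> y = c"
      by (cases g) (simp_all add: y_def a_def b_def c_def)
    then have yS: "x \<otimes> y \<in> S" if "x \<in> S" for x
      using S_a S_b S_c that by blast
    obtain n :: nat where n: "y [^] n = \<one>" "n > 0"
    proof -
      have "y [^] (p ^ 4) = \<one> \<or> y [^] p = \<one>" using y_cases a4 facts(6,7) by auto
      then show ?thesis using that \<open>p > 0\<close> zero_less_power by blast
    qed
    have "inv y = pres_class (Phi2_41_relations p) [(g, False)]"
      using pres_eq.cancel[of "Phi2_41_relations p" g False] y
      by (intro inv_equality)
         (auto simp: y_def gen_word_def G_def Phi2_41_def presented_group_carrier
            presented_group_one pres_class_eq_iff)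
    then have "pres_class (Phi2_41_relations p) (w @ [x]) =
        pres_class (Phi2_41_relations p) w \<otimes> (if s then y else inv y)"
      by (simp add: x y_def gen_word_def G_def Phi2_41_def)
    then show ?case
      using yS[OF snoc] S_pow[OF y yS snoc] inv_pow[OF y n] by (cases s) auto
  qed
  have "S \<subseteq> (\<lambda>(i, j). a [^] i \<otimes> b [^] j) ` ({..<p ^ 4} \<times> {..<p})"
  proof
    fix x assume "x \<in> S"
    then obtain i j :: nat where x: "x = a [^] i \<otimes> b [^] j" by (auto simp: S_def)
    have pow_mod: "y [^] m = y [^] (m mod n)" if "y \<in> carrier G" "y [^] n = \<one>" for y and m n :: nat
    proof -
      have "y [^] m = y [^] (n * (m div n) + m mod n)" by simp
      also have "\<dots> = (y [^] n) [^] (m div n) \<otimes> y [^] (m mod n)"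
        using that(1) by (simp only: nat_pow_mult[symmetric] nat_pow_pow)
      finally show ?thesis using that by simp
    qed
    have "x = a [^] (i mod p ^ 4) \<otimes> b [^] (j mod p)"
      unfolding x by (intro arg_cong2[where f = "(\<otimes>)"] pow_mod a4 facts)
    then show "x \<in> (\<lambda>(i, j). a [^] i \<otimes> b [^] j) ` ({..<p ^ 4} \<times> {..<p})"
      using \<open>p > 0\<close> by (intro image_eqI[of _ _ "(i mod p ^ 4, j mod p)"]) auto
  qed
  moreover have "carrier G \<subseteq> S"
    using S_all by (auto simp: G_def Phi2_41_def presented_group_carrier)
  ultimately show ?thesis by auto
qed

theorem order_Phi2_41:
  assumes "p > 1"
  shows "Coset.order (Phi2_41 p) = p ^ 5"
proof (rule antisym)
  let ?a = "pres_class (Phi2_41_relations p) (gen_word gen_\<alpha>)"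
  let ?b = "pres_class (Phi2_41_relations p) (gen_word gen_\<alpha>1)"
  note nf = Phi2_41_normal_form[of p]
  have fin: "finite (carrier (Phi2_41 p))"
    using nf assms by simp
  have "card (carrier (Phi2_41 p)) \<le> card ({..<p ^ 4} \<times> {..<p})"
    unfolding nf[OF order.strict_trans[OF zero_less_one assms]] by (rule card_image_le) simp
  also have "\<dots> = p ^ 5"
    by (simp add: card_cartesian_product eval_nat_numeral)
  finally show "Coset.order (Phi2_41 p) \<le> p ^ 5"
    by (simp add: Coset.order_def)
  define H where "H = Phi2_41_model (int p)"
  interpret H: group H
    unfolding H_def using assms by (intro group_Phi2_41_model) simp
  define f where "f g = (case g of gen_\<alpha> \<Rightarrow> (1, 0) | gen_\<alpha>1 \<Rightarrow> (0, 1) | gen_\<alpha>2 \<Rightarrow> (int p ^ 3, 0 :: int))"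
    for g
  have p34: "int p ^ 3 < int p ^ 4" "1 < int p ^ 4"
    using assms by (simp_all add: power_strict_increasing)
  have f_closed: "f g \<in> carrier H" for g
    using assms p34 by (cases g) (auto simp: f_def H_def Phi2_41_model_def)
  then have f: "range f \<subseteq> carrier H" by auto
  have a_pow: "(1, 0) [^]\<^bsub>H\<^esub> n = (int n mod int p ^ 4, 0)" for n :: nat
    by (induction n) (auto simp: H_def Phi2_41_model_def nat_pow_def mod_simps add.commute)
  have b_pow: "(0, 1) [^]\<^bsub>H\<^esub> n = (0, int n mod int p)" for n :: nat
    by (induction n) (auto simp: H_def Phi2_41_model_def nat_pow_def mod_simps add.commute)
  have c_pow: "(int p ^ 3, 0) [^]\<^bsub>H\<^esub> n = (int n * int p ^ 3 mod int p ^ 4, 0)" for n :: nat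
    by (induction n) (auto simp: H_def Phi2_41_model_def nat_pow_def mod_simps algebra_simps)
  have comm: "inv\<^bsub>H\<^esub> x \<otimes>\<^bsub>H\<^esub> (inv\<^bsub>H\<^esub> y \<otimes>\<^bsub>H\<^esub> (x \<otimes>\<^bsub>H\<^esub> y)) = z"
    if "x \<otimes>\<^bsub>H\<^esub> y = y \<otimes>\<^bsub>H\<^esub> (x \<otimes>\<^bsub>H\<^esub> z)" "x \<in> carrier H" "y \<in> carrier H" "z \<in> carrier H" for x y z
  proof -
    have cancel: "inv\<^bsub>H\<^esub> w \<otimes>\<^bsub>H\<^esub> (w \<otimes>\<^bsub>H\<^esub> t) = t" if "w \<in> carrier H" "t \<in> carrier H" for w t
      using that by (simp add: H.m_assoc[symmetric])
    show ?thesis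
      using that(2-4) by (simp add: that(1) cancel)
  qed
  have p6: "(x + int p ^ 3 * int p ^ 3) mod int p ^ 4 = x mod int p ^ 4" for x
  proof -
    have "x + int p ^ 3 * int p ^ 3 = x + int p ^ 2 * int p ^ 4"
      by (simp flip: power_add)
    then show ?thesis by (simp only: mod_mult_self1)
  qed
  have comm1: "inv\<^bsub>H\<^esub> (0, 1) \<otimes>\<^bsub>H\<^esub> (inv\<^bsub>H\<^esub> (1, 0) \<otimes>\<^bsub>H\<^esub> ((0, 1) \<otimes>\<^bsub>H\<^esub> (1, 0))) = (int p ^ 3, 0)"
    using f_closed[of gen_\<alpha>] f_closed[of gen_\<alpha>1] f_closed[of gen_\<alpha>2] assms p34 p6[of "1 + int p ^ 3"]
    by (intro comm) (auto simp: f_def H_def Phi2_41_model_def mod_simps add.assoc)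
  have comm2: "inv\<^bsub>H\<^esub> (int p ^ 3, 0) \<otimes>\<^bsub>H\<^esub> (inv\<^bsub>H\<^esub> (1, 0) \<otimes>\<^bsub>H\<^esub> ((int p ^ 3, 0) \<otimes>\<^bsub>H\<^esub> (1, 0))) = \<one>\<^bsub>H\<^esub>"
    using f_closed[of gen_\<alpha>] f_closed[of gen_\<alpha>2]
    by (intro comm) (auto simp: f_def H_def Phi2_41_model_def mod_simps add.commute)
  have comm3: "inv\<^bsub>H\<^esub> (int p ^ 3, 0) \<otimes>\<^bsub>H\<^esub> (inv\<^bsub>H\<^esub> (0, 1) \<otimes>\<^bsub>H\<^esub> ((int p ^ 3, 0) \<otimes>\<^bsub>H\<^esub> (0, 1))) = \<one>\<^bsub>H\<^esub>"
    using f_closed[of gen_\<alpha>1] f_closed[of gen_\<alpha>2] p6[of "int p ^ 3"]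
    by (intro comm) (auto simp: f_def H_def Phi2_41_model_def mod_simps)
  have one: "\<one>\<^bsub>H\<^esub> = (0, 0)" by (simp add: H_def Phi2_41_model_def)
  have "word_value H f u = word_value H f v" if "(u, v) \<in> Phi2_41_relations p" for u v
  proof -
    have val: "word_value H f (gen_word gen_\<alpha>) = (1, 0)" "word_value H f (gen_word gen_\<alpha>1) = (0, 1)"
      "word_value H f (gen_word gen_\<alpha>2) = (int p ^ 3, 0)"
      using f by (simp_all add: H.word_value_gen) (simp_all add: f_def)
    have pow: "(1, 0) [^]\<^bsub>H\<^esub> (p ^ 3) = (int p ^ 3, 0)" "(0, 1) [^]\<^bsub>H\<^esub> p = \<one>\<^bsub>H\<^esub>"
      "(int p ^ 3, 0) [^]\<^bsub>H\<^esub> p = \<one>\<^bsub>H\<^esub>"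
      using p34 unfolding a_pow b_pow c_pow one by (simp_all flip: power_Suc)
    show ?thesis
      using that unfolding Phi2_41_relations_def Let_def
      by (auto simp only: insert_iff empty_iff prod.inject H.word_value_comm[OF f]
        H.word_value_pow[OF f] H.word_value_Nil val pow comm1 comm2 comm3)
  qed
  then obtain h where h: "h \<in> hom (Phi2_41 p) H"
    "\<And>w. h (pres_class (Phi2_41_relations p) w) = word_value H f w"
    using presented_group_universal[OF H.group_axioms f] unfolding Phi2_41_def by metis
  have "carrier H \<subseteq> h ` carrier (Phi2_41 p)"
  proof
    fix x assume x: "x \<in> carrier H"
    obtain i j where ij: "x = (i, j)" by (cases x)
    let ?w = "pow_word (gen_word gen_\<alpha>) (nat i) @ pow_word (gen_word gen_\<alpha>1) (nat j)"
    have "word_value H f ?w = x"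
      using f x by (auto simp: ij H.word_value_append H.word_value_pow H.word_value_gen f_def a_pow b_pow)
        (auto simp: H_def Phi2_41_model_def)
    then have "x = h (pres_class (Phi2_41_relations p) ?w)" by (simp add: h)
    then show "x \<in> h ` carrier (Phi2_41 p)"
      by (auto simp: Phi2_41_def presented_group_carrier)
  qed
  then have "card (carrier H) \<le> card (carrier (Phi2_41 p))"
    using fin by (meson card_image_le card_mono finite_imageI le_trans)
  then show "p ^ 5 \<le> Coset.order (Phi2_41 p)"
    using assms order_Phi2_41_model[of p] by (simp add: Coset.order_def H_def)
qed

section \<open>Galois extensions and realizability\<close>

definition algebraic_over_set :: "'l::field set \<Rightarrow> 'l \<Rightarrow> bool" where
  "algebraic_over_set K x \<longleftrightarrow>
    (\<exists>P. P \<noteq> 0 \<and> (\<forall>i. Polynomial.coeff P i \<in> K) \<and> Polynomial.poly P x = 0)"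

definition galois_aut :: "'l::field set \<Rightarrow> 'l set \<Rightarrow> ('l \<Rightarrow> 'l) set" where
  "galois_aut K M =
    {\<sigma> \<in> Bij M. (\<forall>x\<in>M. \<forall>y\<in>M. \<sigma> (x + y) = \<sigma> x + \<sigma> y \<and> \<sigma> (x * y) = \<sigma> x * \<sigma> y) \<and> (\<forall>x\<in>K. \<sigma> x = x)}"

definition galois_group :: "'l::field set \<Rightarrow> 'l set \<Rightarrow> ('l \<Rightarrow> 'l) monoid" where
  "galois_group K M = BijGroup M \<lparr>carrier := galois_aut K M\<rparr>"

text \<open>\<open>M/K\<close> is Galois: algebraic, and the fixed field of all \<open>K\<close>-automorphisms is \<open>K\<close>.\<close>

definition galois_extension :: "'l::field set \<Rightarrow> 'l set \<Rightarrow> bool" where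
  "galois_extension K M \<longleftrightarrow>
    subfield K (ring_of_type_algebra :: 'l ring) \<and> subfield M (ring_of_type_algebra :: 'l ring) \<and>
    K \<subseteq> M \<and> (\<forall>x\<in>M. algebraic_over_set K x) \<and>
    {x \<in> M. \<forall>\<sigma>\<in>galois_aut K M. \<sigma> x = x} = K"

text \<open>The field \<open>k\<close> is the type \<open>'k\<close>, embedded in its algebraic closure by \<open>to_ac\<close>. A Galois
  extension of \<open>k\<close> is algebraic, hence \<open>k\<close>-isomorphic to a subfield of that closure; so it
  suffices to let \<open>M\<close> range over those subfields.\<close>

definition realizable_as_galois_group :: "'k::field itself \<Rightarrow> ('g, 'm) monoid_scheme \<Rightarrow> bool" where
  "realizable_as_galois_group k G \<longleftrightarrow>
    (\<exists>M :: 'k alg_closure set. galois_extension (range to_ac) M \<and> galois_group (range to_ac) M \<cong> G)"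

lemma group_galois_group:
  assumes M: "subfield M (ring_of_type_algebra :: 'l::field ring)" and "K \<subseteq> M"
  shows "group (galois_group K M)"
proof -
  interpret M: subfield M "ring_of_type_algebra :: 'l ring" by fact
  have closed: "x + y \<in> M" "x * y \<in> M" if "x \<in> M" "y \<in> M" for x y
    using that subringE(6,7)[OF M.subring_axioms, of x y] by (simp_all add: ring_of_type_algebra_def)
  interpret B: group "BijGroup M" by (rule group_BijGroup)
  have Bij: "\<sigma> x \<in> M" if "\<sigma> \<in> Bij M" "x \<in> M" for \<sigma> x
    using that Bij_imp_funcset by blast
  have "subgroup (galois_aut K M) (BijGroup M)"
  proof
    show "galois_aut K M \<subseteq> carrier (BijGroup M)"
      by (auto simp: galois_aut_def BijGroup_def)
    show "\<one>\<^bsub>BijGroup M\<^esub> \<in> galois_aut K M"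
      using closed \<open>K \<subseteq> M\<close> id_Bij by (auto simp: galois_aut_def BijGroup_def)
    show "\<sigma> \<otimes>\<^bsub>BijGroup M\<^esub> \<tau> \<in> galois_aut K M"
      if "\<sigma> \<in> galois_aut K M" "\<tau> \<in> galois_aut K M" for \<sigma> \<tau>
      using that closed \<open>K \<subseteq> M\<close> Bij compose_Bij
      by (auto simp: galois_aut_def BijGroup_def compose_def subset_iff)
    show "inv\<^bsub>BijGroup M\<^esub> \<sigma> \<in> galois_aut K M" if "\<sigma> \<in> galois_aut K M" for \<sigma>
    proof -
      have \<sigma>: "\<sigma> \<in> Bij M" using that by (simp add: galois_aut_def)
      have inj: "inj_on \<sigma> M" using \<sigma> by (auto simp: Bij_def bij_betw_def)
      have "inv_into M \<sigma> (x + y) = inv_into M \<sigma> x + inv_into M \<sigma> y"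
        "inv_into M \<sigma> (x * y) = inv_into M \<sigma> x * inv_into M \<sigma> y" if "x \<in> M" "y \<in> M" for x y
        using \<open>\<sigma> \<in> galois_aut K M\<close> that closed \<sigma>
        by (intro Bij_inv_into_lemma; auto simp: galois_aut_def)+
      moreover have "inv_into M \<sigma> x = x" if "x \<in> K" for x
        using that \<open>\<sigma> \<in> galois_aut K M\<close> \<open>K \<subseteq> M\<close> inj
        by (intro inv_into_f_eq) (auto simp: galois_aut_def)
      ultimately show ?thesis
        using closed \<open>K \<subseteq> M\<close> restrict_inv_into_Bij[OF \<sigma>]
        by (auto simp: inv_BijGroup[OF \<sigma>] galois_aut_def)
    qed
  qed
  then show ?thesis
    unfolding galois_group_def by (rule B.subgroup_imp_group)
qed

section \<open>Roots of unity and independence modulo \<open>p\<close>-th powers\<close>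

definition primitive_root_of_unity :: "nat \<Rightarrow> 'k::field \<Rightarrow> bool" where
  "primitive_root_of_unity n z \<longleftrightarrow> n > 0 \<and> z ^ n = 1 \<and> (\<forall>m. 0 < m \<and> m < n \<longrightarrow> z ^ m \<noteq> 1)"

text \<open>Linear independence over \<open>\<int>/p\<close> of the classes in \<open>k\<^sup>\<times> / k\<^sup>\<times>\<^sup>p\<close>, written
  multiplicatively; the scalars are represented by integer exponents.\<close>

definition independent_mod_powers :: "nat \<Rightarrow> 'k::field list \<Rightarrow> bool" where
  "independent_mod_powers p as \<longleftrightarrow>
    0 \<notin> set as \<and>
    (\<forall>e :: nat \<Rightarrow> int. (\<exists>c. c \<noteq> 0 \<and> (\<Prod>i<length as. (as ! i) powi e i) = c ^ p) \<longrightarrow>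
      (\<forall>i<length as. int p dvd e i))"

section \<open>Brauer equivalence\<close>

text \<open>A \<open>k\<close>-algebra, with \<open>k\<close> the type \<open>'k\<close>, is a record of type \<open>('k, 'a) module\<close>.\<close>

definition algebra_iso :: "('k, 'a) module \<Rightarrow> ('k, 'b) module \<Rightarrow> bool" where
  "algebra_iso A B \<longleftrightarrow>
    (\<exists>h\<in>ring_iso A B. \<forall>c. \<forall>x\<in>carrier A. h (c \<odot>\<^bsub>A\<^esub> x) = c \<odot>\<^bsub>B\<^esub> h x)"

definition matrix_algebra :: "nat \<Rightarrow> ('k, 'a) module \<Rightarrow> ('k, nat \<times> nat \<Rightarrow> 'a) module" where
  "matrix_algebra n A =
    \<lparr>carrier = ({..<n} \<times> {..<n}) \<rightarrow>\<^sub>E carrier A,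
     monoid.mult = (\<lambda>B C. restrict (\<lambda>(i, j). \<Oplus>\<^bsub>A\<^esub>l\<in>{..<n}. B (i, l) \<otimes>\<^bsub>A\<^esub> C (l, j)) ({..<n} \<times> {..<n})),
     one = restrict (\<lambda>(i, j). if i = j then \<one>\<^bsub>A\<^esub> else \<zero>\<^bsub>A\<^esub>) ({..<n} \<times> {..<n}),
     ring.zero = (\<lambda>_\<in>{..<n} \<times> {..<n}. \<zero>\<^bsub>A\<^esub>),
     ring.add = (\<lambda>B C. \<lambda>t\<in>{..<n} \<times> {..<n}. B t \<oplus>\<^bsub>A\<^esub> C t),
     module.smult = (\<lambda>c B. \<lambda>t\<in>{..<n} \<times> {..<n}. c \<odot>\<^bsub>A\<^esub> B t)\<rparr>"

definition base_algebra :: "('k::field, 'k) module" where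
  "base_algebra =
    \<lparr>carrier = UNIV, monoid.mult = (*), one = 1, ring.zero = 0, ring.add = (+), module.smult = (*)\<rparr>"

text \<open>\<open>A \<otimes> M\<^sub>m(k) = M\<^sub>m(A)\<close>, so this is the relation whose classes (of central simple
  algebras) are the elements of \<open>Br(k)\<close>.\<close>

definition brauer_equivalent :: "('k, 'a) module \<Rightarrow> ('k, 'b) module \<Rightarrow> bool" where
  "brauer_equivalent A B \<longleftrightarrow>
    (\<exists>m n. m > 0 \<and> n > 0 \<and> algebra_iso (matrix_algebra m A) (matrix_algebra n B))"

text \<open>The class of \<open>A\<close> is \<open>1\<close> in \<open>Br(k)\<close>, i.e. it equals the class of \<open>k\<close>.\<close>

definition brauer_trivial :: "('k::field, 'a) module \<Rightarrow> bool" where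
  "brauer_trivial A \<longleftrightarrow> brauer_equivalent A (base_algebra :: ('k, 'k) module)"

section \<open>Cyclic algebras\<close>

text \<open>The function \<open>f\<close> stands for \<open>\<Sum> f (r, s) i\<^sub>2\<^sup>r i\<^sub>1\<^sup>s\<close>, with \<open>r, s < p\<close>. The structure
  constants come from
  \<open>(i\<^sub>2\<^sup>r i\<^sub>1\<^sup>s) (i\<^sub>2\<^sup>u i\<^sub>1\<^sup>v) = \<zeta>\<^sup>s\<^sup>u i\<^sub>2\<^sup>r\<^sup>+\<^sup>u i\<^sub>1\<^sup>s\<^sup>+\<^sup>v\<close> together with \<open>i\<^sub>2\<^sup>p = a\<close> and \<open>i\<^sub>1\<^sup>p = b\<close>.\<close>

definition cyclic_coeff :: "nat \<Rightarrow> 'k::field \<Rightarrow> 'k \<Rightarrow> 'k \<Rightarrow> nat \<times> nat \<Rightarrow> nat \<times> nat \<Rightarrow> 'k" where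
  "cyclic_coeff p a b \<zeta> = (\<lambda>(r, s) (u, v). \<zeta> ^ (s * u) * a ^ ((r + u) div p) * b ^ ((s + v) div p))"

definition cyclic_index :: "nat \<Rightarrow> nat \<times> nat \<Rightarrow> nat \<times> nat \<Rightarrow> nat \<times> nat" where
  "cyclic_index p = (\<lambda>(r, s) (u, v). ((r + u) mod p, (s + v) mod p))"

definition cyclic_algebra ::
  "nat \<Rightarrow> 'k::field \<Rightarrow> 'k \<Rightarrow> 'k \<Rightarrow> ('k, nat \<times> nat \<Rightarrow> 'k) module" where
  "cyclic_algebra p a b \<zeta> =
    \<lparr>carrier = {f. \<forall>t. t \<notin> {..<p} \<times> {..<p} \<longrightarrow> f t = 0},
     monoid.mult = (\<lambda>f g t. \<Sum>x\<in>{..<p} \<times> {..<p}. \<Sum>y\<in>{..<p} \<times> {..<p}.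
        if cyclic_index p x y = t then cyclic_coeff p a b \<zeta> x y * f x * g y else 0),
     one = (\<lambda>t. if t = (0, 0) then 1 else 0),
     ring.zero = (\<lambda>t. 0),
     ring.add = (\<lambda>f g t. f t + g t),
     module.smult = (\<lambda>c f t. c * f t)\<rparr>"

definition cyclic_i1 :: "nat \<times> nat \<Rightarrow> 'k::field" where
  "cyclic_i1 = (\<lambda>t. if t = (0, 1) then 1 else 0)"

definition cyclic_i2 :: "nat \<times> nat \<Rightarrow> 'k::field" where
  "cyclic_i2 = (\<lambda>t. if t = (1, 0) then 1 else 0)"

definition cyclic_basis :: "nat \<times> nat \<Rightarrow> nat \<times> nat \<Rightarrow> 'k::field" where
  "cyclic_basis x = (\<lambda>t. if t = x then 1 else 0)"

lemma cyclic_index_in [simp]: "p > 0 \<Longrightarrow> cyclic_index p x y \<in> {..<p} \<times> {..<p}"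
  by (simp add: cyclic_index_def case_prod_beta mem_Times_iff)

lemma cyclic_index_assoc:
  "cyclic_index p (cyclic_index p x y) z = cyclic_index p x (cyclic_index p y z)"
  by (simp add: cyclic_index_def case_prod_beta mod_simps add.assoc)

lemma power_mod_root: "(\<zeta> :: 'k::field) ^ p = 1 \<Longrightarrow> \<zeta> ^ (m mod p) = \<zeta> ^ m"
proof -
  assume "\<zeta> ^ p = 1"
  then have "\<zeta> ^ (p * (m div p) + m mod p) = \<zeta> ^ (m mod p)"
    by (simp only: power_add power_mult power_one mult_1)
  then show ?thesis by simp
qed

lemma add_div_carry: "(r + u) div p + ((r + u) mod p + w) div p = (r + u + w :: nat) div p"
  by (cases "p = 0") (simp, metis add.commute div_mult_self4 mod_mult_div_eq add.assoc)

lemma cyclic_coeff_cocycle: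
  assumes "\<zeta> ^ p = 1"
  shows "cyclic_coeff p a b \<zeta> x y * cyclic_coeff p a b \<zeta> (cyclic_index p x y) z =
    cyclic_coeff p a b \<zeta> y z * cyclic_coeff p a b \<zeta> x (cyclic_index p y z)"
proof -
  obtain r s u v w t where [simp]: "x = (r, s)" "y = (u, v)" "z = (w, t)" by (metis surj_pair)
  have z1: "\<zeta> ^ ((s + v) mod p * w) = \<zeta> ^ ((s + v) * w)"
    using power_mod_root[OF assms] by (metis power_mult)
  have z2: "\<zeta> ^ (s * ((u + w) mod p)) = \<zeta> ^ (s * (u + w))"
    using power_mod_root[OF assms] by (metis power_mult mult.commute)
  have q: "q ^ ((m + n) div p) * q ^ (((m + n) mod p + l) div p) =
      q ^ ((n + l) div p) * q ^ ((m + (n + l) mod p) div p)" for q :: 'a and m n l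
    by (simp only: power_add[symmetric] add_div_carry)
      (metis add_div_carry add.commute add.assoc)
  have "cyclic_coeff p a b \<zeta> x y * cyclic_coeff p a b \<zeta> (cyclic_index p x y) z =
     (\<zeta> ^ (s * u) * \<zeta> ^ ((s + v) * w)) *
     (a ^ ((r + u) div p) * a ^ (((r + u) mod p + w) div p)) *
     (b ^ ((s + v) div p) * b ^ (((s + v) mod p + t) div p))"
    by (simp add: cyclic_coeff_def cyclic_index_def z1)
  also have "\<dots> = (\<zeta> ^ (v * w) * \<zeta> ^ (s * (u + w))) *
     (a ^ ((u + w) div p) * a ^ ((r + (u + w) mod p) div p)) *
     (b ^ ((v + t) div p) * b ^ ((s + (v + t) mod p) div p))"
    unfolding q by (simp add: algebra_simps power_add)
  also have "\<dots> = cyclic_coeff p a b \<zeta> y z * cyclic_coeff p a b \<zeta> x (cyclic_index p y z)"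
    by (simp add: cyclic_coeff_def cyclic_index_def z2)
  finally show ?thesis .
qed

context
  fixes p :: nat and a b \<zeta> :: "'k::field"
  assumes p: "p > 0" and \<zeta>: "\<zeta> ^ p = 1"
begin

lemma cyclic_algebra_mult:
  "(f \<otimes>\<^bsub>cyclic_algebra p a b \<zeta>\<^esub> g) t = (\<Sum>x\<in>{..<p} \<times> {..<p}. \<Sum>y\<in>{..<p} \<times> {..<p}.
     if cyclic_index p x y = t then cyclic_coeff p a b \<zeta> x y * f x * g y else 0)"
  by (simp add: cyclic_algebra_def)

lemma cyclic_algebra_assoc:
  "f \<otimes>\<^bsub>cyclic_algebra p a b \<zeta>\<^esub> g \<otimes>\<^bsub>cyclic_algebra p a b \<zeta>\<^esub> h =
   f \<otimes>\<^bsub>cyclic_algebra p a b \<zeta>\<^esub> (g \<otimes>\<^bsub>cyclic_algebra p a b \<zeta>\<^esub> h)"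
proof
  fix t
  let ?A = "cyclic_algebra p a b \<zeta>" and ?I = "{..<p} \<times> {..<p}"
  let ?c = "cyclic_coeff p a b \<zeta>" and ?op = "cyclic_index p"
  have "(f \<otimes>\<^bsub>?A\<^esub> g \<otimes>\<^bsub>?A\<^esub> h) t = (\<Sum>w\<in>?I. \<Sum>z\<in>?I. \<Sum>x\<in>?I. \<Sum>y\<in>?I.
      if ?op x y = w then (if ?op w z = t then ?c w z * (?c x y * f x * g y) * h z else 0) else 0)"
    unfolding cyclic_algebra_mult
  proof (intro sum.cong HOL.refl)
    fix w z
    show "(if ?op w z = t then ?c w z * (\<Sum>x\<in>?I. \<Sum>y\<in>?I. if ?op x y = w then ?c x y * f x * g y else 0) * h z else 0) =
      (\<Sum>x\<in>?I. \<Sum>y\<in>?I. if ?op x y = w then (if ?op w z = t then ?c w z * (?c x y * f x * g y) * h z else 0) else 0)"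
      by (cases "?op w z = t")
        (simp_all add: sum_distrib_left sum_distrib_right if_distrib[of "\<lambda>q. _ * q"] if_distrib[of "\<lambda>q. q * _"] cong: if_cong)
  qed
  also have "\<dots> = (\<Sum>z\<in>?I. \<Sum>x\<in>?I. \<Sum>w\<in>?I. \<Sum>y\<in>?I.
      if ?op x y = w then (if ?op w z = t then ?c w z * (?c x y * f x * g y) * h z else 0) else 0)"
    by (subst sum.swap) (intro sum.cong HOL.refl sum.swap)
  also have "\<dots> = (\<Sum>z\<in>?I. \<Sum>x\<in>?I. \<Sum>y\<in>?I. \<Sum>w\<in>?I.
      if ?op x y = w then (if ?op w z = t then ?c w z * (?c x y * f x * g y) * h z else 0) else 0)"
    by (intro sum.cong HOL.refl sum.swap)
  also have "\<dots> = (\<Sum>z\<in>?I. \<Sum>x\<in>?I. \<Sum>y\<in>?I. if ?op (?op x y) z = t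
      then (?c x y * ?c (?op x y) z) * f x * g y * h z else 0)"
    using p by (intro sum.cong HOL.refl) (subst sum.delta', auto simp: mult_ac)
  also have "\<dots> = (\<Sum>x\<in>?I. \<Sum>z\<in>?I. \<Sum>y\<in>?I. if ?op (?op x y) z = t
      then (?c x y * ?c (?op x y) z) * f x * g y * h z else 0)"
    by (rule sum.swap)
  also have "\<dots> = (\<Sum>x\<in>?I. \<Sum>y\<in>?I. \<Sum>z\<in>?I. if ?op x (?op y z) = t
      then (?c y z * ?c x (?op y z)) * f x * g y * h z else 0)"
    unfolding cyclic_coeff_cocycle[OF \<zeta>] cyclic_index_assoc by (intro sum.cong HOL.refl sum.swap)
  also have "\<dots> = (\<Sum>x\<in>?I. \<Sum>y\<in>?I. \<Sum>z\<in>?I. \<Sum>w\<in>?I.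
      if ?op y z = w then (if ?op x w = t then ?c x w * f x * (?c y z * g y * h z) else 0) else 0)"
    using p by (intro sum.cong HOL.refl) (subst sum.delta', auto simp: mult_ac)
  also have "\<dots> = (\<Sum>x\<in>?I. \<Sum>y\<in>?I. \<Sum>w\<in>?I. \<Sum>z\<in>?I.
      if ?op y z = w then (if ?op x w = t then ?c x w * f x * (?c y z * g y * h z) else 0) else 0)"
    by (intro sum.cong HOL.refl sum.swap)
  also have "\<dots> = (\<Sum>x\<in>?I. \<Sum>w\<in>?I. \<Sum>y\<in>?I. \<Sum>z\<in>?I.
      if ?op y z = w then (if ?op x w = t then ?c x w * f x * (?c y z * g y * h z) else 0) else 0)"
    by (intro sum.cong HOL.refl sum.swap)
  also have "\<dots> = (f \<otimes>\<^bsub>?A\<^esub> (g \<otimes>\<^bsub>?A\<^esub> h)) t"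
    unfolding cyclic_algebra_mult
  proof (intro sum.cong HOL.refl)
    fix x w
    show "(\<Sum>y\<in>?I. \<Sum>z\<in>?I. if ?op y z = w then (if ?op x w = t then ?c x w * f x * (?c y z * g y * h z) else 0) else 0) =
      (if ?op x w = t then ?c x w * f x * (\<Sum>y\<in>?I. \<Sum>z\<in>?I. if ?op y z = w then ?c y z * g y * h z else 0) else 0)"
      by (cases "?op x w = t")
        (simp_all add: sum_distrib_left if_distrib[of "\<lambda>q. _ * q"] cong: if_cong)
  qed
  finally show "(f \<otimes>\<^bsub>?A\<^esub> g \<otimes>\<^bsub>?A\<^esub> h) t = (f \<otimes>\<^bsub>?A\<^esub> (g \<otimes>\<^bsub>?A\<^esub> h)) t" .
qed

lemma cyclic_basis_mult:
  assumes "x \<in> {..<p} \<times> {..<p}" "y \<in> {..<p} \<times> {..<p}"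
  shows "cyclic_basis x \<otimes>\<^bsub>cyclic_algebra p a b \<zeta>\<^esub> cyclic_basis y =
    cyclic_coeff p a b \<zeta> x y \<odot>\<^bsub>cyclic_algebra p a b \<zeta>\<^esub> cyclic_basis (cyclic_index p x y)"
proof
  fix t
  let ?I = "{..<p} \<times> {..<p}"
  have "(cyclic_basis x \<otimes>\<^bsub>cyclic_algebra p a b \<zeta>\<^esub> cyclic_basis y) t =
    (\<Sum>x'\<in>?I. \<Sum>y'\<in>?I. if y' = y then (if x' = x then
       (if cyclic_index p x y = t then cyclic_coeff p a b \<zeta> x y else 0) else 0) else 0)"
    unfolding cyclic_algebra_mult by (intro sum.cong HOL.refl) (auto simp: cyclic_basis_def)
  also have "\<dots> = (if cyclic_index p x y = t then cyclic_coeff p a b \<zeta> x y else 0)"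
    using assms by (simp add: sum.delta)
  finally show "(cyclic_basis x \<otimes>\<^bsub>cyclic_algebra p a b \<zeta>\<^esub> cyclic_basis y) t =
    (cyclic_coeff p a b \<zeta> x y \<odot>\<^bsub>cyclic_algebra p a b \<zeta>\<^esub> cyclic_basis (cyclic_index p x y)) t"
    by (auto simp: cyclic_algebra_def cyclic_basis_def)
qed

lemma cyclic_algebra_ring: "ring (cyclic_algebra p a b \<zeta>)"
proof (rule ringI)
  let ?A = "cyclic_algebra p a b \<zeta>" and ?I = "{..<p} \<times> {..<p}"
  show "abelian_group ?A"
  proof (rule abelian_groupI)
    fix f assume "f \<in> carrier ?A"
    then show "\<exists>g\<in>carrier ?A. g \<oplus>\<^bsub>?A\<^esub> f = \<zero>\<^bsub>?A\<^esub>"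
      by (intro bexI[of _ "\<lambda>t. - f t"]) (auto simp: cyclic_algebra_def)
  qed (auto simp: cyclic_algebra_def add_ac)
  show "monoid ?A"
  proof (rule monoidI)
    fix f assume f: "f \<in> carrier ?A"
    have "(\<one>\<^bsub>?A\<^esub> \<otimes>\<^bsub>?A\<^esub> f) t = f t" for t
    proof -
      have "(\<one>\<^bsub>?A\<^esub> \<otimes>\<^bsub>?A\<^esub> f) t = (\<Sum>x\<in>?I. \<Sum>y\<in>?I. if y = t then (if x = (0, 0) then f t else 0) else 0)"
        unfolding cyclic_algebra_mult
        by (intro sum.cong HOL.refl)
          (auto simp: cyclic_algebra_def cyclic_coeff_def cyclic_index_def)
      also have "\<dots> = (if t \<in> ?I then f t else 0)"
        using p by (auto simp: sum.delta)
      also have "\<dots> = f t" using f by (cases t) (auto simp: cyclic_algebra_def)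
      finally show ?thesis .
    qed
    then show "\<one>\<^bsub>?A\<^esub> \<otimes>\<^bsub>?A\<^esub> f = f" ..
    have "(f \<otimes>\<^bsub>?A\<^esub> \<one>\<^bsub>?A\<^esub>) t = f t" for t
    proof -
      have "(f \<otimes>\<^bsub>?A\<^esub> \<one>\<^bsub>?A\<^esub>) t = (\<Sum>x\<in>?I. \<Sum>y\<in>?I. if y = (0, 0) then (if x = t then f t else 0) else 0)"
        unfolding cyclic_algebra_mult
        by (intro sum.cong HOL.refl)
          (auto simp: cyclic_algebra_def cyclic_coeff_def cyclic_index_def)
      also have "\<dots> = (if t \<in> ?I then f t else 0)"
        using p by (auto simp: sum.delta)
      also have "\<dots> = f t" using f by (cases t) (auto simp: cyclic_algebra_def)
      finally show ?thesis .
    qed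
    then show "f \<otimes>\<^bsub>?A\<^esub> \<one>\<^bsub>?A\<^esub> = f" ..
  next
    fix f g assume "f \<in> carrier ?A" "g \<in> carrier ?A"
    have "cyclic_index p x y \<noteq> t" if "t \<notin> ?I" for x y t
      using cyclic_index_in[OF p] that by metis
    then show "f \<otimes>\<^bsub>?A\<^esub> g \<in> carrier ?A"
      by (simp add: cyclic_algebra_def)
  next
    show "\<one>\<^bsub>?A\<^esub> \<in> carrier ?A" using p by (auto simp: cyclic_algebra_def)
  qed (rule cyclic_algebra_assoc)
  fix f g h
  show "(f \<oplus>\<^bsub>?A\<^esub> g) \<otimes>\<^bsub>?A\<^esub> h = f \<otimes>\<^bsub>?A\<^esub> h \<oplus>\<^bsub>?A\<^esub> g \<otimes>\<^bsub>?A\<^esub> h"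
    by (auto simp: cyclic_algebra_def fun_eq_iff sum.distrib[symmetric] algebra_simps intro!: sum.cong)
  show "h \<otimes>\<^bsub>?A\<^esub> (f \<oplus>\<^bsub>?A\<^esub> g) = h \<otimes>\<^bsub>?A\<^esub> f \<oplus>\<^bsub>?A\<^esub> h \<otimes>\<^bsub>?A\<^esub> g"
    by (auto simp: cyclic_algebra_def fun_eq_iff sum.distrib[symmetric] algebra_simps intro!: sum.cong)
qed

lemma cyclic_algebra_smult_mult:
  "(c \<odot>\<^bsub>cyclic_algebra p a b \<zeta>\<^esub> f) \<otimes>\<^bsub>cyclic_algebra p a b \<zeta>\<^esub> g =
     c \<odot>\<^bsub>cyclic_algebra p a b \<zeta>\<^esub> (f \<otimes>\<^bsub>cyclic_algebra p a b \<zeta>\<^esub> g)"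
  "f \<otimes>\<^bsub>cyclic_algebra p a b \<zeta>\<^esub> (c \<odot>\<^bsub>cyclic_algebra p a b \<zeta>\<^esub> g) =
     c \<odot>\<^bsub>cyclic_algebra p a b \<zeta>\<^esub> (f \<otimes>\<^bsub>cyclic_algebra p a b \<zeta>\<^esub> g)"
  by (auto simp: cyclic_algebra_def fun_eq_iff sum_distrib_left mult_ac intro!: sum.cong)

lemma cyclic_power:
  assumes "p > 1" "m < p"
  shows "cyclic_i1 [^]\<^bsub>cyclic_algebra p a b \<zeta>\<^esub> m = cyclic_basis (0, m)"
    and "cyclic_i2 [^]\<^bsub>cyclic_algebra p a b \<zeta>\<^esub> m = cyclic_basis (m, 0)"
proof -
  let ?A = "cyclic_algebra p a b \<zeta>"
  interpret A: ring ?A by (rule cyclic_algebra_ring)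
  have one: "\<one>\<^bsub>?A\<^esub> = cyclic_basis (0, 0)" by (simp add: cyclic_algebra_def cyclic_basis_def)
  have i1: "cyclic_i1 = (cyclic_basis (0, 1) :: nat \<times> nat \<Rightarrow> 'k)"
    by (simp add: cyclic_i1_def cyclic_basis_def)
  have i2: "cyclic_i2 = (cyclic_basis (1, 0) :: nat \<times> nat \<Rightarrow> 'k)"
    by (simp add: cyclic_i2_def cyclic_basis_def)
  have smult_1: "1 \<odot>\<^bsub>?A\<^esub> f = f" for f by (simp add: cyclic_algebra_def)
  show "cyclic_i1 [^]\<^bsub>?A\<^esub> m = cyclic_basis (0, m)" using \<open>m < p\<close>
  proof (induction m)
    case (Suc m)
    then show ?case using \<open>p > 1\<close>
      by (simp add: A.nat_pow_Suc i1 cyclic_basis_mult cyclic_coeff_def cyclic_index_def smult_1)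
  qed (simp add: one)
  show "cyclic_i2 [^]\<^bsub>?A\<^esub> m = cyclic_basis (m, 0)" using \<open>m < p\<close>
  proof (induction m)
    case (Suc m)
    then show ?case using \<open>p > 1\<close>
      by (simp add: A.nat_pow_Suc i2 cyclic_basis_mult cyclic_coeff_def cyclic_index_def smult_1)
  qed (simp add: one)
qed

lemma cyclic_basis_eq_monomial:
  assumes "p > 1" "r < p" "s < p"
  shows "cyclic_basis (r, s) =
    cyclic_i2 [^]\<^bsub>cyclic_algebra p a b \<zeta>\<^esub> r \<otimes>\<^bsub>cyclic_algebra p a b \<zeta>\<^esub>
    cyclic_i1 [^]\<^bsub>cyclic_algebra p a b \<zeta>\<^esub> s"
  using assms p
  by (simp add: cyclic_power cyclic_basis_mult cyclic_coeff_def cyclic_index_def)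
    (simp add: cyclic_algebra_def)

lemma cyclic_relations:
  assumes "p > 1"
  shows "cyclic_i1 [^]\<^bsub>cyclic_algebra p a b \<zeta>\<^esub> p = b \<odot>\<^bsub>cyclic_algebra p a b \<zeta>\<^esub> \<one>\<^bsub>cyclic_algebra p a b \<zeta>\<^esub>"
    and "cyclic_i2 [^]\<^bsub>cyclic_algebra p a b \<zeta>\<^esub> p = a \<odot>\<^bsub>cyclic_algebra p a b \<zeta>\<^esub> \<one>\<^bsub>cyclic_algebra p a b \<zeta>\<^esub>"
    and "cyclic_i1 \<otimes>\<^bsub>cyclic_algebra p a b \<zeta>\<^esub> cyclic_i2 =
      \<zeta> \<odot>\<^bsub>cyclic_algebra p a b \<zeta>\<^esub> (cyclic_i2 \<otimes>\<^bsub>cyclic_algebra p a b \<zeta>\<^esub> cyclic_i1)"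
proof -
  let ?A = "cyclic_algebra p a b \<zeta>"
  interpret A: ring ?A by (rule cyclic_algebra_ring)
  have one: "\<one>\<^bsub>?A\<^esub> = cyclic_basis (0, 0)" by (simp add: cyclic_algebra_def cyclic_basis_def)
  have i1: "cyclic_i1 = (cyclic_basis (0, 1) :: nat \<times> nat \<Rightarrow> 'k)"
    by (simp add: cyclic_i1_def cyclic_basis_def)
  have i2: "cyclic_i2 = (cyclic_basis (1, 0) :: nat \<times> nat \<Rightarrow> 'k)"
    by (simp add: cyclic_i2_def cyclic_basis_def)
  obtain q where q: "p = Suc q" using p gr0_implies_Suc by blast
  have "x [^]\<^bsub>?A\<^esub> p = x [^]\<^bsub>?A\<^esub> q \<otimes>\<^bsub>?A\<^esub> x" for x by (simp add: q)
  moreover have "q < p" by (simp add: q)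
  moreover have "Suc q = p" by (simp add: q)
  ultimately show "cyclic_i1 [^]\<^bsub>?A\<^esub> p = b \<odot>\<^bsub>?A\<^esub> \<one>\<^bsub>?A\<^esub>" "cyclic_i2 [^]\<^bsub>?A\<^esub> p = a \<odot>\<^bsub>?A\<^esub> \<one>\<^bsub>?A\<^esub>"
    using \<open>p > 1\<close>
    by (simp_all add: cyclic_power one) (simp_all add: i1 i2 cyclic_basis_mult cyclic_coeff_def cyclic_index_def)
  show "cyclic_i1 \<otimes>\<^bsub>?A\<^esub> cyclic_i2 = \<zeta> \<odot>\<^bsub>?A\<^esub> (cyclic_i2 \<otimes>\<^bsub>?A\<^esub> cyclic_i1)"
    using \<open>p > 1\<close>
    by (simp add: i1 i2 cyclic_basis_mult cyclic_coeff_def cyclic_index_def)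
      (simp add: cyclic_algebra_def)
qed

end

end

theory Submission
  imports Defs
begin

text \<open>Suppose that \<open>s\<close> and \<open>t\<close> generate a Galois group \<open>\<Phi>\<^sub>2(41)\<close> over \<open>k\<close>, with \<open>s\<close>, \<open>t\<close> the images of
  \<open>\<alpha>\<close>, \<open>\<alpha>\<^sub>1\<close>. The commuting automorphisms \<open>s\<^sup>p\<close> and \<open>t\<close> have a common eigenvector \<open>y\<close> with \<open>s\<^sup>p y = z y\<close>,
  \<open>t y = y\<close>. Then \<open>y / s y\<close> is an element of \<open>k(\<beta>)\<close>, \<open>\<beta>\<^sup>p = a\<^sub>2\<close>, divided by a \<open>p\<close>-th root of some \<open>a\<^sub>1\<close>, and the
  product of its conjugates under \<open>s\<close> shows that \<open>z\<^sup>-\<^sup>1 a\<^sub>1\<close> is a norm from \<open>k(\<beta>)\<close>. Conversely, given such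
  a norm equation, Hilbert 90 provides \<open>\<theta>\<close> in \<open>k(\<beta>)\<close> such that adjoining \<open>\<beta>\<close>, a \<open>p\<close>-th root of \<open>a\<^sub>1\<close> and a
  \<open>p\<^sup>3\<close>-th root of \<open>\<theta>\<close> realizes the group; the degree is found by Kummer theory. Finally, the cyclic algebra
  of \<open>a\<close> and \<open>b\<close> is split if and only if \<open>a\<close> is a norm from \<open>k(b\<^sup>1\<^sup>/\<^sup>p)\<close>.\<close>

section \<open>Subfields, polynomials over them and embeddings\<close>

definition is_subfield :: "'a::field set \<Rightarrow> bool" where
  "is_subfield F \<longleftrightarrow> 1 \<in> F \<and> (\<forall>x\<in>F. \<forall>y\<in>F. x + y \<in> F \<and> x * y \<in> F) \<and> (\<forall>x\<in>F. - x \<in> F \<and> inverse x \<in> F)"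

context
  fixes F :: "'a::field set"
  assumes F: "is_subfield F"
begin

lemma is_subfield_one: "1 \<in> F"
  and is_subfield_add: "x \<in> F \<Longrightarrow> y \<in> F \<Longrightarrow> x + y \<in> F"
  and is_subfield_mult: "x \<in> F \<Longrightarrow> y \<in> F \<Longrightarrow> x * y \<in> F"
  and is_subfield_uminus: "x \<in> F \<Longrightarrow> - x \<in> F"
  and is_subfield_inverse: "x \<in> F \<Longrightarrow> inverse x \<in> F"
  using F by (auto simp: is_subfield_def)

lemma is_subfield_diff: "x \<in> F \<Longrightarrow> y \<in> F \<Longrightarrow> x - y \<in> F"
  using is_subfield_add[of x "- y"] is_subfield_uminus by simp

lemma is_subfield_divide: "x \<in> F \<Longrightarrow> y \<in> F \<Longrightarrow> x / y \<in> F"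
  by (simp add: divide_inverse is_subfield_mult is_subfield_inverse)

lemma is_subfield_zero: "0 \<in> F"
  using is_subfield_diff[OF is_subfield_one is_subfield_one] by simp

lemma is_subfield_power: "x \<in> F \<Longrightarrow> x ^ n \<in> F"
  by (induction n) (auto intro: is_subfield_one is_subfield_mult)

lemma is_subfield_sum: "(\<And>i. i \<in> A \<Longrightarrow> f i \<in> F) \<Longrightarrow> sum f A \<in> F"
  by (induction A rule: infinite_finite_induct) (auto intro: is_subfield_zero is_subfield_add)

lemma is_subfield_prod: "(\<And>i. i \<in> A \<Longrightarrow> f i \<in> F) \<Longrightarrow> prod f A \<in> F"
  by (induction A rule: infinite_finite_induct) (auto intro: is_subfield_one is_subfield_mult)

lemmas is_subfield_intros = is_subfield_one is_subfield_add is_subfield_mult is_subfield_uminus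
  is_subfield_inverse is_subfield_diff is_subfield_divide is_subfield_zero is_subfield_power
  is_subfield_sum is_subfield_prod

end

definition poly_over :: "'a::zero set \<Rightarrow> 'a poly \<Rightarrow> bool" where
  "poly_over F P \<longleftrightarrow> (\<forall>i. Polynomial.coeff P i \<in> F)"

lemma poly_over_coeff: "poly_over F P \<Longrightarrow> Polynomial.coeff P i \<in> F"
  by (simp add: poly_over_def)

lemma poly_over_mono: "poly_over F P \<Longrightarrow> F \<subseteq> F' \<Longrightarrow> poly_over F' P"
  by (auto simp: poly_over_def)

lemma poly_over_pCons [simp]: "poly_over F (pCons c P) \<longleftrightarrow> c \<in> F \<and> poly_over F P"
  unfolding poly_over_def by (auto simp: coeff_pCons split: nat.splits)

context
  fixes F :: "'a::field set"
  assumes F: "is_subfield F"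
begin

lemma poly_over_0: "poly_over F 0"
  by (simp add: poly_over_def is_subfield_zero[OF F])

lemma poly_over_add: "poly_over F P \<Longrightarrow> poly_over F Q \<Longrightarrow> poly_over F (P + Q)"
  and poly_over_diff: "poly_over F P \<Longrightarrow> poly_over F Q \<Longrightarrow> poly_over F (P - Q)"
  and poly_over_uminus: "poly_over F P \<Longrightarrow> poly_over F (- P)"
  and poly_over_smult: "c \<in> F \<Longrightarrow> poly_over F P \<Longrightarrow> poly_over F (Polynomial.smult c P)"
  and poly_over_monom: "c \<in> F \<Longrightarrow> poly_over F (Polynomial.monom c n)"
  and poly_over_mult: "poly_over F P \<Longrightarrow> poly_over F Q \<Longrightarrow> poly_over F (P * Q)"
  using is_subfield_intros[OF F] by (auto simp: poly_over_def coeff_mult intro!: is_subfield_sum[OF F])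

lemma poly_over_divmod:
  assumes "poly_over F m" "m \<noteq> 0" "poly_over F P"
  shows "poly_over F (P div m) \<and> poly_over F (P mod m)"
  using assms(3)
proof (induction P)
  case 0
  then show ?case by (simp add: poly_over_0)
next
  case (pCons c P)
  then have IH: "poly_over F (P div m)" "poly_over F (P mod m)" by auto
  define d where "d = Polynomial.coeff (pCons c (P mod m)) (Polynomial.degree m) / Polynomial.lead_coeff m"
  have cP: "poly_over F (pCons c (P mod m))" using IH pCons.prems by simp
  then have "d \<in> F" unfolding d_def
    using assms(1) by (intro is_subfield_divide[OF F]) (auto intro: poly_over_coeff)
  moreover have "pCons c P mod m = pCons c (P mod m) - Polynomial.smult d m"
    using mod_pCons[OF assms(2), of c P] unfolding d_def by (simp add: Let_def)
  moreover have "pCons c P div m = pCons d (P div m)"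
    using div_pCons_eq[of c P m] assms(2) unfolding d_def by simp
  ultimately show ?case
    using IH cP assms(1) by (simp del: poly_over_pCons add: poly_over_diff poly_over_smult) simp
qed

end

definition field_hom_on :: "'a::field set \<Rightarrow> ('a \<Rightarrow> 'a) \<Rightarrow> bool" where
  "field_hom_on F \<phi> \<longleftrightarrow> \<phi> 1 = 1 \<and>
    (\<forall>x\<in>F. \<forall>y\<in>F. \<phi> (x + y) = \<phi> x + \<phi> y \<and> \<phi> (x * y) = \<phi> x * \<phi> y)"

context
  fixes F :: "'a::field set" and \<phi>
  assumes F: "is_subfield F" and \<phi>: "field_hom_on F \<phi>"
begin

lemma field_hom_on_add: "x \<in> F \<Longrightarrow> y \<in> F \<Longrightarrow> \<phi> (x + y) = \<phi> x + \<phi> y"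
  and field_hom_on_mult: "x \<in> F \<Longrightarrow> y \<in> F \<Longrightarrow> \<phi> (x * y) = \<phi> x * \<phi> y"
  and field_hom_on_one: "\<phi> 1 = 1"
  using \<phi> by (auto simp: field_hom_on_def)

lemma field_hom_on_zero: "\<phi> 0 = 0"
  using field_hom_on_add[of 0 0] is_subfield_zero[OF F] by (metis add_cancel_right_right add_0)

lemma field_hom_on_uminus: "x \<in> F \<Longrightarrow> \<phi> (- x) = - \<phi> x"
  using field_hom_on_add[of x "- x"] is_subfield_uminus[OF F, of x] field_hom_on_zero
  by (simp add: eq_neg_iff_add_eq_0 add.commute)

lemma field_hom_on_diff: "x \<in> F \<Longrightarrow> y \<in> F \<Longrightarrow> \<phi> (x - y) = \<phi> x - \<phi> y"
  using field_hom_on_add[of x "- y"] is_subfield_uminus[OF F] field_hom_on_uminus by simp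

lemma field_hom_on_nonzero: "x \<in> F \<Longrightarrow> x \<noteq> 0 \<Longrightarrow> \<phi> x \<noteq> 0"
  using field_hom_on_mult[of x "inverse x"] is_subfield_inverse[OF F, of x] field_hom_on_one by auto

lemma field_hom_on_inj: "x \<in> F \<Longrightarrow> y \<in> F \<Longrightarrow> \<phi> x = \<phi> y \<longleftrightarrow> x = y"
  using field_hom_on_nonzero[of "x - y"] field_hom_on_diff is_subfield_diff[OF F] by auto

lemma field_hom_on_inverse: "x \<in> F \<Longrightarrow> \<phi> (inverse x) = inverse (\<phi> x)"
  using field_hom_on_mult[of x "inverse x"] is_subfield_inverse[OF F, of x] field_hom_on_one
  by (cases "x = 0") (auto simp: field_hom_on_zero inverse_unique)

lemma field_hom_on_divide: "x \<in> F \<Longrightarrow> y \<in> F \<Longrightarrow> \<phi> (x / y) = \<phi> x / \<phi> y"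
  by (simp add: divide_inverse field_hom_on_mult field_hom_on_inverse is_subfield_inverse[OF F])

lemma field_hom_on_power: "x \<in> F \<Longrightarrow> \<phi> (x ^ n) = \<phi> x ^ n"
  by (induction n) (simp_all add: field_hom_on_one field_hom_on_mult is_subfield_power[OF F])

lemma field_hom_on_sum: "(\<And>i. i \<in> A \<Longrightarrow> f i \<in> F) \<Longrightarrow> \<phi> (sum f A) = (\<Sum>i\<in>A. \<phi> (f i))"
  by (induction A rule: infinite_finite_induct)
    (simp_all add: field_hom_on_zero field_hom_on_add is_subfield_sum[OF F])

lemma field_hom_on_prod: "(\<And>i. i \<in> A \<Longrightarrow> f i \<in> F) \<Longrightarrow> \<phi> (prod f A) = (\<Prod>i\<in>A. \<phi> (f i))"
  by (induction A rule: infinite_finite_induct)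
    (simp_all add: field_hom_on_one field_hom_on_mult is_subfield_prod[OF F])

lemma field_hom_on_map_poly_add:
  "poly_over F P \<Longrightarrow> poly_over F Q \<Longrightarrow> map_poly \<phi> (P + Q) = map_poly \<phi> P + map_poly \<phi> Q"
  by (rule poly_eqI) (simp add: coeff_map_poly field_hom_on_zero field_hom_on_add poly_over_coeff)

lemma field_hom_on_map_poly_mult:
  "poly_over F P \<Longrightarrow> poly_over F Q \<Longrightarrow> map_poly \<phi> (P * Q) = map_poly \<phi> P * map_poly \<phi> Q"
  by (rule poly_eqI) (simp add: coeff_map_poly field_hom_on_zero coeff_mult field_hom_on_sum
      field_hom_on_mult is_subfield_mult[OF F] poly_over_coeff)

lemma field_hom_on_poly:
  assumes "poly_over F P" "x \<in> F"
  shows "\<phi> (poly P x) = poly (map_poly \<phi> P) (\<phi> x)"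
  using assms
proof -
  have "poly P x = (\<Sum>i\<le>Polynomial.degree P. Polynomial.coeff P i * x ^ i)" by (rule poly_altdef)
  then have "\<phi> (poly P x) = (\<Sum>i\<le>Polynomial.degree P. \<phi> (Polynomial.coeff P i) * \<phi> x ^ i)"
    using assms by (simp add: field_hom_on_sum is_subfield_mult[OF F] is_subfield_power[OF F]
      poly_over_coeff field_hom_on_mult field_hom_on_power)
  also have "\<dots> = (\<Sum>i\<le>Polynomial.degree P. Polynomial.coeff (map_poly \<phi> P) i * \<phi> x ^ i)"
    by (simp add: coeff_map_poly field_hom_on_zero)
  also have "\<dots> = poly (map_poly \<phi> P) (\<phi> x)"
    unfolding poly_altdef using map_poly_degree_leq[of \<phi> P]
    by (intro sum.mono_neutral_right) (auto intro: coeff_eq_0)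
  finally show ?thesis .
qed

end

section \<open>Pure extensions\<close>

definition primitive_root :: "nat \<Rightarrow> 'a::field \<Rightarrow> bool" where
  "primitive_root n \<omega> \<longleftrightarrow> n > 0 \<and> (\<forall>m. \<omega> ^ m = 1 \<longleftrightarrow> n dvd m)"

lemma primitive_root_of_unity_imp_primitive_root:
  assumes "primitive_root_of_unity n \<omega>"
  shows "primitive_root n \<omega>"
proof -
  have n: "n > 0" "\<omega> ^ n = 1" and min: "\<And>m. 0 < m \<Longrightarrow> m < n \<Longrightarrow> \<omega> ^ m \<noteq> 1"
    using assms by (auto simp: primitive_root_of_unity_def)
  have "n dvd m" if "\<omega> ^ m = 1" for m
  proof -
    have "\<omega> ^ (m mod n) = 1" using power_mod_root[OF n(2)] that by simp
    then have "m mod n = 0" using min[of "m mod n"] n(1) by auto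
    then show ?thesis by auto
  qed
  then show ?thesis using n by (auto simp: primitive_root_def power_mult)
qed

lemma primitive_root_power:
  assumes "primitive_root (m * n) \<omega>" shows "primitive_root n (\<omega> ^ m)"
  using assms by (auto simp: primitive_root_def simp flip: power_mult)

lemma primitive_root_nonzero: "primitive_root n \<omega> \<Longrightarrow> \<omega> \<noteq> 0"
  by (metis dvd_refl power_0_left primitive_root_def zero_neq_one neq0_conv)

lemma primitive_root_eq_iff:
  assumes "primitive_root n \<omega>" "i < n" "j < n" "\<omega> ^ i = \<omega> ^ j"
  shows "i = j"
proof -
  have nz: "\<omega> \<noteq> 0" using primitive_root_nonzero[OF assms(1)] .
  have *: "i = j" if "i \<le> j" "j < n" "\<omega> ^ i = \<omega> ^ j" for i j
  proof -
    have "\<omega> ^ j = \<omega> ^ i * \<omega> ^ (j - i)" using that(1) by (simp only: power_add[symmetric] le_add_diff_inverse)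
    then have "\<omega> ^ (j - i) = 1" using that nz by simp
    then have "n dvd j - i" using assms(1) by (simp add: primitive_root_def)
    then show ?thesis using that by (auto dest: dvd_imp_le)
  qed
  show ?thesis using assms(2-4) *[of i j] *[of j i] by (cases "i \<le> j") auto
qed

lemma primitive_root_sum:
  assumes "primitive_root n \<omega>"
  shows "(\<Sum>i<n. \<omega> ^ (i * j)) = (if n dvd j then of_nat n else 0)"
proof (cases "n dvd j")
  case True
  then have "\<omega> ^ (i * j) = 1" for i using assms by (simp add: primitive_root_def)
  then show ?thesis using True by simp
next
  case False
  then have "\<omega> ^ j \<noteq> 1" using assms by (simp add: primitive_root_def)
  moreover have "(\<Sum>i<n. (\<omega> ^ j) ^ i) * (\<omega> ^ j - 1) = (\<omega> ^ j) ^ n - 1"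
    by (metis power_diff_1_eq mult.commute)
  moreover have "(\<omega> ^ j) ^ n = 1"
    using assms by (simp add: primitive_root_def flip: power_mult)
  ultimately show ?thesis using False by (simp add: mult.commute flip: power_mult)
qed

lemma primitive_root_exhaust:
  assumes "primitive_root n \<omega>" "x ^ n = 1"
  obtains i where "i < n" "x = \<omega> ^ i"
proof -
  let ?P = "Polynomial.monom 1 n - 1 :: 'a poly"
  have n: "n > 0" using assms by (simp add: primitive_root_def)
  have deg: "Polynomial.degree ?P = n"
    using n by (intro antisym degree_diff_le le_degree) (auto simp: degree_monom_le coeff_diff)
  then have nz: "?P \<noteq> 0" using n by auto
  have "(\<lambda>i. \<omega> ^ i) ` {..<n} \<subseteq> {x. poly ?P x = 0}"
    using assms(1) by (auto simp: poly_monom primitive_root_def simp flip: power_mult)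
  moreover have "card ((\<lambda>i. \<omega> ^ i) ` {..<n}) = n"
    by (subst card_image) (auto intro!: inj_onI primitive_root_eq_iff[OF assms(1)])
  moreover have "finite {x. poly ?P x = 0}" "card {x. poly ?P x = 0} \<le> n"
    using poly_roots_finite[OF nz] card_poly_roots_bound[OF nz] deg by auto
  ultimately have "(\<lambda>i. \<omega> ^ i) ` {..<n} = {x. poly ?P x = 0}"
    by (intro card_seteq) auto
  moreover have "poly ?P x = 0" using assms(2) by (simp add: poly_monom)
  ultimately show ?thesis using that by auto
qed

text \<open>\<open>u\<close> generates an extension of degree \<open>n\<close> of \<open>F\<close> with minimal polynomial \<open>X\<^sup>n - u\<^sup>n\<close>.\<close>

definition pure_over :: "nat \<Rightarrow> 'a::field set \<Rightarrow> 'a \<Rightarrow> bool" where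
  "pure_over n F u \<longleftrightarrow> n > 0 \<and> u ^ n \<in> F \<and>
    (\<forall>P. poly_over F P \<longrightarrow> Polynomial.degree P < n \<longrightarrow> poly P u = 0 \<longrightarrow> P = 0)"

definition adjoin :: "'a::field set \<Rightarrow> 'a \<Rightarrow> 'a set" where
  "adjoin F u = {poly P u | P. poly_over F P}"

text \<open>The constant coefficient of a monic factor of degree \<open>d\<close> of \<open>X\<^sup>n - u\<^sup>n\<close> is a root of
  unity times \<open>u\<^sup>d\<close>.\<close>

lemma pure_overI:
  fixes u :: "'a::alg_closed_field"
  assumes F: "is_subfield F" and \<omega>: "\<omega> \<in> F" "primitive_root (q ^ Suc e) \<omega>"
    and q: "Factorial_Ring.prime q" and u: "u ^ (q ^ Suc e) \<in> F" "u ^ (q ^ e) \<notin> F"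
  shows "pure_over (q ^ Suc e) F u"
proof -
  define n where "n = q ^ Suc e"
  have n: "n > 0" using q by (simp add: n_def prime_gt_0_nat)
  have u0: "u \<noteq> 0" using u(2) is_subfield_zero[OF F] prime_gt_0_nat[OF q] by (auto simp: power_0_left)
  define B where "B = (\<lambda>P. P \<noteq> 0 \<and> poly_over F P \<and> poly P u = 0)"
  have False if "B P" "Polynomial.degree P < n" for P
  proof -
    obtain Q where Q: "B Q" "\<And>R. B R \<Longrightarrow> Polynomial.degree Q \<le> Polynomial.degree R"
      using ex_has_least_nat[of B P Polynomial.degree] \<open>B P\<close> by blast
    have Qn: "Polynomial.degree Q < n" using Q(2)[OF \<open>B P\<close>] that by simp
    have Q': "Q \<noteq> 0" "poly_over F Q" "poly Q u = 0" using Q(1) by (auto simp: B_def)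
    define d where "d = Polynomial.degree Q"
    have "d > 0"
    proof (rule ccontr)
      assume "\<not> d > 0"
      then obtain c where "Q = [:c:]" by (auto simp: d_def elim: degree_eq_zeroE)
      then show False using Q' by auto
    qed
    let ?M = "Polynomial.monom 1 n - [:u ^ n:]"
    have M: "poly_over F ?M" using u(1) F
      by (intro poly_over_diff poly_over_monom) (auto simp: n_def is_subfield_one poly_over_0)
    have "?M mod Q = 0"
    proof (rule ccontr)
      assume nz: "?M mod Q \<noteq> 0"
      have "poly (?M mod Q) u = poly ?M u"
        using Q'(3) by (metis add.left_neutral mult_zero_right mult_zero_left poly_add poly_mult div_mult_mod_eq)
      then have "B (?M mod Q)"
        using nz poly_over_divmod[OF F Q'(2,1) M] by (simp add: B_def poly_monom)
      moreover have "Polynomial.degree (?M mod Q) < Polynomial.degree Q"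
        using degree_mod_less[OF Q'(1), of ?M] nz by simp
      ultimately show False using Q(2) by fastforce
    qed
    then have dvd: "Q dvd ?M" by auto
    obtain A where A: "size A = d" "Q = Polynomial.smult (Polynomial.lead_coeff Q) (\<Prod>x\<in>#A. [:- x, 1:])"
      using alg_closed_imp_factorization[OF Q'(1)] by (auto simp: d_def)
    have "\<exists>i. (\<Prod>x\<in>#A'. x) = \<omega> ^ i * u ^ size A'" if "A' \<subseteq># A" for A'
      using that
    proof (induction A')
      case empty
      then show ?case by (auto intro: exI[of _ 0])
    next
      case (add x A')
      then obtain i where i: "(\<Prod>x\<in>#A'. x) = \<omega> ^ i * u ^ size A'"
        by (auto dest: mset_subset_eq_insertD subset_mset.less_imp_le)
      have "x \<in># A" using add.prems by (meson insert_subset_eq_iff)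
      then have "poly (\<Prod>x\<in>#A. [:- x, 1:]) x = 0"
        by (auto simp: poly_prod_mset)
      then have "poly Q x = 0" by (subst A(2)) simp
      then have "poly ?M x = 0" using dvd by (metis dvdE mult_zero_left poly_mult)
      then have "(x / u) ^ n = 1" using u0 by (simp add: poly_monom power_divide)
      then obtain j where "x / u = \<omega> ^ j"
        using primitive_root_exhaust[of n \<omega>] \<omega>(2) unfolding n_def by metis
      then have "x = \<omega> ^ j * u" using u0 by (simp add: field_simps)
      then show ?case using i by (auto intro!: exI[of _ "i + j"] simp: power_add mult_ac)
    qed
    from this[of A] obtain i where i: "(\<Prod>x\<in>#A. x) = \<omega> ^ i * u ^ d" using A(1) by auto
    have "poly Q 0 = Polynomial.lead_coeff Q * (\<Prod>x\<in>#A. - x)"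
      by (subst A(2)) (simp add: poly_prod_mset)
    also have "(\<Prod>x\<in>#A. - x) = (- 1) ^ d * (\<Prod>x\<in>#A. x)"
      using prod_mset.distrib[of "\<lambda>_. - 1" "\<lambda>x. x" A] A(1) by (simp)
    finally have "u ^ d = (- 1) ^ d * poly Q 0 / (Polynomial.lead_coeff Q * \<omega> ^ i)"
      using Q'(1) primitive_root_nonzero[OF \<omega>(2)] unfolding i by (simp add: flip: power_mult_distrib mult.assoc)
    also have "\<dots> \<in> F"
      using F Q'(2) \<omega>(1)
      by (intro is_subfield_divide is_subfield_mult is_subfield_power is_subfield_uminus is_subfield_one)
        (auto simp: poly_0_coeff_0 poly_over_coeff)
    finally have ud: "u ^ d \<in> F" .
    obtain a b where ab: "d * a = n * b + gcd d n" using bezout_nat[of d n] \<open>d > 0\<close> by auto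
    have "u ^ gcd d n = (u ^ d) ^ a / (u ^ n) ^ b"
      using ab u0 by (simp add: power_add flip: power_mult)
    then have ug: "u ^ gcd d n \<in> F" using ud u(1) F by (simp add: n_def is_subfield_divide is_subfield_power)
    obtain k where k: "k \<le> Suc e" "gcd d n = q ^ k"
      using divides_primepow_nat[OF q, of "gcd d n" "Suc e"] by (auto simp: n_def)
    have "gcd d n \<le> d" using \<open>d > 0\<close> by (simp add: gcd_le1_nat)
    then have "k \<noteq> Suc e" using k Qn by (auto simp: n_def d_def)
    then have "k \<le> e" using k by simp
    then have "q ^ e = gcd d n * q ^ (e - k)" using k(2) by (simp flip: power_add)
    then show False using ug u(2) F by (simp add: power_mult is_subfield_power)
  qed
  then show ?thesis using n u(1) unfolding pure_over_def B_def n_def by blast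
qed

lemma adjoinI: "poly_over F P \<Longrightarrow> poly P u \<in> adjoin F u"
  by (auto simp: adjoin_def)

lemma adjoin_base: "is_subfield F \<Longrightarrow> F \<subseteq> adjoin F u"
  using adjoinI[of F "[:c:]" u for c] poly_over_0 by fastforce

lemma adjoin_gen: "is_subfield F \<Longrightarrow> u \<in> adjoin F u"
  using adjoinI[of F "[:0, 1:]" u] by (simp add: poly_over_0 is_subfield_zero is_subfield_one)

lemma adjoin_subset:
  assumes "is_subfield M" "F \<subseteq> M" "u \<in> M" shows "adjoin F u \<subseteq> M"
  using assms(2,3) unfolding adjoin_def poly_altdef
  by (auto intro!: is_subfield_sum[OF assms(1)] is_subfield_mult[OF assms(1)]
    is_subfield_power[OF assms(1)] dest: poly_over_coeff)

lemma is_subfield_range_to_ac: "is_subfield (range (to_ac :: 'k::field \<Rightarrow> _))"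
  unfolding is_subfield_def
  by (auto simp flip: to_ac_add to_ac_mult to_ac_minus to_ac_inverse to_ac_1)

text \<open>Inverses come for free, since the closure is algebraic over \<open>k\<close>.\<close>

lemma is_subfield_adjoin:
  fixes F :: "'k::field alg_closure set"
  assumes F: "is_subfield F" and k: "range to_ac \<subseteq> F"
  shows "is_subfield (adjoin F u)"
proof -
  let ?M = "adjoin F u"
  have add: "x + y \<in> ?M" and mult: "x * y \<in> ?M" if xy: "x \<in> ?M" "y \<in> ?M" for x y
  proof -
    obtain P Q where "x = poly P u" "y = poly Q u" "poly_over F P" "poly_over F Q"
      using xy by (auto simp: adjoin_def)
    then show "x + y \<in> ?M" "x * y \<in> ?M"
      using adjoinI[OF poly_over_add[OF F, of P Q], of u] adjoinI[OF poly_over_mult[OF F, of P Q], of u]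
      by simp_all
  qed
  have uminus: "- x \<in> ?M" if x: "x \<in> ?M" for x
  proof -
    obtain P where "x = poly P u" "poly_over F P" using x by (auto simp: adjoin_def)
    then show ?thesis using adjoinI[OF poly_over_uminus[OF F, of P], of u] by simp
  qed
  have one: "1 \<in> ?M" using adjoin_base[OF F] is_subfield_one[OF F] by auto
  have poly_closed: "poly (map_poly to_ac P) x \<in> ?M" if "x \<in> ?M" for x P
  proof (induction P)
    case 0
    have "0 \<in> ?M" using adjoin_base[OF F] is_subfield_zero[OF F] by auto
    then show ?case by simp
  next
    case (pCons c P)
    have "to_ac c \<in> ?M" using adjoin_base[OF F, of u] k by auto
    then show ?case using pCons that by (simp add: map_poly_pCons add mult)
  qed
  have "inverse x \<in> ?M" if x: "x \<in> ?M" "x \<noteq> 0" for x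
  proof -
    have "\<exists>P. Polynomial.coeff P 0 \<noteq> 0 \<and> poly (map_poly to_ac P) x = 0"
      if "P \<noteq> 0" "poly (map_poly to_ac P) x = 0" for P
      using that
    proof (induction P)
      case (pCons c P)
      show ?case
      proof (cases "c = 0")
        case True
        then show ?thesis using pCons \<open>x \<noteq> 0\<close> by (auto simp: map_poly_pCons)
      next
        case False
        then show ?thesis using pCons.prems by (intro exI[of _ "pCons c P"]) simp
      qed
    qed simp
    then obtain P where P: "Polynomial.coeff P 0 \<noteq> 0" "poly (map_poly to_ac P) x = 0"
      using alg_closure_algebraic[of x] by metis
    obtain c P' where cP: "P = pCons c P'" by (metis pCons_cases)
    have c: "c \<noteq> 0" using P(1) cP by simp
    have "to_ac c + x * poly (map_poly to_ac P') x = 0" using P(2) cP by (simp add: map_poly_pCons)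
    then have "x * (- poly (map_poly to_ac P') x * to_ac (inverse c)) = 1"
      using c by (simp add: field_simps neg_eq_iff_add_eq_0 add.commute)
    then have "inverse x = - poly (map_poly to_ac P') x * to_ac (inverse c)"
      by (rule inverse_unique)
    moreover have "to_ac (inverse c) \<in> ?M" using adjoin_base[OF F, of u] k by blast
    ultimately show ?thesis using mult[OF uminus[OF poly_closed[OF x(1), of P']]] by simp
  qed
  then have "inverse x \<in> ?M" if "x \<in> ?M" for x using that by (cases "x = 0") auto
  then show ?thesis using add mult uminus one by (simp add: is_subfield_def)
qed

context
  fixes F :: "'a::field set" and u n
  assumes F: "is_subfield F" and pure: "pure_over n F u"
begin

lemma pure_polynomial:
  defines "m \<equiv> Polynomial.monom 1 n - [:u ^ n:]"
  shows "m \<noteq> 0" "poly_over F m" "Polynomial.degree (P mod m) < n" "poly (P mod m) u = poly P u"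
proof -
  have n: "n > 0" "u ^ n \<in> F" using pure by (auto simp: pure_over_def)
  have deg: "Polynomial.degree m = n"
    unfolding m_def using n(1)
    by (intro antisym degree_diff_le le_degree) (auto simp: degree_monom_le coeff_diff coeff_pCons split: nat.splits)
  then show m0: "m \<noteq> 0" using n(1) by auto
  show "poly_over F m" unfolding m_def using n(2) F
    by (intro poly_over_diff poly_over_monom) (auto simp: is_subfield_one poly_over_0)
  show "Polynomial.degree (P mod m) < n"
    using degree_mod_less'[OF m0, of P] deg n(1) by (cases "P mod m = 0") auto
  have "poly P u = poly (P div m * m + P mod m) u"
    by (rule arg_cong[OF div_mult_mod_eq[symmetric]])
  then show "poly (P mod m) u = poly P u" by (simp only: poly_add poly_mult) (simp add: m_def poly_monom)
qed

lemma pure_reduce: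
  assumes "x \<in> adjoin F u"
  obtains P where "poly_over F P" "Polynomial.degree P < n" "poly P u = x"
proof -
  obtain P where P: "poly_over F P" "poly P u = x" using assms by (auto simp: adjoin_def)
  show ?thesis
    using that poly_over_divmod[OF F pure_polynomial(2,1) P(1)] pure_polynomial(3,4)[of P] P(2) by metis
qed

lemma pure_unique:
  assumes "poly_over F P" "poly_over F Q" "Polynomial.degree P < n" "Polynomial.degree Q < n"
    "poly P u = poly Q u"
  shows "P = Q"
proof -
  have "P - Q = 0" using pure assms(3-5) poly_over_diff[OF F assms(1,2)] degree_diff_less[of P n Q]
    unfolding pure_over_def by (metis poly_diff right_minus_eq)
  then show ?thesis by simp
qed

lemma pure_extend:
  assumes \<phi>: "field_hom_on F \<phi>" and v: "v ^ n = \<phi> (u ^ n)"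
  obtains \<psi> where "field_hom_on (adjoin F u) \<psi>" "\<And>x. x \<in> F \<Longrightarrow> \<psi> x = \<phi> x" "\<psi> u = v"
proof -
  let ?m = "Polynomial.monom 1 n - [:u ^ n:]"
  have n: "n > 0" "u ^ n \<in> F" using pure by (auto simp: pure_over_def)
  note m0 = pure_polynomial(1) and m = pure_polynomial(2)
  have mv: "poly (map_poly \<phi> ?m) v = 0"
  proof -
    have "map_poly \<phi> ?m = Polynomial.monom 1 n - [:\<phi> (u ^ n):]"
      using is_subfield_zero[OF F] is_subfield_one[OF F] n(2)
      by (intro poly_eqI) (auto simp: coeff_map_poly field_hom_on_zero[OF F \<phi>] field_hom_on_one[OF F \<phi>]
          field_hom_on_diff[OF F \<phi>] field_hom_on_uminus[OF F \<phi>] coeff_pCons split: nat.splits)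
    then show ?thesis using v by (simp add: poly_monom)
  qed
  have *: "poly (map_poly \<phi> P) v = poly (map_poly \<phi> Q) v"
    if "poly_over F P" "poly_over F Q" "poly P u = poly Q u" for P Q
  proof -
    define D where "D = P - Q"
    have D: "poly_over F D" using that F by (simp add: D_def poly_over_diff)
    have dm: "poly_over F (D div ?m)" "poly_over F (D mod ?m)"
      using poly_over_divmod[OF F m m0 D] by auto
    have D_eq: "D = D div ?m * ?m + D mod ?m" by (rule div_mult_mod_eq[symmetric])
    have "D mod ?m = 0"
      using pure dm(2) that(3) pure_polynomial(3,4)[of D] by (simp add: pure_over_def D_def)
    then have "D = D div ?m * ?m" using D_eq by simp
    then have "poly (map_poly \<phi> D) v = 0"
      using field_hom_on_map_poly_mult[OF F \<phi> dm(1) m] mv by (metis mult_zero_right poly_mult)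
    moreover have "map_poly \<phi> P = map_poly \<phi> D + map_poly \<phi> Q"
      using field_hom_on_map_poly_add[OF F \<phi> D that(2)] by (simp add: D_def)
    ultimately show ?thesis by simp
  qed
  define \<psi> where "\<psi> = (\<lambda>x. poly (map_poly \<phi> (SOME P. poly_over F P \<and> poly P u = x)) v)"
  have \<psi>: "\<psi> (poly P u) = poly (map_poly \<phi> P) v" if "poly_over F P" for P
  proof -
    have "\<exists>Q. poly_over F Q \<and> poly Q u = poly P u" using that by blast
    from someI_ex[OF this] show ?thesis unfolding \<psi>_def using * that by blast
  qed
  have base: "\<psi> x = \<phi> x" if "x \<in> F" for x
    using \<psi>[of "[:x:]"] that
    by (simp add: poly_over_0[OF F] map_poly_pCons field_hom_on_zero[OF F \<phi>])
  show ?thesis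
  proof
    show "field_hom_on (adjoin F u) \<psi>"
      unfolding field_hom_on_def
    proof (intro conjI ballI)
      show "\<psi> 1 = 1" using base[OF is_subfield_one[OF F]] field_hom_on_one[OF F \<phi>] by simp
      fix x y assume "x \<in> adjoin F u" "y \<in> adjoin F u"
      then obtain P Q where PQ: "x = poly P u" "y = poly Q u" "poly_over F P" "poly_over F Q"
        by (auto simp: adjoin_def)
      show "\<psi> (x + y) = \<psi> x + \<psi> y"
        using PQ \<psi>[OF poly_over_add[OF F PQ(3,4)]] by (simp add: \<psi> field_hom_on_map_poly_add[OF F \<phi>])
      show "\<psi> (x * y) = \<psi> x * \<psi> y"
        using PQ \<psi>[OF poly_over_mult[OF F PQ(3,4)]] by (simp add: \<psi> field_hom_on_map_poly_mult[OF F \<phi>])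
    qed
    show "\<psi> u = v"
      using \<psi>[of "[:0, 1:]"] by (simp add: poly_over_0[OF F] is_subfield_zero[OF F] is_subfield_one[OF F]
        map_poly_pCons field_hom_on_one[OF F \<phi>] field_hom_on_zero[OF F \<phi>])
  qed (rule base)
qed

end

lemma field_hom_on_adjoin_poly:
  assumes F: "is_subfield F" and M: "is_subfield M" "adjoin F u \<subseteq> M" and \<phi>: "field_hom_on M \<phi>"
    and P: "poly_over F P"
  shows "\<phi> (poly P u) = poly (map_poly \<phi> P) (\<phi> u)"
  using M adjoin_base[OF F, of u] adjoin_gen[OF F, of u]
  by (intro field_hom_on_poly[OF M(1) \<phi>] poly_over_mono[OF P]) auto

lemma field_hom_on_adjoin_eq:
  assumes F: "is_subfield F" and M: "is_subfield M" "adjoin F u \<subseteq> M"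
    and \<phi>: "field_hom_on M \<phi>" "field_hom_on M \<psi>"
    and eq: "\<And>x. x \<in> F \<Longrightarrow> \<phi> x = \<psi> x" "\<phi> u = \<psi> u" and x: "x \<in> adjoin F u"
  shows "\<phi> x = \<psi> x"
proof -
  obtain P where P: "poly_over F P" "x = poly P u" using x by (auto simp: adjoin_def)
  have "map_poly \<phi> P = map_poly \<psi> P"
    using P(1) eq(1) field_hom_on_zero[OF M(1)] \<phi>
    by (intro poly_eqI) (simp add: coeff_map_poly poly_over_coeff)
  then show ?thesis
    using field_hom_on_adjoin_poly[OF F M \<phi>(1) P(1)] field_hom_on_adjoin_poly[OF F M \<phi>(2) P(1)] P(2) eq(2)
    by simp
qed

lemma field_hom_on_adjoin_closed:
  assumes F: "is_subfield F" and M: "is_subfield M" "adjoin F u \<subseteq> M" and \<phi>: "field_hom_on M \<phi>"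
    and N: "is_subfield N" "\<And>x. x \<in> F \<Longrightarrow> \<phi> x \<in> N" "\<phi> u \<in> N" and x: "x \<in> adjoin F u"
  shows "\<phi> x \<in> N"
proof -
  obtain P where P: "poly_over F P" "x = poly P u" using x by (auto simp: adjoin_def)
  have "poly_over N (map_poly \<phi> P)"
    using P(1) N(2) field_hom_on_zero[OF M(1) \<phi>] by (auto simp: poly_over_def coeff_map_poly)
  then have "poly (map_poly \<phi> P) (\<phi> u) \<in> adjoin N (\<phi> u)" by (rule adjoinI)
  then show ?thesis
    using adjoin_subset[OF N(1) _ N(3), of N] field_hom_on_adjoin_poly[OF F M \<phi> P(1)] P(2) by auto
qed

lemma pure_fixed:
  assumes F: "is_subfield F" and pure: "pure_over n F u" and \<omega>: "\<omega> \<in> F" "primitive_root n \<omega>"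
    and M: "is_subfield M" "adjoin F u \<subseteq> M" and \<phi>: "field_hom_on M \<phi>"
    and fix': "\<And>x. x \<in> F \<Longrightarrow> \<phi> x = x" "\<phi> u = \<omega> * u" and x: "x \<in> adjoin F u" "\<phi> x = x"
  shows "x \<in> F"
proof -
  obtain P where P: "poly_over F P" "Polynomial.degree P < n" "poly P u = x"
    using pure_reduce[OF F pure x(1)] .
  have mp: "map_poly \<phi> P = P"
    using P(1) fix'(1) field_hom_on_zero[OF M(1) \<phi>]
    by (intro poly_eqI) (simp add: coeff_map_poly poly_over_coeff)
  define Q where "Q = P \<circ>\<^sub>p [:0, \<omega>:]"
  have Qc: "Polynomial.coeff Q i = \<omega> ^ i * Polynomial.coeff P i" for i
    by (simp add: Q_def coeff_pcompose_linear)
  have "poly Q u = poly P u"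
    using field_hom_on_adjoin_poly[OF F M \<phi> P(1)] x(2) P(3) fix'(2)
    by (simp add: mp Q_def poly_pcompose mult.commute)
  moreover have "poly_over F Q" using P(1) \<omega>(1) F
    by (simp add: poly_over_def Qc is_subfield_mult is_subfield_power)
  moreover have "Polynomial.degree Q < n"
    using P(2) degree_pcompose_le[of P "[:0, \<omega>:]"] unfolding Q_def by (auto split: if_splits)
  ultimately have "Q = P" using pure_unique[OF F pure] P by blast
  then have "(\<omega> ^ i - 1) * Polynomial.coeff P i = 0" for i
    using Qc[of i] by (simp add: algebra_simps)
  then have "Polynomial.coeff P i = 0" if "i > 0" "i < n" for i
    using that \<omega>(2) by (metis dvd_imp_le mult_eq_0_iff not_le primitive_root_def right_minus_eq)
  then have "Polynomial.coeff P i = 0" if "i > 0" for i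
    using that P(2) by (cases "i < n") (auto intro: coeff_eq_0)
  then have "Polynomial.degree P = 0" by (metis leading_coeff_0_iff neq0_conv degree_0)
  then obtain c where "P = [:c:]" by (auto elim: degree_eq_zeroE)
  then show ?thesis using P by simp
qed

text \<open>Kummer: the eigenvectors of \<open>u \<mapsto> \<omega> u\<close> are the multiples of powers of \<open>u\<close>.\<close>

lemma pure_power_in_base:
  assumes F: "is_subfield F" and pure: "pure_over n F u" and \<omega>: "\<omega> \<in> F" "primitive_root n \<omega>"
    and M: "is_subfield (adjoin F u)" and u0: "u \<noteq> 0" and w: "w \<in> adjoin F u" "w ^ n \<in> F"
  obtains c j where "c \<in> F" "w = c * u ^ j"
proof (cases "w = 0")
  case True
  then show ?thesis using that[of 0 0] is_subfield_zero[OF F] by simp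
next
  case False
  let ?M = "adjoin F u"
  have un: "u ^ n \<in> F" and n: "n > 0" using pure by (auto simp: pure_over_def)
  have "field_hom_on F (\<lambda>x. x)" by (simp add: field_hom_on_def)
  moreover have "(\<omega> * u) ^ n = u ^ n"
    using \<omega>(2) by (simp add: power_mult_distrib primitive_root_def)
  ultimately obtain \<phi> where \<phi>: "field_hom_on ?M \<phi>" "\<And>x. x \<in> F \<Longrightarrow> \<phi> x = x" "\<phi> u = \<omega> * u"
    using pure_extend[OF F pure] by metis
  have "\<phi> w ^ n = w ^ n" using \<phi>(2)[OF w(2)] field_hom_on_power[OF M \<phi>(1) w(1)] by simp
  then have "(\<phi> w / w) ^ n = 1" using False by (simp add: power_divide)
  then obtain j where j: "\<phi> w / w = \<omega> ^ j" using primitive_root_exhaust[OF \<omega>(2)] by metis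
  have uM: "u \<in> ?M" by (rule adjoin_gen[OF F])
  have "\<phi> (w / u ^ j) = \<phi> w / (\<omega> * u) ^ j"
    by (simp add: field_hom_on_divide[OF M \<phi>(1)] field_hom_on_power[OF M \<phi>(1)] w(1) uM
      is_subfield_power[OF M] \<phi>(3))
  also have "\<phi> w = \<omega> ^ j * w" using j False by (simp add: field_simps)
  finally have "\<phi> (w / u ^ j) = w / u ^ j"
    using primitive_root_nonzero[OF \<omega>(2)] by (simp add: power_mult_distrib)
  moreover have "w / u ^ j \<in> ?M"
    using w(1) uM by (intro is_subfield_divide[OF M] is_subfield_power[OF M])
  ultimately have "w / u ^ j \<in> F"
    using pure_fixed[OF F pure \<omega> M subset_refl \<phi>] by blast
  then show ?thesis using that[of "w / u ^ j" j] u0 by simp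
qed

section \<open>The Galois group of a subfield\<close>

lemma subfield_iff_is_subfield:
  "subfield M (ring_of_type_algebra :: 'a::field ring) \<longleftrightarrow> is_subfield M"
proof
  interpret R: field "ring_of_type_algebra :: 'a ring" by (rule field_from_type_algebra)
  have ops: "x \<otimes>\<^bsub>ring_of_type_algebra\<^esub> y = x * y" "x \<oplus>\<^bsub>ring_of_type_algebra\<^esub> y = x + y"
    "\<one>\<^bsub>ring_of_type_algebra\<^esub> = (1::'a)" "\<zero>\<^bsub>ring_of_type_algebra\<^esub> = (0::'a)"
    "carrier (ring_of_type_algebra :: 'a ring) = UNIV" for x y :: 'a
    by (simp_all add: ring_of_type_algebra_def)
  have minus: "\<ominus>\<^bsub>ring_of_type_algebra\<^esub> x = - x" for x :: 'a
    by (rule R.minus_equality) (simp_all add: ops)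
  have inv: "inv\<^bsub>ring_of_type_algebra\<^esub> x = inverse x" if "x \<noteq> 0" for x :: 'a
    using that by (intro R.inv_unique'[symmetric]) (simp_all add: ops)
  {
    assume M: "subfield M (ring_of_type_algebra :: 'a ring)"
    note sub = subringE[OF subfieldE(1)[OF M], unfolded ops minus]
    have "inverse x \<in> M" if "x \<in> M" for x
      using R.subfield_m_inv(1)[OF M, of x] that inv[of x] by (cases "x = 0") (auto simp: ops)
    then show "is_subfield M"
      using sub by (auto simp: is_subfield_def)
  }
  {
    assume M: "is_subfield M"
    show "subfield M (ring_of_type_algebra :: 'a ring)"
    proof (rule R.subfieldI')
      show "subring M (ring_of_type_algebra :: 'a ring)"
        by (rule R.subringI) (auto simp: ops minus is_subfield_intros[OF M])
      show "inv\<^bsub>ring_of_type_algebra\<^esub> x \<in> M" if "x \<in> M - {\<zero>\<^bsub>ring_of_type_algebra\<^esub>}" for x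
        using that inv[of x] is_subfield_inverse[OF M, of x] by (auto simp: ops)
    qed
  }
qed

lemma algebraic_over_range_to_ac: "algebraic_over_set (range to_ac) x"
proof -
  obtain P where P: "P \<noteq> 0" "poly (map_poly to_ac P) x = 0" using alg_closure_algebraic .
  then show ?thesis unfolding algebraic_over_set_def
    by (intro exI[of _ "map_poly to_ac P"]) (auto simp: coeff_map_poly poly_eq_iff)
qed

lemma galois_group_simps:
  "carrier (galois_group K M) = galois_aut K M" "\<one>\<^bsub>galois_group K M\<^esub> = (\<lambda>x\<in>M. x)"
  by (simp_all add: galois_group_def BijGroup_def)

lemma galois_group_mult:
  "\<sigma> \<in> galois_aut K M \<Longrightarrow> \<tau> \<in> galois_aut K M \<Longrightarrow> x \<in> M \<Longrightarrow> (\<sigma> \<otimes>\<^bsub>galois_group K M\<^esub> \<tau>) x = \<sigma> (\<tau> x)"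
  by (simp add: galois_group_def BijGroup_def galois_aut_def compose_def)

lemma galois_aut_closed: "\<sigma> \<in> galois_aut K M \<Longrightarrow> x \<in> M \<Longrightarrow> \<sigma> x \<in> M"
  by (auto simp: galois_aut_def dest: Bij_imp_funcset)

lemma galois_aut_fixes: "\<sigma> \<in> galois_aut K M \<Longrightarrow> x \<in> K \<Longrightarrow> \<sigma> x = x"
  by (auto simp: galois_aut_def)

lemma galois_aut_field_hom_on:
  "is_subfield K \<Longrightarrow> \<sigma> \<in> galois_aut K M \<Longrightarrow> field_hom_on M \<sigma>"
  by (auto simp: galois_aut_def field_hom_on_def is_subfield_one)

lemma galois_aut_ext:
  "\<sigma> \<in> galois_aut K M \<Longrightarrow> \<tau> \<in> galois_aut K M \<Longrightarrow> (\<And>x. x \<in> M \<Longrightarrow> \<sigma> x = \<tau> x) \<Longrightarrow> \<sigma> = \<tau>"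
  by (auto simp: galois_aut_def dest!: Bij_imp_extensional intro: extensionalityI)

lemma galois_group_pow:
  assumes "is_subfield M" "K \<subseteq> M" "\<sigma> \<in> galois_aut K M" "x \<in> M"
  shows "(\<sigma> [^]\<^bsub>galois_group K M\<^esub> (n::nat)) x = (\<sigma> ^^ n) x"
proof -
  interpret group "galois_group K M"
    using assms by (intro group_galois_group) (simp_all add: subfield_iff_is_subfield)
  have [simp]: "\<sigma> \<in> carrier (galois_group K M)" using assms by (simp add: galois_group_simps)
  show ?thesis using assms(4)
  proof (induction n)
    case (Suc n)
    have "\<sigma> [^]\<^bsub>galois_group K M\<^esub> n \<in> galois_aut K M"
      using nat_pow_closed[of \<sigma> n] assms(3) by (simp add: galois_group_simps)
    then have "(\<sigma> [^]\<^bsub>galois_group K M\<^esub> Suc n) x = (\<sigma> \<otimes>\<^bsub>galois_group K M\<^esub> \<sigma> [^]\<^bsub>galois_group K M\<^esub> n) x"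
      by (simp only: nat_pow_Suc2 \<open>\<sigma> \<in> carrier _\<close>)
    then show ?case
      using Suc \<open>\<sigma> [^]\<^bsub>galois_group K M\<^esub> n \<in> galois_aut K M\<close> assms(3)
      by (simp add: galois_group_mult)
  qed (simp add: galois_group_simps)
qed

text \<open>The endomorphisms of \<open>M\<close> over \<open>K\<close>, as functions that may be arbitrary outside \<open>M\<close>.\<close>

definition field_endo :: "'a::field set \<Rightarrow> 'a set \<Rightarrow> ('a \<Rightarrow> 'a) \<Rightarrow> bool" where
  "field_endo K M \<phi> \<longleftrightarrow> field_hom_on M \<phi> \<and> (\<forall>x\<in>K. \<phi> x = x) \<and> (\<forall>x\<in>M. \<phi> x \<in> M)"

lemma field_endo_id: "field_endo K M (\<lambda>x. x)" "field_endo K M id"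
  by (auto simp: field_endo_def field_hom_on_def)

lemma field_endo_comp: "field_endo K M \<phi> \<Longrightarrow> field_endo K M \<psi> \<Longrightarrow> field_endo K M (\<phi> \<circ> \<psi>)"
  by (auto simp: field_endo_def field_hom_on_def)

lemma field_endo_funpow: "field_endo K M \<phi> \<Longrightarrow> field_endo K M (\<phi> ^^ n)"
  by (induction n) (simp_all add: field_endo_id field_endo_comp)

lemma field_endo_galois_aut: "is_subfield K \<Longrightarrow> \<sigma> \<in> galois_aut K M \<Longrightarrow> field_endo K M \<sigma>"
  by (simp add: field_endo_def galois_aut_field_hom_on galois_aut_closed galois_aut_fixes)

lemma restrict_in_galois_aut:
  assumes M: "is_subfield M" "K \<subseteq> M" and \<phi>: "field_endo K M \<phi>" and n: "n > 0" "\<And>x. x \<in> M \<Longrightarrow> (\<phi> ^^ n) x = x"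
  shows "restrict \<phi> M \<in> galois_aut K M"
proof -
  have inj: "inj_on \<phi> M"
    using \<phi> field_hom_on_inj[OF M(1), of \<phi>] by (auto simp: field_endo_def inj_on_def)
  have "y \<in> \<phi> ` M" if "y \<in> M" for y
  proof -
    have "(\<phi> ^^ (n - 1)) y \<in> M" using field_endo_funpow[OF \<phi>] that by (auto simp: field_endo_def)
    moreover have "\<phi> ((\<phi> ^^ (n - 1)) y) = (\<phi> ^^ n) y" using n(1) by (cases n) auto
    ultimately show ?thesis using n(2)[OF that] by (metis imageI)
  qed
  then have "bij_betw \<phi> M M" using inj \<phi> by (auto simp: bij_betw_def field_endo_def)
  then have "bij_betw (restrict \<phi> M) M M" by (subst bij_betw_cong[of M _ \<phi>]) auto
  then show ?thesis
    using \<phi> is_subfield_add[OF M(1)] is_subfield_mult[OF M(1)] M(2)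
    by (auto simp: galois_aut_def Bij_def field_endo_def field_hom_on_def)
qed

section \<open>From the norm equation to the extension\<close>

locale Phi2_41_tower =
  fixes p :: nat and z :: "'k::field alg_closure" and \<beta> \<gamma> y x :: "'k alg_closure"
    and s t :: "'k alg_closure \<Rightarrow> 'k alg_closure" and k K E M
  assumes p: "Factorial_Ring.prime p" "odd p"
    and k_def: "k = range to_ac" and K_def: "K = adjoin k \<beta>" and E_def: "E = adjoin K \<gamma>" and M_def: "M = adjoin E y"
    and z: "z \<in> k" "primitive_root (p ^ 3) z"
    and \<beta>: "pure_over p k \<beta>" "\<beta> \<noteq> 0" and \<gamma>: "pure_over p K \<gamma>" "\<gamma> ^ p \<in> k" "\<gamma> \<noteq> 0"
    and y: "pure_over (p ^ 3) E y" "y ^ (p ^ 3) \<in> K" "y \<noteq> 0" and x: "x \<in> K"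
    and s: "field_hom_on M s" "\<And>a. a \<in> k \<Longrightarrow> s a = a" "s \<beta> = z ^ p\<^sup>2 * \<beta>" "s \<gamma> = \<gamma>" "s y = x * \<gamma> * y"
    and t: "field_hom_on M t" "\<And>a. a \<in> k \<Longrightarrow> t a = a" "t \<beta> = \<beta>" "t \<gamma> = z ^ p\<^sup>2 * \<gamma>" "t y = y"
    and s_pow_p: "(s ^^ p) y = z * y"
begin

abbreviation "\<zeta> \<equiv> z ^ p\<^sup>2"
abbreviation "\<Gamma> \<equiv> galois_group k M"
abbreviation group_mult (infixl "\<bullet>" 70) where "\<sigma> \<bullet> \<tau> \<equiv> \<sigma> \<otimes>\<^bsub>\<Gamma>\<^esub> \<tau>"
abbreviation group_pow (infixr "\<up>" 75) where "\<sigma> \<up> n \<equiv> \<sigma> [^]\<^bsub>\<Gamma>\<^esub> (n :: nat)"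

lemma p0: "p > 0" using p(1) by (rule prime_gt_0_nat)

lemma \<zeta>: "primitive_root p \<zeta>"
  using primitive_root_power[of "p\<^sup>2" p z] z(2) by (simp add: power2_eq_square power3_eq_cube)

lemma subfields: "is_subfield k" "is_subfield K" "is_subfield E" "is_subfield M"
  and subsets: "k \<subseteq> K" "K \<subseteq> E" "E \<subseteq> M" "k \<subseteq> M" "K \<subseteq> M"
  and gens: "\<beta> \<in> K" "\<gamma> \<in> E" "y \<in> M" "\<beta> \<in> M" "\<gamma> \<in> M" "\<zeta> \<in> k"
proof -
  show 1: "is_subfield k" unfolding k_def by (rule is_subfield_range_to_ac)
  show 2: "is_subfield K" unfolding K_def using 1 k_def by (intro is_subfield_adjoin) auto
  show 3: "k \<subseteq> K" unfolding K_def by (rule adjoin_base[OF 1])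
  show 4: "is_subfield E" unfolding E_def using 2 3 k_def by (intro is_subfield_adjoin) auto
  show 5: "K \<subseteq> E" unfolding E_def by (rule adjoin_base[OF 2])
  show 6: "is_subfield M" unfolding M_def using 3 4 5 k_def by (intro is_subfield_adjoin) auto
  show 7: "E \<subseteq> M" unfolding M_def by (rule adjoin_base[OF 4])
  show "k \<subseteq> M" "K \<subseteq> M" using 3 5 7 by auto
  show 8: "\<beta> \<in> K" "\<gamma> \<in> E" "y \<in> M"
    unfolding K_def E_def M_def
    using adjoin_gen[OF 1] adjoin_gen[OF 2] adjoin_gen[OF 4] by (auto simp: K_def E_def)
  show "\<beta> \<in> M" "\<gamma> \<in> M" using 5 7 8 by auto
  show "\<zeta> \<in> k" using z(1) 1 by (simp add: is_subfield_power)
qed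

lemma endo_eq:
  assumes "field_endo k M \<phi>" "field_endo k M \<psi>" "\<phi> \<beta> = \<psi> \<beta>"
  shows "a \<in> K \<Longrightarrow> \<phi> a = \<psi> a"
    and "\<phi> \<gamma> = \<psi> \<gamma> \<Longrightarrow> a \<in> E \<Longrightarrow> \<phi> a = \<psi> a"
    and "\<phi> \<gamma> = \<psi> \<gamma> \<Longrightarrow> \<phi> y = \<psi> y \<Longrightarrow> a \<in> M \<Longrightarrow> \<phi> a = \<psi> a"
proof -
  have h: "field_hom_on M \<phi>" "field_hom_on M \<psi>" and k: "\<And>a. a \<in> k \<Longrightarrow> \<phi> a = \<psi> a"
    using assms by (auto simp: field_endo_def)
  show 1: "\<phi> a = \<psi> a" if "a \<in> K" for a
    using field_hom_on_adjoin_eq[OF subfields(1,4) _ h k assms(3)] that subsets(5) by (simp add: K_def)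
  show 2: "\<phi> a = \<psi> a" if "\<phi> \<gamma> = \<psi> \<gamma>" "a \<in> E" for a
    using field_hom_on_adjoin_eq[OF subfields(2,4) _ h 1 that(1)] that subsets(3) by (simp add: E_def)
  show "\<phi> a = \<psi> a" if "\<phi> \<gamma> = \<psi> \<gamma>" "\<phi> y = \<psi> y" "a \<in> M" for a
    using field_hom_on_adjoin_eq[OF subfields(3,4) _ h 2[OF that(1)] that(2)] that by (simp add: M_def)
qed

lemma endo_closed:
  assumes "field_hom_on M \<phi>" "\<And>a. a \<in> k \<Longrightarrow> \<phi> a = a" "\<phi> \<beta> \<in> M" "\<phi> \<gamma> \<in> M" "\<phi> y \<in> M"
  shows "field_endo k M \<phi>"
proof -
  have 0: "\<phi> a \<in> M" if "a \<in> k" for a using assms(2) that subsets(4) by auto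
  have 1: "\<phi> a \<in> M" if "a \<in> K" for a
    using field_hom_on_adjoin_closed[OF subfields(1,4) _ assms(1) subfields(4) 0 assms(3)] that subsets(5)
    by (simp add: K_def)
  have 2: "\<phi> a \<in> M" if "a \<in> E" for a
    using field_hom_on_adjoin_closed[OF subfields(2,4) _ assms(1) subfields(4) 1 assms(4)] that subsets(3)
    by (simp add: E_def)
  have "\<phi> a \<in> M" if "a \<in> M" for a
    using field_hom_on_adjoin_closed[OF subfields(3,4) _ assms(1) subfields(4) 2 assms(5)] that
    by (simp add: M_def)
  then show ?thesis using assms by (simp add: field_endo_def)
qed

lemma endo_s: "field_endo k M s" and endo_t: "field_endo k M t"
proof -
  note intros = is_subfield_mult[OF subfields(4)]
  have "\<zeta> \<in> M" "x \<in> M" using gens(6) x subsets by auto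
  then show "field_endo k M s" "field_endo k M t"
    using gens s t by (auto intro!: endo_closed intros)
qed

lemma endo_mult:
  assumes "field_endo k M \<phi>" "a \<in> k" "b \<in> M" shows "\<phi> (a * b) = a * \<phi> b"
  using assms field_hom_on_mult[of M \<phi> a b] subfields(4) subsets(4) by (auto simp: field_endo_def)

lemma s_funpow: "(s ^^ i) \<beta> = \<zeta> ^ i * \<beta>" "(s ^^ i) \<gamma> = \<gamma>"
  and t_funpow: "(t ^^ i) \<beta> = \<beta>" "(t ^^ i) \<gamma> = \<zeta> ^ i * \<gamma>" "(t ^^ i) y = y"
proof -
  have "\<zeta> ^ j \<in> k" for j using gens(6) subfields(1) by (simp add: is_subfield_power)
  note mult = endo_mult[OF endo_s this] endo_mult[OF endo_t this]
  show "(s ^^ i) \<beta> = \<zeta> ^ i * \<beta>" by (induction i) (simp_all add: mult gens s)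
  show "(s ^^ i) \<gamma> = \<gamma>" by (induction i) (simp_all add: s)
  show "(t ^^ i) \<beta> = \<beta>" by (induction i) (simp_all add: t)
  show "(t ^^ i) \<gamma> = \<zeta> ^ i * \<gamma>" by (induction i) (simp_all add: mult gens t)
  show "(t ^^ i) y = y" by (induction i) (simp_all add: t)
qed

lemma s_funpow_y: "(s ^^ (p * i)) y = z ^ i * y"
proof (induction i)
  case (Suc i)
  have "(s ^^ (p * Suc i)) y = (s ^^ p) ((s ^^ (p * i)) y)" by (simp add: funpow_add)
  also have "\<dots> = z ^ i * (s ^^ p) y" unfolding Suc
    using z(1) subfields(1) gens by (intro endo_mult field_endo_funpow endo_s) (auto intro: is_subfield_power)
  finally show ?case by (simp add: s_pow_p)
qed simp

lemma z_pow_eq_1: "z ^ i = 1 \<longleftrightarrow> p ^ 3 dvd i" and \<zeta>_pow_eq_1: "\<zeta> ^ i = 1 \<longleftrightarrow> p dvd i"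
  using z(2) \<zeta> by (auto simp: primitive_root_def)

lemma p4: "p ^ 4 = p * p ^ 3" by (simp add: eval_nat_numeral)

lemma s_order: "a \<in> M \<Longrightarrow> (s ^^ (p ^ 4)) a = a"
proof (rule endo_eq(3)[OF field_endo_funpow[OF endo_s] field_endo_id(1)])
  show "(s ^^ (p ^ 4)) \<beta> = \<beta>" using \<zeta>_pow_eq_1[of "p ^ 4"] by (simp add: s_funpow p4 dvd_mult2)
  show "(s ^^ (p ^ 4)) y = y" using z_pow_eq_1[of "p ^ 3"] unfolding p4 s_funpow_y by simp
qed (simp_all add: s_funpow)

lemma t_order: "a \<in> M \<Longrightarrow> (t ^^ p) a = a"
proof (rule endo_eq(3)[OF field_endo_funpow[OF endo_t] field_endo_id(1)])
  show "(t ^^ p) \<gamma> = \<gamma>" using \<zeta>_pow_eq_1[of p] by (simp add: t_funpow)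
qed (simp_all add: t_funpow)

definition "S = restrict s M"
definition "T = restrict t M"

lemma S: "S \<in> galois_aut k M" and T: "T \<in> galois_aut k M"
  unfolding S_def T_def
  using restrict_in_galois_aut[OF subfields(4) subsets(4) endo_s _ s_order]
    restrict_in_galois_aut[OF subfields(4) subsets(4) endo_t _ t_order] p0 by simp_all

sublocale \<Gamma>: group \<Gamma>
  using subfields subsets by (intro group_galois_group) (simp_all add: subfield_iff_is_subfield)

lemma galois_aut_eqI:
  assumes "\<sigma> \<in> galois_aut k M" "\<tau> \<in> galois_aut k M" "\<sigma> \<beta> = \<tau> \<beta>" "\<sigma> \<gamma> = \<tau> \<gamma>" "\<sigma> y = \<tau> y"
  shows "\<sigma> = \<tau>"
  using assms endo_eq(3)[of \<sigma> \<tau>] subfields(1) by (intro galois_aut_ext) (auto intro: field_endo_galois_aut)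

lemma ST_pow: "a \<in> M \<Longrightarrow> (S \<up> n) a = (s ^^ n) a" "a \<in> M \<Longrightarrow> (T \<up> n) a = (t ^^ n) a"
proof -
  have "(restrict \<phi> M ^^ n) a = (\<phi> ^^ n) a" if "field_endo k M \<phi>" "a \<in> M" for \<phi> a
  proof (induction n)
    case (Suc n)
    then show ?case using field_endo_funpow[OF that(1), of n] that(2) by (simp add: field_endo_def)
  qed simp
  then show "a \<in> M \<Longrightarrow> (S \<up> n) a = (s ^^ n) a" "a \<in> M \<Longrightarrow> (T \<up> n) a = (t ^^ n) a"
    using galois_group_pow[OF subfields(4) subsets(4)] S T endo_s endo_t by (simp_all add: S_def T_def)
qed

lemma in_carrier [simp]: "S \<in> carrier \<Gamma>" "T \<in> carrier \<Gamma>"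
  using S T by (simp_all add: galois_group_simps)

lemma pow_aut: "S \<up> n \<in> galois_aut k M" "T \<up> n \<in> galois_aut k M"
  using S T \<Gamma>.nat_pow_closed[of S n] \<Gamma>.nat_pow_closed[of T n] by (simp_all add: galois_group_simps del: \<Gamma>.nat_pow_closed)

lemma mult_aut: "\<sigma> \<in> galois_aut k M \<Longrightarrow> \<tau> \<in> galois_aut k M \<Longrightarrow> \<sigma> \<bullet> \<tau> \<in> galois_aut k M"
  using \<Gamma>.m_closed[of \<sigma> \<tau>] by (simp add: galois_group_simps)

definition "C = S \<up> (p ^ 3)"

lemma C: "C \<in> galois_aut k M" "C \<in> carrier \<Gamma>" "C \<beta> = \<beta>" "C \<gamma> = \<gamma>" "C y = \<zeta> * y"
proof -
  show "C \<in> galois_aut k M" "C \<in> carrier \<Gamma>" by (simp_all add: C_def pow_aut)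
  have "p ^ 3 = p * p\<^sup>2" by (simp add: eval_nat_numeral)
  then show "C \<beta> = \<beta>" "C \<gamma> = \<gamma>" "C y = \<zeta> * y"
    using s_funpow_y[of "p\<^sup>2"] \<zeta>_pow_eq_1[of "p ^ 3"] by (simp_all add: C_def ST_pow s_funpow gens)
qed

lemma ST_gens: "S \<beta> = \<zeta> * \<beta>" "S \<gamma> = \<gamma>" "S y = x * \<gamma> * y" "T \<beta> = \<beta>" "T \<gamma> = \<zeta> * \<gamma>" "T y = y"
  using gens s t by (simp_all add: S_def T_def)

lemma aut_mult: "\<sigma> \<in> galois_aut k M \<Longrightarrow> a \<in> M \<Longrightarrow> b \<in> M \<Longrightarrow> \<sigma> (a * b) = \<sigma> a * \<sigma> b"
  by (simp add: galois_aut_def)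

lemma relations:
  "T \<bullet> S = S \<bullet> (T \<bullet> C)" "C \<bullet> S = S \<bullet> C" "C \<bullet> T = T \<bullet> C"
  "T \<up> p = \<one>\<^bsub>\<Gamma>\<^esub>" "C \<up> p = \<one>\<^bsub>\<Gamma>\<^esub>"
proof -
  have \<zeta>k: "\<sigma> \<zeta> = \<zeta>" if "\<sigma> \<in> galois_aut k M" for \<sigma>
    using galois_aut_fixes[OF that gens(6)] .
  have xM: "x \<in> M" "\<zeta> \<in> M" using x gens(6) subsets by auto
  have K_fix: "\<sigma> x = x" if "\<sigma> \<in> galois_aut k M" "\<sigma> \<beta> = \<beta>" for \<sigma>
    using endo_eq(1)[of \<sigma> "\<lambda>x. x" x] that subfields(1) x by (simp add: field_endo_galois_aut field_endo_id)
  note m = is_subfield_mult[OF subfields(4)]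
  note simps = galois_group_mult mult_aut S T C ST_gens gens xM m aut_mult \<zeta>k K_fix[OF T] K_fix[OF C(1)]
  show "T \<bullet> S = S \<bullet> (T \<bullet> C)" "C \<bullet> S = S \<bullet> C" "C \<bullet> T = T \<bullet> C"
    by (rule galois_aut_eqI; simp add: simps)+
  have one: "\<one>\<^bsub>\<Gamma>\<^esub> \<in> galois_aut k M" using \<Gamma>.one_closed by (simp add: galois_group_simps)
  show "T \<up> p = \<one>\<^bsub>\<Gamma>\<^esub>"
    using t_order gens by (intro galois_aut_eqI pow_aut one) (simp_all add: ST_pow galois_group_simps)
  have "C \<up> p = S \<up> (p ^ 4)"
    by (simp add: C_def \<Gamma>.nat_pow_pow eval_nat_numeral mult.commute)
  also have "\<dots> = \<one>\<^bsub>\<Gamma>\<^esub>"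
    using s_order gens by (intro galois_aut_eqI pow_aut one) (simp_all add: ST_pow galois_group_simps)
  finally show "C \<up> p = \<one>\<^bsub>\<Gamma>\<^esub>" .
qed

lemma exhaust:
  assumes \<sigma>: "\<sigma> \<in> galois_aut k M"
  obtains i j :: nat where "\<sigma> = S \<up> i \<bullet> T \<up> j"
proof -
  have hom: "field_hom_on M \<sigma>" using subfields(1) \<sigma> by (rule galois_aut_field_hom_on)
  have pow: "\<sigma> (a ^ n) = \<sigma> a ^ n" if "a \<in> M" for a n
    using field_hom_on_power[OF subfields(4) hom that] .
  have kummer: "\<exists>i. \<sigma> a = \<zeta> ^ i * a" if "a \<in> M" "a ^ p \<in> k" "a \<noteq> 0" for a
  proof -
    have "\<sigma> a ^ p = a ^ p" using pow[OF that(1)] galois_aut_fixes[OF \<sigma> that(2)] by metis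
    then have "(\<sigma> a / a) ^ p = 1" using that(3) by (simp add: power_divide)
    then obtain i where "\<sigma> a / a = \<zeta> ^ i" using primitive_root_exhaust[OF \<zeta>] by metis
    then have "\<sigma> a = \<zeta> ^ i * a" using that(3) by (simp add: field_simps)
    then show ?thesis ..
  qed
  obtain i where i: "\<sigma> \<beta> = \<zeta> ^ i * \<beta>" using kummer[of \<beta>] gens \<beta> by (auto simp: pure_over_def)
  obtain j where j: "\<sigma> \<gamma> = \<zeta> ^ j * \<gamma>" using kummer[of \<gamma>] gens \<gamma> by auto
  define \<tau> where "\<tau> = s ^^ i"
  have \<tau>: "field_endo k M \<tau>" unfolding \<tau>_def by (rule field_endo_funpow[OF endo_s])
  have "\<sigma> (y ^ p ^ 3) = \<tau> (y ^ p ^ 3)"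
    by (rule endo_eq(1)[OF field_endo_galois_aut[OF subfields(1) \<sigma>] \<tau> _ y(2)]) (simp only: \<tau>_def s_funpow i)
  then have "\<sigma> y ^ p ^ 3 = \<tau> y ^ p ^ 3"
    using pow[OF gens(3), of "p ^ 3"] field_hom_on_power[OF subfields(4) _ gens(3), of \<tau> "p ^ 3"] \<tau>
    unfolding field_endo_def by metis
  moreover have \<tau>y: "\<tau> y \<noteq> 0"
    using field_hom_on_nonzero[OF subfields(4) _ gens(3) y(3), of \<tau>] \<tau> by (simp add: field_endo_def)
  ultimately have "(\<sigma> y / \<tau> y) ^ p ^ 3 = 1" by (simp add: power_divide)
  then obtain l where "\<sigma> y / \<tau> y = z ^ l" using primitive_root_exhaust[OF z(2)] by metis
  then have l: "\<sigma> y = z ^ l * \<tau> y" using \<tau>y by (simp add: field_simps)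
  have zk: "z ^ n \<in> k" "\<zeta> ^ n \<in> k" for n
    using z(1) gens(6) subfields(1) by (simp_all add: is_subfield_power)
  note em = endo_mult[OF field_endo_funpow[OF endo_s] zk(1)] endo_mult[OF field_endo_funpow[OF endo_s] zk(2)]
  show ?thesis
  proof (rule that, rule galois_aut_eqI[OF \<sigma> mult_aut[OF pow_aut]])
    show "\<sigma> \<beta> = (S \<up> (i + p * l) \<bullet> T \<up> j) \<beta>"
      using i gens \<zeta>_pow_eq_1[of "p * l"]
      by (simp add: galois_group_mult pow_aut ST_pow t_funpow s_funpow power_add)
    show "\<sigma> \<gamma> = (S \<up> (i + p * l) \<bullet> T \<up> j) \<gamma>"
      using j gens subsets zk(2)[of j] is_subfield_mult[OF subfields(4), of "\<zeta> ^ j" \<gamma>]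
      by (auto simp: galois_group_mult pow_aut ST_pow t_funpow s_funpow em)
    show "\<sigma> y = (S \<up> (i + p * l) \<bullet> T \<up> j) y"
      using l gens
      by (simp add: galois_group_mult pow_aut ST_pow t_funpow funpow_add s_funpow_y em \<tau>_def)
  qed
qed

lemma injective:
  assumes "i < p ^ 4" "j < p" "S \<up> i \<bullet> T \<up> j = \<one>\<^bsub>\<Gamma>\<^esub>"
  shows "i = 0 \<and> j = 0"
proof -
  have zk: "\<zeta> ^ n \<in> k" for n using gens(6) subfields(1) by (simp add: is_subfield_power)
  have *: "(s ^^ i) ((t ^^ j) a) = a" if "a \<in> M" for a
  proof -
    have "(S \<up> i \<bullet> T \<up> j) a = a" using assms(3) that by (simp add: galois_group_simps)
    moreover have "(t ^^ j) a \<in> M" using field_endo_funpow[OF endo_t] that by (auto simp: field_endo_def)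
    ultimately show ?thesis using that by (simp add: galois_group_mult pow_aut ST_pow)
  qed
  have "\<zeta> ^ j * \<gamma> = \<gamma>" using *[OF gens(5)] gens
    by (simp add: t_funpow endo_mult[OF field_endo_funpow[OF endo_s] zk] s_funpow)
  then have "\<zeta> ^ j = 1" using \<gamma>(3) by simp
  then have j: "j = 0" using \<zeta>_pow_eq_1 assms(2) by (metis dvd_imp_le neq0_conv not_le)
  have "\<zeta> ^ i = 1" using *[OF gens(4)] \<beta>(2) by (simp add: t_funpow s_funpow)
  then obtain l where l: "i = p * l" using \<zeta>_pow_eq_1 by blast
  have "z ^ l = 1" using *[OF gens(3)] y(3) by (simp add: t_funpow l s_funpow_y)
  then have "p ^ 3 dvd l" using z_pow_eq_1 by simp
  then have "p ^ 4 dvd i" unfolding l p4 by (rule mult_dvd_mono[OF dvd_refl])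
  then show ?thesis using assms(1) j by (metis dvd_imp_le neq0_conv not_le)
qed

lemma galois_group_iso: "\<Gamma> \<cong> Phi2_41 p"
proof -
  define f where "f g = (case g of gen_\<alpha> \<Rightarrow> S | gen_\<alpha>1 \<Rightarrow> T | gen_\<alpha>2 \<Rightarrow> C)" for g
  have f: "range f \<subseteq> carrier \<Gamma>"
    using C(2) by (auto simp: f_def split: Phi2_41_gen.splits)
  have comm: "inv\<^bsub>\<Gamma>\<^esub> u \<bullet> (inv\<^bsub>\<Gamma>\<^esub> v \<bullet> (u \<bullet> v)) = w"
    if "u \<bullet> v = v \<bullet> (u \<bullet> w)" "u \<in> carrier \<Gamma>" "v \<in> carrier \<Gamma>" "w \<in> carrier \<Gamma>" for u v w
  proof -
    have cancel: "inv\<^bsub>\<Gamma>\<^esub> w \<bullet> (w \<bullet> t) = t" if "w \<in> carrier \<Gamma>" "t \<in> carrier \<Gamma>" for w t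
      using that by (simp add: \<Gamma>.m_assoc[symmetric])
    show ?thesis using that(2-4) by (simp add: that(1) cancel)
  qed
  have comm1: "inv\<^bsub>\<Gamma>\<^esub> T \<bullet> (inv\<^bsub>\<Gamma>\<^esub> S \<bullet> (T \<bullet> S)) = C"
    by (intro comm relations) (simp_all add: C)
  have comm2: "inv\<^bsub>\<Gamma>\<^esub> C \<bullet> (inv\<^bsub>\<Gamma>\<^esub> S \<bullet> (C \<bullet> S)) = \<one>\<^bsub>\<Gamma>\<^esub>"
    "inv\<^bsub>\<Gamma>\<^esub> C \<bullet> (inv\<^bsub>\<Gamma>\<^esub> T \<bullet> (C \<bullet> T)) = \<one>\<^bsub>\<Gamma>\<^esub>"
    by (intro comm; simp add: C relations)+
  have val: "word_value \<Gamma> f (gen_word gen_\<alpha>) = S" "word_value \<Gamma> f (gen_word gen_\<alpha>1) = T"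
    "word_value \<Gamma> f (gen_word gen_\<alpha>2) = C"
    using f by (simp_all add: \<Gamma>.word_value_gen) (simp_all add: f_def)
  have rel: "word_value \<Gamma> f u = word_value \<Gamma> f v" if "(u, v) \<in> Phi2_41_relations p" for u v
    using that unfolding Phi2_41_relations_def Let_def
    by (auto simp only: insert_iff empty_iff prod.inject \<Gamma>.word_value_comm[OF f]
        \<Gamma>.word_value_pow[OF f] \<Gamma>.word_value_Nil val C_def[symmetric] relations(4,5) comm1 comm2)
  obtain h where h: "h \<in> hom (Phi2_41 p) \<Gamma>"
    "\<And>w. h (pres_class (Phi2_41_relations p) w) = word_value \<Gamma> f w"
    using presented_group_universal[OF \<Gamma>.group_axioms f rel] unfolding Phi2_41_def by metis
  interpret G: group "Phi2_41 p" by (rule Phi2_41_group)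
  interpret h: group_hom "Phi2_41 p" \<Gamma> h
    using h(1) by unfold_locales
  define a where "a = pres_class (Phi2_41_relations p) (gen_word gen_\<alpha>)"
  define b where "b = pres_class (Phi2_41_relations p) (gen_word gen_\<alpha>1)"
  have ab: "a \<in> carrier (Phi2_41 p)" "b \<in> carrier (Phi2_41 p)" "h a = S" "h b = T"
    using Phi2_41_facts(1,2)[of p] by (simp_all add: a_def b_def h(2) val)
  have hij: "h (a [^]\<^bsub>Phi2_41 p\<^esub> (i::nat) \<otimes>\<^bsub>Phi2_41 p\<^esub> b [^]\<^bsub>Phi2_41 p\<^esub> (j::nat)) =
    S \<up> i \<bullet> T \<up> j" for i j
    using ab by (simp add: h.hom_nat_pow)
  have "inj_on h (carrier (Phi2_41 p))"
    unfolding h.inj_on_one_iff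
  proof (intro allI impI)
    fix g assume g: "g \<in> carrier (Phi2_41 p)" "h g = \<one>\<^bsub>\<Gamma>\<^esub>"
    then obtain i j where "i < p ^ 4" "j < p" "g = a [^]\<^bsub>Phi2_41 p\<^esub> (i::nat) \<otimes>\<^bsub>Phi2_41 p\<^esub> b [^]\<^bsub>Phi2_41 p\<^esub> (j::nat)"
      using Phi2_41_normal_form[OF p0] by (auto simp: a_def b_def)
    then show "g = \<one>\<^bsub>Phi2_41 p\<^esub>" using injective[of i j] g(2) hij[of i j] by simp
  qed
  moreover have "h ` carrier (Phi2_41 p) = carrier \<Gamma>"
  proof
    show "carrier \<Gamma> \<subseteq> h ` carrier (Phi2_41 p)"
    proof
      fix \<sigma> assume "\<sigma> \<in> carrier \<Gamma>"
      then obtain i j :: nat where "\<sigma> = S \<up> i \<bullet> T \<up> j"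
        using exhaust by (auto simp: galois_group_simps)
      then show "\<sigma> \<in> h ` carrier (Phi2_41 p)"
        using hij[of i j] ab by (metis G.m_closed G.nat_pow_closed imageI)
    qed
  qed auto
  ultimately have "h \<in> iso (Phi2_41 p) \<Gamma>" using h(1) by (simp add: iso_def bij_betw_def)
  then show ?thesis by (intro G.iso_sym) (auto simp: is_iso_def)
qed

lemma galois: "galois_extension k M"
proof -
  have fixed: "a \<in> k" if a: "a \<in> M" "\<And>\<sigma>. \<sigma> \<in> galois_aut k M \<Longrightarrow> \<sigma> a = a" for a
  proof -
    have "s a = a" "t a = a" using a(2)[OF S] a(2)[OF T] a(1) by (simp_all add: S_def T_def)
    then have sa: "(s ^^ n) a = a" for n by (induction n) auto
    note sp = field_endo_funpow[OF endo_s, of p]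
    have z': "z \<in> E" "\<zeta> \<in> K" using z(1) gens(6) subsets by auto
    have 1: "(s ^^ p) b = b" if "b \<in> E" for b
      using endo_eq(2)[OF sp field_endo_id(1) _ _ that] \<zeta>_pow_eq_1[of p] by (simp add: s_funpow)
    have "a \<in> E"
      using pure_fixed[of E "p ^ 3" y z M "s ^^ p" a] subfields y(1) z'(1) z(2) sp 1 s_pow_p a(1) sa
      by (simp add: M_def field_endo_def)
    have 2: "t b = b" if "b \<in> K" for b
      using endo_eq(1)[OF endo_t field_endo_id(1) _ that] t by simp
    have "a \<in> K"
      using pure_fixed[of K p \<gamma> \<zeta> M t a] subfields subsets \<gamma>(1) z'(2) \<zeta> t(1,4) 2 \<open>t a = a\<close> \<open>a \<in> E\<close>
      by (simp add: E_def)
    then show "a \<in> k"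
      using pure_fixed[of k p \<beta> \<zeta> M s a] subfields subsets \<beta>(1) gens(6) \<zeta> s(1-3) \<open>s a = a\<close>
      by (simp add: K_def)
  qed
  then have "{a \<in> M. \<forall>\<sigma>\<in>galois_aut k M. \<sigma> a = a} = k"
    using subsets(4) galois_aut_fixes by auto
  then show ?thesis
    using subfields subsets
    by (auto simp: galois_extension_def subfield_iff_is_subfield k_def algebraic_over_range_to_ac)
qed

end

lemma independent_mod_powers_pair:
  "independent_mod_powers p [a, b] \<longleftrightarrow> a \<noteq> 0 \<and> b \<noteq> 0 \<and>
    (\<forall>m n c. c \<noteq> 0 \<longrightarrow> a powi m * b powi n = c ^ p \<longrightarrow> int p dvd m \<and> int p dvd n)"
proof -
  have all: "(\<forall>i<length [a, b]. P i) \<longleftrightarrow> P 0 \<and> P 1" for P :: "nat \<Rightarrow> bool"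
    by (auto simp: less_Suc_eq)
  have "(\<forall>e :: nat \<Rightarrow> int. Q (e 0) (e 1)) \<longleftrightarrow> (\<forall>m n. Q m n)" for Q :: "int \<Rightarrow> int \<Rightarrow> bool"
  proof safe
    fix m n assume "\<forall>e :: nat \<Rightarrow> int. Q (e 0) (e 1)"
    from this[rule_format, of "\<lambda>i. if i = 0 then m else n"] show "Q m n" by simp
  qed blast
  note e = this[of "\<lambda>m n. (\<exists>c. c \<noteq> 0 \<and> a powi m * b powi n = c ^ p) \<longrightarrow> int p dvd m \<and> int p dvd n"]
  have prod: "(\<Prod>i<length [a, b]. ([a, b] ! i) powi e i) = a powi e 0 * b powi e 1" for e
    by (simp add: lessThan_Suc mult.commute)
  show ?thesis
    unfolding independent_mod_powers_def all prod e by auto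
qed

lemma hilbert_90:
  assumes K: "is_subfield K" and \<sigma>: "field_endo k K \<sigma>" "\<And>a. a \<in> K \<Longrightarrow> (\<sigma> ^^ p) a = a"
    and \<zeta>: "primitive_root p \<zeta>" "\<zeta> \<in> k" "k \<subseteq> K" and \<beta>: "\<beta> \<in> K" "\<beta> \<noteq> 0" "\<sigma> \<beta> = \<zeta> * \<beta>"
    and p: "of_nat p \<noteq> (0 :: 'a::field)"
    and w: "w \<in> K" "(\<Prod>q<p. (\<sigma> ^^ q) w) = (1 :: 'a)"
  obtains \<theta> where "\<theta> \<in> K" "\<theta> \<noteq> 0" "\<sigma> \<theta> = w * \<theta>"
proof -
  have p0: "p > 0" using \<zeta>(1) by (simp add: primitive_root_def)
  have closed: "(\<sigma> ^^ i) a \<in> K" if "a \<in> K" for i a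
    using field_endo_funpow[OF \<sigma>(1), of i] that by (simp add: field_endo_def)
  have hom: "field_hom_on K \<sigma>" using \<sigma>(1) by (simp add: field_endo_def)
  have w0: "w \<noteq> 0"
    using w(2) p0 by (metis One_nat_def funpow_0 lessThan_iff finite_lessThan prod_zero_iff zero_neq_one)
  have \<zeta>K: "\<zeta> ^ i \<in> K" for i using \<zeta>(2,3) K by (auto intro: is_subfield_power)
  have \<sigma>\<zeta>: "\<sigma> (\<zeta> ^ i) = \<zeta> ^ i" for i
    using \<sigma>(1) \<zeta>(2,3) field_hom_on_power[OF K hom, of \<zeta> i] by (auto simp: field_endo_def)
  have \<sigma>\<beta>: "(\<sigma> ^^ i) \<beta> = \<zeta> ^ i * \<beta>" for i
    by (induction i) (simp_all add: field_hom_on_mult[OF K hom] \<zeta>K \<sigma>\<zeta> \<beta>)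
  define b where "b i = (\<Prod>j<i. inverse ((\<sigma> ^^ j) w))" for i
  have bK: "b i \<in> K" for i
    unfolding b_def using w(1) K by (intro is_subfield_prod is_subfield_inverse closed)
  have \<sigma>b: "\<sigma> (b i) = w * b (Suc i)" for i
  proof -
    have "\<sigma> (b i) = (\<Prod>j<i. inverse ((\<sigma> ^^ Suc j) w))"
      unfolding b_def
      by (simp add: field_hom_on_prod[OF K hom] field_hom_on_inverse[OF K hom] is_subfield_inverse[OF K] closed w(1))
    also have "\<dots> = w * b (Suc i)"
      unfolding b_def prod.lessThan_Suc_shift using w0 by simp
    finally show ?thesis .
  qed
  have bp: "b p = 1"
    unfolding b_def using w(2) prod_inversef[of "\<lambda>j. (\<sigma> ^^ j) w" "{..<p}"] by (simp add: comp_def)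
  define \<theta> where "\<theta> u = (\<Sum>i<p. b i * (\<sigma> ^^ i) u)" for u
  have \<theta>K: "\<theta> u \<in> K" if "u \<in> K" for u
    unfolding \<theta>_def using that by (intro is_subfield_sum[OF K] is_subfield_mult[OF K] bK closed)
  have \<sigma>\<theta>: "\<sigma> (\<theta> u) = w * \<theta> u" if "u \<in> K" for u
  proof -
    have "\<sigma> (\<theta> u) = (\<Sum>i<p. w * (b (Suc i) * (\<sigma> ^^ Suc i) u))"
      unfolding \<theta>_def using that
      by (simp add: field_hom_on_sum[OF K hom] field_hom_on_mult[OF K hom] is_subfield_mult[OF K] bK closed \<sigma>b mult.assoc)
    also have "\<dots> = w * (\<Sum>i<p. b (Suc i) * (\<sigma> ^^ Suc i) u)" by (rule sum_distrib_left[symmetric])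
    also have "(\<Sum>i<p. b (Suc i) * (\<sigma> ^^ Suc i) u) = \<theta> u + b p * (\<sigma> ^^ p) u - b 0 * (\<sigma> ^^ 0) u"
      unfolding \<theta>_def using sum.lessThan_Suc_shift[of "\<lambda>i. b i * (\<sigma> ^^ i) u" p]
      by (simp add: algebra_simps)
    also have "\<dots> = \<theta> u" using \<sigma>(2)[OF that] bp by (simp add: b_def)
    finally show ?thesis .
  qed
  have "\<exists>l<p. \<theta> (\<beta> ^ l) \<noteq> 0"
  proof (rule ccontr)
    assume "\<not> ?thesis"
    then have "0 = (\<Sum>l<p. \<theta> (\<beta> ^ l) / \<beta> ^ l)" by simp
    also have "\<dots> = (\<Sum>l<p. \<Sum>i<p. b i * \<zeta> ^ (l * i))"
    proof (rule sum.cong[OF HOL.refl])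
      fix l
      have "(\<sigma> ^^ i) (\<beta> ^ l) = \<zeta> ^ (l * i) * \<beta> ^ l" for i
        using field_hom_on_power[OF K _ \<beta>(1), of "\<sigma> ^^ i" l] field_endo_funpow[OF \<sigma>(1), of i]
        by (simp add: field_endo_def \<sigma>\<beta> power_mult_distrib mult.commute flip: power_mult)
      then show "\<theta> (\<beta> ^ l) / \<beta> ^ l = (\<Sum>i<p. b i * \<zeta> ^ (l * i))"
        using \<beta>(2) by (simp add: \<theta>_def sum_divide_distrib)
    qed
    also have "\<dots> = (\<Sum>i<p. b i * (\<Sum>l<p. \<zeta> ^ (l * i)))"
      by (subst sum.swap) (simp add: sum_distrib_left)
    also have "\<dots> = (\<Sum>i<p. if i = 0 then b i * of_nat p else 0)"
      by (intro sum.cong HOL.refl) (auto simp: primitive_root_sum[OF \<zeta>(1)] dest: dvd_imp_le)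
    also have "\<dots> = of_nat p" using p0 by (simp add: b_def)
    finally show False using p by simp
  qed
  then obtain l where "\<theta> (\<beta> ^ l) \<noteq> 0" by blast
  then show ?thesis
    using that[of "\<theta> (\<beta> ^ l)"] \<theta>K \<sigma>\<theta> \<beta>(1) is_subfield_power[OF K] by blast
qed

abbreviation ac_poly :: "'k::field poly \<Rightarrow> 'k alg_closure \<Rightarrow> 'k alg_closure" where
  "ac_poly P x \<equiv> poly (map_poly to_ac P) x"

lemma to_ac_primitive_root: "primitive_root n (to_ac z) \<longleftrightarrow> primitive_root n z"
  by (simp add: primitive_root_def flip: to_ac_power)

lemma pure_over_base:
  fixes b z :: "'k::field"
  assumes p: "Factorial_Ring.prime p" and z: "primitive_root p z"
    and b: "\<And>c. b \<noteq> c ^ p" and \<beta>: "\<beta> ^ p = to_ac b"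
  shows "pure_over p (range to_ac) \<beta>"
proof -
  have "\<beta> \<notin> range to_ac"
  proof
    assume "\<beta> \<in> range to_ac"
    then obtain c where "\<beta> = to_ac c" by blast
    then have "to_ac b = to_ac (c ^ p)" using \<beta> by simp
    then show False using b unfolding to_ac_eq_iff by blast
  qed
  then show ?thesis
    using pure_overI[OF is_subfield_range_to_ac, of "to_ac z" p 0 \<beta>] p z \<beta>
    by (simp add: to_ac_primitive_root)
qed

lemma ac_poly_in_adjoin: "ac_poly P \<beta> \<in> adjoin (range to_ac) \<beta>"
  by (intro adjoinI) (auto simp: poly_over_def coeff_map_poly)

lemma field_endo_ac_poly:
  assumes M: "is_subfield M" "range to_ac \<subseteq> M" and \<phi>: "field_endo (range to_ac) M \<phi>" and x: "x \<in> M"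
  shows "\<phi> (ac_poly P x) = ac_poly P (\<phi> x)"
proof -
  have h: "field_hom_on M \<phi>" using \<phi> by (simp add: field_endo_def)
  have P: "poly_over M (map_poly to_ac P)" using M(2) by (auto simp: poly_over_def coeff_map_poly)
  have "map_poly \<phi> (map_poly to_ac P) = map_poly to_ac P"
    using \<phi> field_hom_on_zero[OF M(1) h] by (intro poly_eqI) (simp add: coeff_map_poly field_endo_def)
  then show ?thesis using field_hom_on_poly[OF M(1) h P x] by simp
qed

theorem norm_equation_imp_realizable:
  fixes a1 a2 z :: "'k::field" and h d :: "'k poly"
  assumes p: "Factorial_Ring.prime p" "odd p" and char: "of_nat p \<noteq> (0 :: 'k)"
    and z: "primitive_root (p ^ 3) z" and ind: "independent_mod_powers p [a1, a2]"
    and \<beta>: "\<beta> ^ p = to_ac a2" and d: "ac_poly d \<beta> \<noteq> 0"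
    and norm: "(\<Prod>q<p. ac_poly h (to_ac (z ^ p\<^sup>2) ^ q * \<beta>)) =
      to_ac (inverse z * a1) * (\<Prod>q<p. ac_poly d (to_ac (z ^ p\<^sup>2) ^ q * \<beta>))"
  shows "realizable_as_galois_group TYPE('k) (Phi2_41 p)"
proof -
  have p0: "p > 0" using p(1) by (rule prime_gt_0_nat)
  have p1: "\<not> int p dvd 1" using prime_gt_1_nat[OF p(1)] by simp
  define Z \<zeta> A where "Z = to_ac z" and "\<zeta> = Z ^ p\<^sup>2" and "A = to_ac a1"
  have Z: "primitive_root (p ^ 3) Z" using z by (simp add: Z_def to_ac_primitive_root)
  have z\<zeta>: "primitive_root p (z ^ p\<^sup>2)"
    using primitive_root_power[of "p\<^sup>2" p z] z by (simp add: power2_eq_square power3_eq_cube)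
  have \<zeta>_ac: "to_ac (z ^ p\<^sup>2) = \<zeta>" by (simp add: \<zeta>_def Z_def)
  have \<zeta>: "primitive_root p \<zeta>" using z\<zeta> unfolding \<zeta>_ac[symmetric] to_ac_primitive_root .
  have nz: "a1 \<noteq> 0" "a2 \<noteq> 0" "A \<noteq> 0" "\<beta> \<noteq> 0" "Z \<noteq> 0" "\<zeta> \<noteq> 0"
    using ind \<beta> p0 primitive_root_nonzero[OF Z]
    by (auto simp: independent_mod_powers_pair A_def \<zeta>_def power_0_left)
  have ind': "int p dvd m \<and> int p dvd n" if "c \<noteq> 0" "a1 powi m * a2 powi n = c ^ p" for m n c
    using ind that unfolding independent_mod_powers_pair by blast

  define k where "k = range (to_ac :: 'k \<Rightarrow> _)"
  have k: "is_subfield k" unfolding k_def by (rule is_subfield_range_to_ac)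
  have in_k: "Z \<in> k" "\<zeta> \<in> k" "A \<in> k"
  proof -
    show "Z \<in> k" "A \<in> k" by (simp_all add: k_def Z_def A_def)
    then show "\<zeta> \<in> k" unfolding \<zeta>_def by (intro is_subfield_power[OF k])
  qed
  have "a2 \<noteq> c ^ p" for c
    using ind'[of c 0 1] nz p1 p0 by (cases "c = 0") auto
  then have \<beta>_pure: "pure_over p k \<beta>"
    unfolding k_def using pure_over_base[OF p(1) z\<zeta> _ \<beta>] by blast
  define K where "K = adjoin k \<beta>"
  have K: "is_subfield K" unfolding K_def using k by (intro is_subfield_adjoin) (simp_all add: k_def)
  have kK: "k \<subseteq> K" and \<beta>K: "\<beta> \<in> K" unfolding K_def using k by (auto intro: adjoin_gen dest: adjoin_base)
  have "field_hom_on k (\<lambda>x. x)" by (simp add: field_hom_on_def)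
  moreover have "(\<zeta> * \<beta>) ^ p = \<beta> ^ p" using \<zeta> by (simp add: power_mult_distrib primitive_root_def)
  ultimately obtain \<sigma> where \<sigma>: "field_hom_on K \<sigma>" "\<And>a. a \<in> k \<Longrightarrow> \<sigma> a = a" "\<sigma> \<beta> = \<zeta> * \<beta>"
    using pure_extend[OF k \<beta>_pure] unfolding K_def by metis
  have "\<sigma> a \<in> K" if "a \<in> K" for a
    using field_hom_on_adjoin_closed[OF k K _ \<sigma>(1) K, of \<beta> a] \<sigma> that kK \<beta>K in_k is_subfield_mult[OF K]
    by (auto simp: K_def[symmetric])
  then have endo: "field_endo k K \<sigma>" using \<sigma> by (simp add: field_endo_def)
  have endo': "field_endo (range to_ac) K (\<sigma> ^^ i)" for i
    using field_endo_funpow[OF endo] by (simp add: k_def)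
  have closed: "(\<sigma> ^^ i) a \<in> K" if "a \<in> K" for i a
    using endo'[of i] that by (simp add: field_endo_def)
  have homi: "field_hom_on K (\<sigma> ^^ i)" and fixi: "a \<in> k \<Longrightarrow> (\<sigma> ^^ i) a = a" for i a
    using endo'[of i] by (auto simp: field_endo_def k_def)
  have \<sigma>\<beta>: "(\<sigma> ^^ i) \<beta> = \<zeta> ^ i * \<beta>" for i
    using \<sigma> in_k kK \<beta>K is_subfield_power[OF k in_k(2)]
    by (induction i) (auto simp: field_hom_on_mult[OF K \<sigma>(1)] subset_iff)
  have order: "(\<sigma> ^^ p) a = a" if "a \<in> K" for a
    using field_hom_on_adjoin_eq[OF k K _ homi[of p] field_endo_id(1)[of k K, unfolded field_endo_def, THEN conjunct1], of \<beta> a]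
      that fixi \<sigma>\<beta>[of p] \<zeta> by (simp add: K_def[symmetric] primitive_root_def)

  define D H x where "D = ac_poly d \<beta>" and "H = ac_poly h \<beta>" and "x = D / H"
  have DH: "D \<in> K" "H \<in> K" unfolding D_def H_def K_def k_def by (rule ac_poly_in_adjoin)+
  have \<sigma>D: "ac_poly d (\<zeta> ^ i * \<beta>) = (\<sigma> ^^ i) D" and \<sigma>H: "ac_poly h (\<zeta> ^ i * \<beta>) = (\<sigma> ^^ i) H" for i
    using field_endo_ac_poly[OF K _ endo' \<beta>K] kK \<sigma>\<beta>[of i] by (simp_all add: D_def H_def k_def)
  have norm': "(\<Prod>q<p. (\<sigma> ^^ q) H) = A / Z * (\<Prod>q<p. (\<sigma> ^^ q) D)"
    using norm unfolding \<zeta>_ac \<sigma>D \<sigma>H by (simp add: A_def Z_def field_simps)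
  have ND: "(\<Prod>q<p. (\<sigma> ^^ q) D) \<noteq> 0"
    using field_hom_on_nonzero[OF K homi DH(1)] d by (simp add: D_def)
  have "H \<noteq> 0"
  proof
    assume "H = 0"
    then have "(\<Prod>q<p. (\<sigma> ^^ q) H) = 0" using p0 by (intro prod_zero) (auto intro!: bexI[of _ 0])
    then show False using norm' ND nz by simp
  qed
  have xK: "x \<in> K" and x0: "x \<noteq> 0"
    using DH K d \<open>H \<noteq> 0\<close> by (auto simp: x_def D_def[symmetric] intro: is_subfield_divide)
  have Nx: "(\<Prod>q<p. (\<sigma> ^^ q) x) = Z / A"
  proof -
    have "(\<Prod>q<p. (\<sigma> ^^ q) x) = (\<Prod>q<p. (\<sigma> ^^ q) D) / (\<Prod>q<p. (\<sigma> ^^ q) H)"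
      by (simp add: x_def field_hom_on_divide[OF K homi] DH prod_dividef)
    then show ?thesis using norm' ND nz by (simp add: field_simps)
  qed
  have AK: "A ^ i \<in> K" "A \<in> K" for i using in_k kK K by (auto intro: is_subfield_power)
  have fixA: "(\<sigma> ^^ q) (A ^ i) = A ^ i" for q i
    using fixi[OF is_subfield_power[OF k in_k(3)]] .
  define w where "w = x ^ p ^ 3 * A ^ p\<^sup>2"
  have wK: "w \<in> K" unfolding w_def using xK AK by (intro is_subfield_mult[OF K] is_subfield_power[OF K])
  have Nw: "(\<Prod>q<p. (\<sigma> ^^ q) w) = 1"
  proof -
    have "(\<sigma> ^^ q) w = (\<sigma> ^^ q) x ^ p ^ 3 * A ^ p\<^sup>2" for q
      using xK AK by (simp add: w_def field_hom_on_mult[OF K homi] field_hom_on_power[OF K homi]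
        is_subfield_power[OF K] fixA)
    then have "(\<Prod>q<p. (\<sigma> ^^ q) w) = (\<Prod>q<p. (\<sigma> ^^ q) x) ^ p ^ 3 * (A ^ p\<^sup>2) ^ p"
      by (simp add: prod.distrib prod_power_distrib)
    also have "(A ^ p\<^sup>2) ^ p = A ^ p ^ 3" by (simp add: eval_nat_numeral mult_ac flip: power_mult)
    finally show ?thesis
      unfolding Nx using nz Z by (simp add: power_divide primitive_root_def)
  qed
  have "of_nat p \<noteq> (0 :: 'k alg_closure)"
    using char by (metis to_ac_of_nat to_ac_eq_0_iff)
  then obtain \<theta> where \<theta>: "\<theta> \<in> K" "\<theta> \<noteq> 0" "\<sigma> \<theta> = w * \<theta>"
    using hilbert_90[OF K endo order \<zeta> in_k(2) kK \<beta>K nz(4) \<sigma>(3) _ wK Nw] by blast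

  obtain \<gamma> where \<gamma>: "\<gamma> ^ p = A" using nth_root_exists[OF p0] by blast
  have \<gamma>0: "\<gamma> \<noteq> 0" using \<gamma> nz p0 by (auto simp: power_0_left)
  have "\<gamma> \<notin> K"
  proof
    assume "\<gamma> \<in> K"
    then obtain c j where c: "c \<in> k" "\<gamma> = c * \<beta> ^ j"
      using pure_power_in_base[OF k \<beta>_pure in_k(2) \<zeta> _ nz(4), of \<gamma>] K \<gamma> in_k unfolding K_def by metis
    then obtain c' where c': "c = to_ac c'" by (auto simp: k_def)
    have "to_ac a1 = to_ac (c' ^ p * a2 ^ j)"
      using \<gamma> \<beta> c(2) c' unfolding A_def by (metis (no_types, lifting) to_ac_mult to_ac_power power_mult_distrib power_mult mult.commute)
    then have "a1 = c' ^ p * a2 ^ j" by (simp only: to_ac_eq_iff)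
    then have "c' \<noteq> 0 \<and> a1 powi 1 * a2 powi (- int j) = c' ^ p"
      using nz p0 by (auto simp: power_int_minus field_simps power_0_left)
    then show False using ind'[of c' 1 "- int j"] p1 by blast
  qed
  then have \<gamma>_pure: "pure_over p K \<gamma>"
    using pure_overI[OF K, of \<zeta> p 0 \<gamma>] in_k kK \<zeta> p(1) \<gamma> by auto
  define E where "E = adjoin K \<gamma>"
  have E: "is_subfield E" unfolding E_def using K kK by (intro is_subfield_adjoin) (auto simp: k_def)
  have KE: "K \<subseteq> E" and \<gamma>E: "\<gamma> \<in> E" unfolding E_def using K by (auto intro: adjoin_gen dest: adjoin_base)
  obtain y where y: "y ^ p ^ 3 = \<theta>" using nth_root_exists[of "p ^ 3" \<theta>] p0 by auto
  have y0: "y \<noteq> 0" using y \<theta> p0 by (auto simp: power_0_left)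
  have "y ^ p\<^sup>2 \<notin> E"
  proof
    assume "y ^ p\<^sup>2 \<in> E"
    moreover have W: "(y ^ p\<^sup>2) ^ p = \<theta>" using y by (simp add: eval_nat_numeral mult_ac flip: power_mult)
    ultimately obtain c j where c: "c \<in> K" "y ^ p\<^sup>2 = c * \<gamma> ^ j"
      using pure_power_in_base[OF K \<gamma>_pure _ \<zeta> _ \<gamma>0, of "y ^ p\<^sup>2"] E in_k kK \<theta>(1) unfolding E_def by (metis subsetD)
    have c0: "c \<noteq> 0" using c(2) y0 by auto
    have \<theta>c: "\<theta> = c ^ p * A ^ j"
      using W unfolding c(2) power_mult_distrib \<gamma>[symmetric] by (simp add: mult.commute flip: power_mult)
    have "w * c ^ p = \<sigma> c ^ p"
    proof -
      have "\<sigma> \<theta> = \<sigma> c ^ p * A ^ j"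
        using c(1) AK fixA[of 1 j] unfolding \<theta>c
        by (simp add: field_hom_on_mult[OF K \<sigma>(1)] field_hom_on_power[OF K \<sigma>(1)] is_subfield_power[OF K])
      then show ?thesis using \<theta>(3) nz unfolding \<theta>c by simp
    qed
    moreover have "w = (x ^ p\<^sup>2 * A ^ p) ^ p"
      by (simp add: w_def power_mult_distrib eval_nat_numeral mult_ac flip: power_mult)
    moreover have "\<sigma> c \<noteq> 0" using field_hom_on_nonzero[OF K \<sigma>(1) c(1) c0] .
    ultimately have "(\<sigma> c / (c * (x ^ p\<^sup>2 * A ^ p))) ^ p = 1"
      using c0 x0 nz by (simp add: power_divide power_mult_distrib field_simps)
    then obtain m where "\<sigma> c / (c * (x ^ p\<^sup>2 * A ^ p)) = \<zeta> ^ m"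
      using primitive_root_exhaust[OF \<zeta>] by metis
    then have \<sigma>c: "\<sigma> c = \<zeta> ^ m * A ^ p * x ^ p\<^sup>2 * c"
      using c0 x0 nz by (simp add: field_simps)
    have m: "\<zeta> ^ m * A ^ p \<in> k" using in_k k by (intro is_subfield_mult is_subfield_power)
    have step: "(\<sigma> ^^ Suc q) c / (\<sigma> ^^ q) c = \<zeta> ^ m * A ^ p * (\<sigma> ^^ q) x ^ p\<^sup>2" for q
    proof -
      have mK: "\<zeta> ^ m * A ^ p \<in> K" using m kK by auto
      have "(\<sigma> ^^ Suc q) c = (\<sigma> ^^ q) (\<sigma> c)" by (simp add: funpow_swap1)
      also have "\<dots> = \<zeta> ^ m * A ^ p * (\<sigma> ^^ q) x ^ p\<^sup>2 * (\<sigma> ^^ q) c"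
        unfolding \<sigma>c using fixi[OF m] xK c(1)
        by (simp only: field_hom_on_mult[OF K homi] field_hom_on_power[OF K homi] is_subfield_power[OF K]
          is_subfield_mult[OF K] mK)
      finally show ?thesis using field_hom_on_nonzero[OF K homi c(1) c0] by simp
    qed
    have tele: "(\<Prod>q<n. (\<sigma> ^^ Suc q) c / (\<sigma> ^^ q) c) = (\<sigma> ^^ n) c / c" for n
    proof (induction n)
      case (Suc n)
      then show ?case using field_hom_on_nonzero[OF K homi[of n] c(1) c0] by (simp add: field_simps)
    qed (simp add: c0)
    have "1 = (\<Prod>q<p. \<zeta> ^ m * A ^ p * (\<sigma> ^^ q) x ^ p\<^sup>2)"
      using tele[of p] order[OF c(1)] c0 unfolding step by simp
    also have "\<dots> = (\<zeta> ^ m) ^ p * (A ^ p) ^ p * (Z / A) ^ p\<^sup>2"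
      by (simp add: prod.distrib power_mult_distrib Nx flip: prod_power_distrib)
    also have "(\<zeta> ^ m) ^ p = 1" using \<zeta> by (simp add: primitive_root_def flip: power_mult)
    also have "(A ^ p) ^ p = A ^ p\<^sup>2" by (simp add: power2_eq_square power_mult)
    finally have "\<zeta> = 1" using nz by (simp add: power_divide \<zeta>_def)
    then show False using \<zeta> prime_gt_1_nat[OF p(1)] by (auto simp: primitive_root_def dest!: spec[of _ 1])
  qed
  then have y_pure: "pure_over (p ^ 3) E y"
    using pure_overI[OF E, of Z p 2 y] in_k kK KE Z p(1) y \<theta>(1) by (auto simp: eval_nat_numeral)
  define M where "M = adjoin E y"
  have M: "is_subfield M" unfolding M_def using E kK KE by (intro is_subfield_adjoin) (auto simp: k_def)
  have EM: "E \<subseteq> M" and yM: "y \<in> M" unfolding M_def using E by (auto intro: adjoin_gen dest: adjoin_base)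

  have "\<gamma> ^ p = \<sigma> (\<gamma> ^ p)" using \<sigma>(2)[OF in_k(3)] by (simp add: \<gamma>)
  then obtain s1 where s1: "field_hom_on E s1" "\<And>a. a \<in> K \<Longrightarrow> s1 a = \<sigma> a" "s1 \<gamma> = \<gamma>"
    using pure_extend[OF K \<gamma>_pure \<sigma>(1)] unfolding E_def by metis
  have "(x * \<gamma> * y) ^ p ^ 3 = s1 (y ^ p ^ 3)"
  proof -
    have "\<gamma> ^ p ^ 3 = A ^ p\<^sup>2" unfolding \<gamma>[symmetric] by (simp add: eval_nat_numeral mult_ac flip: power_mult)
    then show ?thesis unfolding y s1(2)[OF \<theta>(1)] \<theta>(3) w_def power_mult_distrib by simp
  qed
  then obtain s where s: "field_hom_on M s" "\<And>a. a \<in> E \<Longrightarrow> s a = s1 a" "s y = x * \<gamma> * y"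
    using pure_extend[OF E y_pure s1(1)] unfolding M_def by metis
  have sK: "s a = \<sigma> a" if "a \<in> K" for a using s(2) s1(2) KE that by auto
  have "field_hom_on K (\<lambda>x. x)" by (simp add: field_hom_on_def)
  moreover have "(\<zeta> * \<gamma>) ^ p = \<gamma> ^ p" using \<zeta> by (simp add: power_mult_distrib primitive_root_def)
  ultimately obtain t1 where t1: "field_hom_on E t1" "\<And>a. a \<in> K \<Longrightarrow> t1 a = a" "t1 \<gamma> = \<zeta> * \<gamma>"
    using pure_extend[OF K \<gamma>_pure] unfolding E_def by metis
  have "y ^ p ^ 3 = t1 (y ^ p ^ 3)" by (simp add: y t1(2) \<theta>(1))
  then obtain t where t: "field_hom_on M t" "\<And>a. a \<in> E \<Longrightarrow> t a = t1 a" "t y = y"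
    using pure_extend[OF E y_pure t1(1)] unfolding M_def by metis

  have xi: "(\<sigma> ^^ i) x \<in> K" for i using closed xK by blast
  have sy: "(s ^^ i) y = (\<Prod>q<i. (\<sigma> ^^ q) x) * \<gamma> ^ i * y" for i
  proof (induction i)
    case (Suc i)
    have inK: "(\<Prod>q<i. (\<sigma> ^^ q) x) \<in> K" using xi by (intro is_subfield_prod[OF K])
    have "s (\<gamma> ^ i) = \<gamma> ^ i"
      using field_hom_on_power[OF M s(1), of \<gamma> i] s(2) s1(3) \<gamma>E EM by auto
    moreover have "\<gamma> ^ i \<in> M" using is_subfield_power[OF M] \<gamma>E EM by blast
    moreover have "s (\<Prod>q<i. (\<sigma> ^^ q) x) = (\<Prod>q<i. (\<sigma> ^^ Suc q) x)"
      using sK[OF inK] xi by (simp add: field_hom_on_prod[OF K \<sigma>(1)])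
    moreover have "(\<Prod>q<i. (\<sigma> ^^ q) x) \<in> M" using inK KE EM by auto
    ultimately have "s ((\<Prod>q<i. (\<sigma> ^^ q) x) * \<gamma> ^ i * y) = (\<Prod>q<i. (\<sigma> ^^ Suc q) x) * \<gamma> ^ i * (x * \<gamma> * y)"
      using yM by (simp only: field_hom_on_mult[OF M s(1)] is_subfield_mult[OF M] s(3))
    also have "\<dots> = (\<Prod>q<Suc i. (\<sigma> ^^ q) x) * \<gamma> ^ Suc i * y"
      unfolding prod.lessThan_Suc_shift by simp
    finally show ?case using Suc by simp
  qed simp
  have sk: "s a = a" if "a \<in> k" for a using sK \<sigma>(2) kK that by auto
  have tk: "t a = a" if "a \<in> k" for a using t(2) t1(2) kK KE that by (metis subsetD)
  have "s \<beta> = \<zeta> * \<beta>" "t \<beta> = \<beta>" "s \<gamma> = \<gamma>" "t \<gamma> = \<zeta> * \<gamma>"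
    using sK[OF \<beta>K] \<sigma>(3) t(2)[OF subsetD[OF KE \<beta>K]] t(2)[OF \<gamma>E] t1(2)[OF \<beta>K] t1(3) s(2)[OF \<gamma>E] s1(3)
    by simp_all
  note gens = this[unfolded \<zeta>_def]
  have "\<gamma> ^ p \<in> k" "y ^ p ^ 3 \<in> K" "(s ^^ p) y = Z * y"
    unfolding sy Nx \<gamma> y using nz in_k \<theta> by simp_all
  then interpret T: Phi2_41_tower p Z \<beta> \<gamma> y x s t k K E M
    by (intro Phi2_41_tower.intro p k_def K_def E_def M_def in_k Z \<beta>_pure nz \<gamma>_pure \<gamma>0 y_pure y0 xK
        s(1) t(1) sk tk gens s(3) t(3))
  show ?thesis
    unfolding realizable_as_galois_group_def
    using T.galois T.galois_group_iso by (auto simp: k_def)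
qed

section \<open>Split cyclic algebras and norms\<close>

text \<open>The element \<open>\<Sum> i\<^sub>2\<^sup>r f\<^sub>r(i\<^sub>1)\<close> is handled through the values of the polynomials \<open>f\<^sub>r\<close> at the
  roots \<open>x\<close> of \<open>X\<^sup>p = b\<close>.\<close>

definition cyclic_comp :: "nat \<Rightarrow> (nat \<times> nat \<Rightarrow> 'k::field) \<Rightarrow> nat \<Rightarrow> 'k alg_closure \<Rightarrow> 'k alg_closure" where
  "cyclic_comp p f r x = (\<Sum>s<p. to_ac (f (r, s)) * x ^ s)"

lemma to_ac_if: "to_ac (if P then c else 0) = (if P then to_ac c else 0)"
  by simp

lemma cyclic_comp_mult:
  assumes p: "p > 0" and x: "x ^ p = to_ac b"
  shows "cyclic_comp p (f \<otimes>\<^bsub>cyclic_algebra p a b \<zeta>\<^esub> g) t x =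
    (\<Sum>r<p. \<Sum>u<p. if (r + u) mod p = t then to_ac a ^ ((r + u) div p) *
       cyclic_comp p f r (to_ac \<zeta> ^ u * x) * cyclic_comp p g u x else 0)"
proof -
  let ?I = "{..<p} \<times> {..<p}"
  let ?c = "\<lambda>y y'. to_ac (cyclic_coeff p a b \<zeta> y y' * f y * g y')"
  have "cyclic_comp p (f \<otimes>\<^bsub>cyclic_algebra p a b \<zeta>\<^esub> g) t x =
    (\<Sum>q<p. \<Sum>y\<in>?I. \<Sum>y'\<in>?I. if cyclic_index p y y' = (t, q) then ?c y y' * x ^ q else 0)"
    by (simp add: cyclic_comp_def cyclic_algebra_def to_ac_sum to_ac_if sum_distrib_right
      if_distrib[of "\<lambda>c. c * _"] del: to_ac_mult cong: if_cong)
  also have "\<dots> = (\<Sum>y\<in>?I. \<Sum>y'\<in>?I. \<Sum>q<p. if cyclic_index p y y' = (t, q) then ?c y y' * x ^ q else 0)"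
    by (rule HOL.trans[OF sum.swap], rule sum.cong[OF HOL.refl], rule sum.swap)
  also have "\<dots> = (\<Sum>y\<in>?I. \<Sum>y'\<in>?I. if (fst y + fst y') mod p = t then
      to_ac a ^ ((fst y + fst y') div p) * (to_ac (f y) * (to_ac \<zeta> ^ fst y' * x) ^ snd y) * (to_ac (g y') * x ^ snd y') else 0)"
  proof (intro sum.cong HOL.refl)
    fix y y' assume "y \<in> ?I" "y' \<in> ?I"
    obtain r s u v where [simp]: "y = (r, s)" "y' = (u, v)" by fastforce
    have "to_ac b ^ ((s + v) div p) * x ^ ((s + v) mod p) = x ^ (p * ((s + v) div p) + (s + v) mod p)"
      by (simp only: x[symmetric] power_add power_mult)
    also have "\<dots> = x ^ s * x ^ v" by (simp add: power_add)
    finally have xb: "to_ac b ^ ((s + v) div p) * x ^ ((s + v) mod p) = x ^ s * x ^ v" .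
    have "(\<Sum>q<p. if cyclic_index p y y' = (t, q) then ?c y y' * x ^ q else 0) =
      (\<Sum>q<p. if q = (s + v) mod p then (if (r + u) mod p = t then ?c y y' * x ^ ((s + v) mod p) else 0) else 0)"
      by (intro sum.cong HOL.refl) (auto simp: cyclic_index_def)
    also have "\<dots> = (if (r + u) mod p = t then ?c y y' * x ^ ((s + v) mod p) else 0)"
      using p by (simp add: sum.delta)
    also have "?c y y' * x ^ ((s + v) mod p) = to_ac a ^ ((r + u) div p) * to_ac \<zeta> ^ (s * u) * to_ac (f y) * to_ac (g y') *
        (to_ac b ^ ((s + v) div p) * x ^ ((s + v) mod p))"
      by (simp add: cyclic_coeff_def mult_ac)
    also have "\<dots> = to_ac a ^ ((r + u) div p) * (to_ac (f y) * (to_ac \<zeta> ^ u * x) ^ s) * (to_ac (g y') * x ^ v)"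
      unfolding xb by (simp add: power_mult_distrib mult_ac flip: power_mult)
    finally show "(\<Sum>q<p. if cyclic_index p y y' = (t, q) then ?c y y' * x ^ q else 0) =
      (if (fst y + fst y') mod p = t then
        to_ac a ^ ((fst y + fst y') div p) * (to_ac (f y) * (to_ac \<zeta> ^ fst y' * x) ^ snd y) * (to_ac (g y') * x ^ snd y') else 0)"
      by simp
  qed
  also have "\<dots> = (\<Sum>r<p. \<Sum>s<p. \<Sum>u<p. \<Sum>v<p. if (r + u) mod p = t then
      to_ac a ^ ((r + u) div p) * (to_ac (f (r, s)) * (to_ac \<zeta> ^ u * x) ^ s) * (to_ac (g (u, v)) * x ^ v) else 0)"
    unfolding sum.cartesian_product' fst_conv snd_conv by (rule HOL.refl)
  also have "\<dots> = (\<Sum>r<p. \<Sum>u<p. \<Sum>s<p. \<Sum>v<p. if (r + u) mod p = t then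
      to_ac a ^ ((r + u) div p) * (to_ac (f (r, s)) * (to_ac \<zeta> ^ u * x) ^ s) * (to_ac (g (u, v)) * x ^ v) else 0)"
    by (intro sum.cong HOL.refl sum.swap)
  also have "\<dots> = (\<Sum>r<p. \<Sum>u<p. if (r + u) mod p = t then to_ac a ^ ((r + u) div p) *
       cyclic_comp p f r (to_ac \<zeta> ^ u * x) * cyclic_comp p g u x else 0)"
    by (intro sum.cong HOL.refl) (simp add: cyclic_comp_def sum_distrib_left sum_distrib_right mult_ac)
  finally show ?thesis .
qed

lemma cyclic_comp_nonzero:
  assumes x: "pure_over p (range to_ac) x" and f: "f (r, s) \<noteq> 0" "s < p"
  shows "cyclic_comp p f r x \<noteq> 0"
proof
  assume 0: "cyclic_comp p f r x = 0"
  define P where "P = (\<Sum>s<p. Polynomial.monom (to_ac (f (r, s))) s)"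
  have c: "Polynomial.coeff P i = (if i < p then to_ac (f (r, i)) else 0)" for i
    by (simp add: P_def coeff_sum sum.delta)
  have "poly P x = 0" using 0 by (simp add: P_def cyclic_comp_def poly_sum poly_monom)
  moreover have "poly_over (range to_ac) P" by (auto simp: poly_over_def c)
  moreover have "Polynomial.degree P < p"
    using f(2) by (metis c leading_coeff_0_iff degree_0 not_less_zero neq0_conv less_nat_zero_code)
  ultimately have "P = 0" using x by (simp add: pure_over_def)
  then show False using c[of s] f by simp
qed

definition matrix_elem :: "nat \<Rightarrow> ('k, 'a) module \<Rightarrow> nat \<Rightarrow> nat \<Rightarrow> 'a \<Rightarrow> nat \<times> nat \<Rightarrow> 'a" where
  "matrix_elem n R a b f = (\<lambda>(i, j) \<in> {..<n} \<times> {..<n}. if i = a \<and> j = b then f else \<zero>\<^bsub>R\<^esub>)"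

locale algebra_ring = ring A for A :: "('k, 'a) module" (structure)
begin

lemma matrix_algebra_mult_closed:
  assumes "B \<in> carrier (matrix_algebra n A)" "C \<in> carrier (matrix_algebra n A)"
  shows "B \<otimes>\<^bsub>matrix_algebra n A\<^esub> C \<in> carrier (matrix_algebra n A)"
proof -
  have "(\<Oplus>l\<in>{..<n}. B (i, l) \<otimes> C (l, j)) \<in> carrier A" if "i < n" "j < n" for i j
    using assms that by (intro finsum_closed) (auto simp: matrix_algebra_def)
  then show ?thesis by (auto simp: matrix_algebra_def restrict_PiE_iff)
qed

lemma matrix_elem_closed: "f \<in> carrier A \<Longrightarrow> matrix_elem n A a b f \<in> carrier (matrix_algebra n A)"
  by (auto simp: matrix_algebra_def matrix_elem_def)

lemma matrix_elem_mult:
  assumes "B \<in> carrier (matrix_algebra n A)" "f \<in> carrier A" "a < n" "b < n" "i < n" "j < n"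
  shows "(matrix_elem n A a b f \<otimes>\<^bsub>matrix_algebra n A\<^esub> B) (i, j) = (if i = a then f \<otimes> B (b, j) else \<zero>)"
    and "(B \<otimes>\<^bsub>matrix_algebra n A\<^esub> matrix_elem n A a b f) (i, j) = (if j = b then B (i, a) \<otimes> f else \<zero>)"
proof -
  have B: "B (i, j) \<in> carrier A" if "i < n" "j < n" for i j
    using assms(1) that by (auto simp: matrix_algebra_def)
  have "(matrix_elem n A a b f \<otimes>\<^bsub>matrix_algebra n A\<^esub> B) (i, j) =
    (\<Oplus>l\<in>{..<n}. if b = l then (if i = a then f \<otimes> B (l, j) else \<zero>) else \<zero>)"
    using assms B by (auto simp: matrix_algebra_def matrix_elem_def intro!: finsum_cong')
  also have "\<dots> = (if i = a then f \<otimes> B (b, j) else \<zero>)"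
    using assms B by (intro finsum_singleton) auto
  finally show "(matrix_elem n A a b f \<otimes>\<^bsub>matrix_algebra n A\<^esub> B) (i, j) = (if i = a then f \<otimes> B (b, j) else \<zero>)" .
  have "(B \<otimes>\<^bsub>matrix_algebra n A\<^esub> matrix_elem n A a b f) (i, j) =
    (\<Oplus>l\<in>{..<n}. if a = l then (if j = b then B (i, l) \<otimes> f else \<zero>) else \<zero>)"
    using assms B by (auto simp: matrix_algebra_def matrix_elem_def intro!: finsum_cong')
  also have "\<dots> = (if j = b then B (i, a) \<otimes> f else \<zero>)"
    using assms B by (intro finsum_singleton) auto
  finally show "(B \<otimes>\<^bsub>matrix_algebra n A\<^esub> matrix_elem n A a b f) (i, j) = (if j = b then B (i, a) \<otimes> f else \<zero>)" .
qed

end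

lemma ring_base_algebra: "ring (base_algebra :: ('k::field, 'k) module)"
proof (rule ringI)
  show "abelian_group (base_algebra :: ('k, 'k) module)"
    by (rule abelian_groupI) (auto simp: base_algebra_def add_ac intro: exI[of _ "- x" for x] add.left_inverse)
  show "monoid (base_algebra :: ('k, 'k) module)"
    by (rule monoidI) (auto simp: base_algebra_def)
qed (auto simp: base_algebra_def algebra_simps)

text \<open>A rank one idempotent \<open>\<epsilon>\<close> of \<open>M\<^sub>n(k)\<close> satisfies \<open>\<epsilon> X \<epsilon> \<in> k \<epsilon>\<close>; comparing one nonzero entry of its image
  in \<open>M\<^sub>m(A)\<close> gives an element of \<open>A\<close> with the same property.\<close>

lemma brauer_trivial_imp_rank_one:
  fixes A :: "('k::field, 'a) module"
  assumes A: "ring A" and triv: "brauer_trivial A"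
    and smult: "\<And>c f. f \<in> carrier A \<Longrightarrow> c \<odot>\<^bsub>A\<^esub> f \<in> carrier A" "\<And>f. f \<in> carrier A \<Longrightarrow> 0 \<odot>\<^bsub>A\<^esub> f = \<zero>\<^bsub>A\<^esub>"
  obtains w where "w \<in> carrier A" "w \<noteq> \<zero>\<^bsub>A\<^esub>"
    "\<And>f. f \<in> carrier A \<Longrightarrow> \<exists>c. w \<otimes>\<^bsub>A\<^esub> f \<otimes>\<^bsub>A\<^esub> w = c \<odot>\<^bsub>A\<^esub> w"
proof -
  interpret A: algebra_ring A using A by (rule algebra_ring.intro)
  let ?k = "base_algebra :: ('k, 'k) module"
  interpret K: algebra_ring ?k using ring_base_algebra by (rule algebra_ring.intro)
  obtain m n h where mn: "m > 0" "n > 0" and h: "h \<in> ring_iso (matrix_algebra m A) (matrix_algebra n ?k)"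
    "\<And>c x. x \<in> carrier (matrix_algebra m A) \<Longrightarrow> h (c \<odot>\<^bsub>matrix_algebra m A\<^esub> x) = c \<odot>\<^bsub>matrix_algebra n ?k\<^esub> h x"
    using triv unfolding brauer_trivial_def brauer_equivalent_def algebra_iso_def by blast
  let ?B = "matrix_algebra m A" and ?D = "matrix_algebra n ?k"
  have bij: "bij_betw h (carrier ?B) (carrier ?D)"
    and hmult: "\<And>x y. x \<in> carrier ?B \<Longrightarrow> y \<in> carrier ?B \<Longrightarrow> h (x \<otimes>\<^bsub>?B\<^esub> y) = h x \<otimes>\<^bsub>?D\<^esub> h y"
    using h(1) by (auto simp: ring_iso_def ring_hom_def)
  have hclosed: "h Y \<in> carrier ?D" if "Y \<in> carrier ?B" for Y
    using bij that by (auto simp: bij_betw_def)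
  have Bsmult: "c \<odot>\<^bsub>?B\<^esub> Y \<in> carrier ?B" if "Y \<in> carrier ?B" for c Y
    using that smult(1) by (auto simp: matrix_algebra_def restrict_PiE_iff PiE_iff)
  define E where "E = matrix_elem n ?k 0 0 \<one>\<^bsub>?k\<^esub>"
  have E: "E \<in> carrier ?D" unfolding E_def by (rule K.matrix_elem_closed) simp
  have EYE: "E \<otimes>\<^bsub>?D\<^esub> Y \<otimes>\<^bsub>?D\<^esub> E = Y (0, 0) \<odot>\<^bsub>?D\<^esub> E" if Y: "Y \<in> carrier ?D" for Y
  proof
    fix t :: "nat \<times> nat"
    obtain i j where t: "t = (i, j)" by (cases t)
    have EY: "E \<otimes>\<^bsub>?D\<^esub> Y \<in> carrier ?D" using E Y by (rule K.matrix_algebra_mult_closed)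
    show "(E \<otimes>\<^bsub>?D\<^esub> Y \<otimes>\<^bsub>?D\<^esub> E) t = (Y (0, 0) \<odot>\<^bsub>?D\<^esub> E) t"
    proof (cases "i < n \<and> j < n")
      case True
      then show ?thesis
        using mn K.matrix_elem_mult(2)[OF EY, of "\<one>\<^bsub>?k\<^esub>" 0 0 i j] K.matrix_elem_mult(1)[OF Y, of "\<one>\<^bsub>?k\<^esub>" 0 0 i 0]
        by (auto simp: t E_def[symmetric]) (auto simp: matrix_algebra_def base_algebra_def E_def matrix_elem_def)
    next
      case False
      then show ?thesis by (auto simp: t matrix_algebra_def)
    qed
  qed
  define \<epsilon> where "\<epsilon> = inv_into (carrier ?B) h E"
  have \<epsilon>: "\<epsilon> \<in> carrier ?B" "h \<epsilon> = E"
    using bij E by (auto simp: \<epsilon>_def bij_betw_def inv_into_into f_inv_into_f)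
  have \<epsilon>Y\<epsilon>: "\<exists>c. \<epsilon> \<otimes>\<^bsub>?B\<^esub> Y \<otimes>\<^bsub>?B\<^esub> \<epsilon> = c \<odot>\<^bsub>?B\<^esub> \<epsilon>" if Y: "Y \<in> carrier ?B" for Y
  proof -
    have \<epsilon>Y: "\<epsilon> \<otimes>\<^bsub>?B\<^esub> Y \<in> carrier ?B" using \<epsilon>(1) Y by (rule A.matrix_algebra_mult_closed)
    have "h (\<epsilon> \<otimes>\<^bsub>?B\<^esub> Y \<otimes>\<^bsub>?B\<^esub> \<epsilon>) = h (h Y (0, 0) \<odot>\<^bsub>?B\<^esub> \<epsilon>)"
      using Y \<epsilon> \<epsilon>Y EYE[OF hclosed[OF Y]] by (simp add: hmult h(2))
    then have "\<epsilon> \<otimes>\<^bsub>?B\<^esub> Y \<otimes>\<^bsub>?B\<^esub> \<epsilon> = h Y (0, 0) \<odot>\<^bsub>?B\<^esub> \<epsilon>"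
      using bij A.matrix_algebra_mult_closed[OF \<epsilon>Y \<epsilon>(1)] Bsmult[OF \<epsilon>(1)]
      by (auto simp: bij_betw_def dest: inj_onD)
    then show ?thesis ..
  qed
  have ent: "\<epsilon> (i, j) \<in> carrier A" if "i < m" "j < m" for i j
    using \<epsilon>(1) that by (auto simp: matrix_algebra_def)
  have "\<exists>i<m. \<exists>j<m. \<epsilon> (i, j) \<noteq> \<zero>\<^bsub>A\<^esub>"
  proof (rule ccontr)
    assume *: "\<not> ?thesis"
    have "0 \<odot>\<^bsub>?B\<^esub> \<epsilon> = \<epsilon>"
    proof
      fix t show "(0 \<odot>\<^bsub>?B\<^esub> \<epsilon>) t = \<epsilon> t"
        using * \<epsilon>(1) smult(2) A.zero_closed by (cases t) (auto simp: matrix_algebra_def extensional_def PiE_iff)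
    qed
    then have "E = 0 \<odot>\<^bsub>?D\<^esub> E" using h(2)[OF \<epsilon>(1), of 0] \<epsilon>(2) by simp
    then have "E (0, 0) = (0 \<odot>\<^bsub>?D\<^esub> E) (0, 0)" by metis
    then show False using mn by (simp add: E_def matrix_elem_def matrix_algebra_def base_algebra_def)
  qed
  then obtain i j where ij: "i < m" "j < m" "\<epsilon> (i, j) \<noteq> \<zero>\<^bsub>A\<^esub>" by blast
  show ?thesis
  proof
    show "\<epsilon> (i, j) \<in> carrier A" "\<epsilon> (i, j) \<noteq> \<zero>\<^bsub>A\<^esub>" using ij ent by auto
    fix f assume f: "f \<in> carrier A"
    define Y where "Y = matrix_elem m A j i f"
    have Y: "Y \<in> carrier ?B" unfolding Y_def using f by (rule A.matrix_elem_closed)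
    obtain c where c: "\<epsilon> \<otimes>\<^bsub>?B\<^esub> Y \<otimes>\<^bsub>?B\<^esub> \<epsilon> = c \<odot>\<^bsub>?B\<^esub> \<epsilon>" using \<epsilon>Y\<epsilon>[OF Y] by blast
    have \<epsilon>Y: "(\<epsilon> \<otimes>\<^bsub>?B\<^esub> Y) (i, l) = (if i = l then \<epsilon> (i, j) \<otimes>\<^bsub>A\<^esub> f else \<zero>\<^bsub>A\<^esub>)" if "l < m" for l
      unfolding Y_def using A.matrix_elem_mult(2)[OF \<epsilon>(1) f ij(2,1,1) that] by auto
    have "(\<epsilon> \<otimes>\<^bsub>?B\<^esub> Y \<otimes>\<^bsub>?B\<^esub> \<epsilon>) (i, j) =
      (\<Oplus>\<^bsub>A\<^esub>l\<in>{..<m}. if i = l then \<epsilon> (i, j) \<otimes>\<^bsub>A\<^esub> f \<otimes>\<^bsub>A\<^esub> \<epsilon> (l, j) else \<zero>\<^bsub>A\<^esub>)"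
    proof -
      have "(\<epsilon> \<otimes>\<^bsub>?B\<^esub> Y \<otimes>\<^bsub>?B\<^esub> \<epsilon>) (i, j) = (\<Oplus>\<^bsub>A\<^esub>l\<in>{..<m}. (\<epsilon> \<otimes>\<^bsub>?B\<^esub> Y) (i, l) \<otimes>\<^bsub>A\<^esub> \<epsilon> (l, j))"
        using ij by (simp add: matrix_algebra_def)
      also have "\<dots> = (\<Oplus>\<^bsub>A\<^esub>l\<in>{..<m}. if i = l then \<epsilon> (i, j) \<otimes>\<^bsub>A\<^esub> f \<otimes>\<^bsub>A\<^esub> \<epsilon> (l, j) else \<zero>\<^bsub>A\<^esub>)"
        using \<epsilon>Y ent f ij by (intro A.finsum_cong') auto
      finally show ?thesis .
    qed
    also have "\<dots> = \<epsilon> (i, j) \<otimes>\<^bsub>A\<^esub> f \<otimes>\<^bsub>A\<^esub> \<epsilon> (i, j)"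
      using ent f ij by (intro A.finsum_singleton) auto
    finally have "\<epsilon> (i, j) \<otimes>\<^bsub>A\<^esub> f \<otimes>\<^bsub>A\<^esub> \<epsilon> (i, j) = (c \<odot>\<^bsub>?B\<^esub> \<epsilon>) (i, j)" using c by simp
    also have "\<dots> = c \<odot>\<^bsub>A\<^esub> \<epsilon> (i, j)" using ij by (simp add: matrix_algebra_def)
    finally show "\<exists>c. \<epsilon> (i, j) \<otimes>\<^bsub>A\<^esub> f \<otimes>\<^bsub>A\<^esub> \<epsilon> (i, j) = c \<odot>\<^bsub>A\<^esub> \<epsilon> (i, j)" ..
  qed
qed

lemma primitive_root_sum_quotient:
  assumes \<zeta>: "primitive_root p \<zeta>" and x: "x \<noteq> 0" and "u < p" "q < p"
  shows "(\<Sum>j<p. (\<zeta> ^ u * x) ^ j / (\<zeta> ^ q * x) ^ j) = (if u = q then of_nat p else 0)"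
proof -
  have nz: "\<zeta> \<noteq> 0" using \<zeta> by (rule primitive_root_nonzero)
  have "\<zeta> ^ p = 1" using \<zeta> by (simp add: primitive_root_def)
  then have "\<zeta> ^ u / \<zeta> ^ q = \<zeta> ^ (u + (p - q))"
    using nz \<open>q < p\<close> by (simp add: field_simps power_add[symmetric] del: power_add) (simp add: power_add)
  then have "(\<zeta> ^ u * x) ^ j / (\<zeta> ^ q * x) ^ j = \<zeta> ^ (j * (u + (p - q)))" for j
    using x by (simp add: power_mult_distrib mult.commute[of j] power_mult flip: power_divide)
  then have "(\<Sum>j<p. (\<zeta> ^ u * x) ^ j / (\<zeta> ^ q * x) ^ j) = (if p dvd u + (p - q) then of_nat p else 0)"
    by (simp add: primitive_root_sum[OF \<zeta>])
  also have "p dvd u + (p - q) \<longleftrightarrow> u = q"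
  proof
    assume "p dvd u + (p - q)"
    then obtain c where c: "u + (p - q) = p * c" ..
    have "0 < p * c" "p * c < p * 2" using assms(3,4) c by linarith+
    then have "c = 1" by auto
    then show "u = q" using c assms(4) by simp
  qed (use assms in simp)
  finally show ?thesis .
qed

lemma split_imp_norm_equation:
  fixes a b \<zeta> :: "'k::field"
  assumes p: "Factorial_Ring.prime p" and char: "of_nat p \<noteq> (0 :: 'k)" and \<zeta>: "primitive_root p \<zeta>"
    and a: "a \<noteq> 0" and b: "b \<noteq> 0" "\<And>c. b \<noteq> c ^ p" and \<beta>: "\<beta> ^ p = to_ac b"
    and split: "brauer_trivial (cyclic_algebra p a b \<zeta>)"
  obtains h d where "ac_poly d \<beta> \<noteq> 0"
    "(\<Prod>q<p. ac_poly h (to_ac \<zeta> ^ q * \<beta>)) = to_ac a * (\<Prod>q<p. ac_poly d (to_ac \<zeta> ^ q * \<beta>))"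
proof -
  let ?A = "cyclic_algebra p a b \<zeta>"
  have p1: "p > 1" and p0: "p > 0" using p prime_gt_1_nat prime_gt_0_nat by auto
  have \<zeta>1: "\<zeta> ^ p = 1" using \<zeta> by (simp add: primitive_root_def)
  interpret A: ring ?A using p0 \<zeta>1 by (rule cyclic_algebra_ring)
  define Z where "Z = to_ac \<zeta>"
  have Z: "primitive_root p Z" unfolding Z_def to_ac_primitive_root by (rule \<zeta>)
  have nz: "Z \<noteq> 0" "\<beta> \<noteq> 0" using primitive_root_nonzero[OF Z] \<beta> b p0 by (auto simp: power_0_left)
  have root: "(Z ^ q * \<beta>) ^ p = to_ac b" for q
    using Z \<beta> by (simp add: power_mult_distrib primitive_root_def flip: power_mult)
  have pure: "pure_over p (range to_ac) (Z ^ q * \<beta>)" for q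
    using pure_over_base[OF p \<zeta> b(2) root] .
  have ne: "cyclic_comp p f r (Z ^ q * \<beta>) \<noteq> 0"
    if "cyclic_comp p f r \<beta> \<noteq> 0" for f :: "nat \<times> nat \<Rightarrow> 'k" and r q
  proof -
    have "\<exists>s<p. f (r, s) \<noteq> 0"
    proof (rule ccontr)
      assume "\<not> ?thesis"
      then have "cyclic_comp p f r \<beta> = 0" by (auto simp: cyclic_comp_def intro!: sum.neutral)
      then show False using that by simp
    qed
    then show ?thesis using cyclic_comp_nonzero[OF pure] by blast
  qed
  obtain w where w: "w \<in> carrier ?A" "w \<noteq> \<zero>\<^bsub>?A\<^esub>"
    "\<And>f. f \<in> carrier ?A \<Longrightarrow> \<exists>c. w \<otimes>\<^bsub>?A\<^esub> f \<otimes>\<^bsub>?A\<^esub> w = c \<odot>\<^bsub>?A\<^esub> w"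
    using brauer_trivial_imp_rank_one[OF A.ring_axioms split] by (auto simp: cyclic_algebra_def)
  define W where "W q x = cyclic_comp p w q x" for q x
  obtain r0 where r0: "r0 < p" "W r0 \<beta> \<noteq> 0"
  proof -
    obtain r s where rs: "w (r, s) \<noteq> 0" using w(2) by (auto simp: cyclic_algebra_def fun_eq_iff)
    then have "r < p" "s < p" using w(1) by (auto simp: cyclic_algebra_def)
    then show ?thesis using that[of r] cyclic_comp_nonzero[of p \<beta> w r s] pure[of 0] rs
      by (simp add: W_def)
  qed
  have basis: "cyclic_basis y \<in> carrier ?A" if "y \<in> {..<p} \<times> {..<p}" for y
    using that by (auto simp: cyclic_algebra_def cyclic_basis_def)
  have comp_basis: "cyclic_comp p (cyclic_basis (i, j)) r x = (if r = i then x ^ j else 0)" if "j < p" for i j r x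
  proof -
    have "cyclic_comp p (cyclic_basis (i, j)) r x = (\<Sum>s<p. if s = j then (if r = i then x ^ j else 0) else 0)"
      unfolding cyclic_comp_def by (intro sum.cong HOL.refl) (simp add: cyclic_basis_def)
    then show ?thesis using that by (simp add: sum.delta)
  qed
  note mult = cyclic_comp_mult[OF p0, where \<zeta> = \<zeta>, folded Z_def]
  define u0 where "u0 = (p - r0) mod p"
  have u0: "u0 < p" using p0 by (simp add: u0_def)
  have u0_iff: "(r + u0) mod p = 0 \<longleftrightarrow> r = r0" if "r < p" for r
  proof (cases "r0 = 0")
    case True
    then show ?thesis using that by (simp add: u0_def)
  next
    case False
    then have u: "u0 = p - r0" using r0 by (simp add: u0_def)
    have "(r + u0) mod p = 0 \<longleftrightarrow> p dvd r + (p - r0)" unfolding u by auto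
    also have "\<dots> \<longleftrightarrow> r = r0"
    proof
      assume "p dvd r + (p - r0)"
      then obtain c where c: "r + (p - r0) = p * c" ..
      have "0 < p * c" "p * c < p * 2" using that r0 False c by linarith+
      then have "c = 1" by auto
      then show "r = r0" using c r0 by simp
    qed (use r0 in simp)
    finally show ?thesis .
  qed
  define c d e where "c = (cyclic_basis (u0, 0) :: nat \<times> nat \<Rightarrow> 'k)" and "d = w \<otimes>\<^bsub>?A\<^esub> c"
    and "e = cyclic_basis (1, 0) \<otimes>\<^bsub>?A\<^esub> w"
  have c: "c \<in> carrier ?A" unfolding c_def using u0 p0 by (intro basis) auto
  have d: "d \<in> carrier ?A" unfolding d_def using w(1) c by simp
  have e: "e \<in> carrier ?A" unfolding e_def using w(1) basis[of "(1, 0)"] p1 by simp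
  have d0: "cyclic_comp p d 0 x = to_ac a ^ ((r0 + u0) div p) * W r0 (Z ^ u0 * x)" if x: "x ^ p = to_ac b" for x
  proof -
    have "cyclic_comp p d 0 x = (\<Sum>r<p. \<Sum>u<p. if u = u0 then
        (if r = r0 then to_ac a ^ ((r0 + u0) div p) * W r0 (Z ^ u0 * x) else 0) else 0)"
      unfolding d_def mult[OF x]
      by (intro sum.cong HOL.refl) (use u0_iff p0 in \<open>auto simp: c_def comp_basis W_def\<close>)
    then show ?thesis using u0 r0 by (simp add: sum.delta)
  qed
  have ecomp: "cyclic_comp p e q x = (if q = 0 then to_ac a * W (p - 1) x else W (q - 1) x)"
    if x: "x ^ p = to_ac b" and q: "q < p" for x q
  proof -
    have iff: "(1 + u) mod p = q \<longleftrightarrow> u = (if q = 0 then p - 1 else q - 1)" if "u < p" for u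
      using that q p1 by (cases "Suc u = p") auto
    have "cyclic_comp p e q x = (\<Sum>r<p. \<Sum>u<p. if r = 1 then (if u = (if q = 0 then p - 1 else q - 1) then
        to_ac a ^ ((1 + u) div p) * W u x else 0) else 0)"
      unfolding e_def mult[OF x]
      by (intro sum.cong HOL.refl) (use iff p0 in \<open>auto simp: comp_basis W_def\<close>)
    also have "\<dots> = (\<Sum>r<p. if r = 1 then (\<Sum>u<p. if u = (if q = 0 then p - 1 else q - 1) then
        to_ac a ^ ((1 + u) div p) * W u x else 0) else 0)" by (intro sum.cong HOL.refl) auto
    also have "\<dots> = (if q = 0 then to_ac a * W (p - 1) x else W (q - 1) x)"
      using p1 q by (auto simp: sum.delta)
    finally show ?thesis .
  qed
  have dX: "cyclic_comp p (d \<otimes>\<^bsub>?A\<^esub> cyclic_basis (0, j)) r x = cyclic_comp p d r x * x ^ j"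
    if x: "x ^ p = to_ac b" and "j < p" "r < p" for j r x
  proof -
    have "cyclic_comp p (d \<otimes>\<^bsub>?A\<^esub> cyclic_basis (0, j)) r x =
      (\<Sum>r'<p. \<Sum>u<p. if u = 0 then (if r' = r then cyclic_comp p d r x * x ^ j else 0) else 0)"
      unfolding mult[OF x] using that by (intro sum.cong HOL.refl) (auto simp: comp_basis)
    then show ?thesis using that p0 by (simp add: sum.delta)
  qed
  have "\<exists>\<mu>. d \<otimes>\<^bsub>?A\<^esub> cyclic_basis (0, j) \<otimes>\<^bsub>?A\<^esub> e = \<mu> \<odot>\<^bsub>?A\<^esub> w" if "j < p" for j
  proof -
    have X: "cyclic_basis (0, j) \<in> carrier ?A" "cyclic_basis (1, 0) \<in> carrier ?A"
      using basis that p1 by auto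
    then have "d \<otimes>\<^bsub>?A\<^esub> cyclic_basis (0, j) \<otimes>\<^bsub>?A\<^esub> e =
      w \<otimes>\<^bsub>?A\<^esub> (c \<otimes>\<^bsub>?A\<^esub> cyclic_basis (0, j) \<otimes>\<^bsub>?A\<^esub> cyclic_basis (1, 0)) \<otimes>\<^bsub>?A\<^esub> w"
      using w(1) c by (simp add: d_def e_def A.m_assoc)
    then show ?thesis using w(3)[of "c \<otimes>\<^bsub>?A\<^esub> cyclic_basis (0, j) \<otimes>\<^bsub>?A\<^esub> cyclic_basis (1, 0)"] X c by simp
  qed
  then obtain \<mu> where \<mu>: "\<And>j. j < p \<Longrightarrow> d \<otimes>\<^bsub>?A\<^esub> cyclic_basis (0, j) \<otimes>\<^bsub>?A\<^esub> e = \<mu> j \<odot>\<^bsub>?A\<^esub> w"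
    by metis
  define H where "H x = (\<Sum>j<p. to_ac (\<mu> j) / x ^ j)" for x
  have key: "of_nat p * cyclic_comp p d 0 (Z ^ q * x) * cyclic_comp p e q x = H (Z ^ q * x) * W q x"
    if x: "x ^ p = to_ac b" "x \<noteq> 0" and q: "q < p" for x q
  proof -
    let ?d = "\<lambda>r u. cyclic_comp p d r (Z ^ u * x)" and ?e = "\<lambda>u. cyclic_comp p e u x"
    have rt: "(Z ^ u * x) ^ p = to_ac b" for u
      using Z x by (simp add: power_mult_distrib primitive_root_def flip: power_mult)
    have m: "to_ac (\<mu> j) * W q x = (\<Sum>r<p. \<Sum>u<p. if (r + u) mod p = q then
        to_ac a ^ ((r + u) div p) * (?d r u * (Z ^ u * x) ^ j) * ?e u else 0)" if "j < p" for j
    proof -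
      have "to_ac (\<mu> j) * W q x = cyclic_comp p (d \<otimes>\<^bsub>?A\<^esub> cyclic_basis (0, j) \<otimes>\<^bsub>?A\<^esub> e) q x"
        unfolding \<mu>[OF that] by (simp add: W_def cyclic_comp_def cyclic_algebra_def sum_distrib_left mult.assoc)
      also have "\<dots> = (\<Sum>r<p. \<Sum>u<p. if (r + u) mod p = q then
        to_ac a ^ ((r + u) div p) * (?d r u * (Z ^ u * x) ^ j) * ?e u else 0)"
        unfolding mult[OF x(1)] by (intro sum.cong HOL.refl) (simp add: dX[OF rt that])
      finally show ?thesis .
    qed
    have "H (Z ^ q * x) * W q x = (\<Sum>j<p. to_ac (\<mu> j) * W q x / (Z ^ q * x) ^ j)"
      by (simp add: H_def sum_distrib_right)
    also have "\<dots> = (\<Sum>j<p. \<Sum>r<p. \<Sum>u<p. if (r + u) mod p = q then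
        to_ac a ^ ((r + u) div p) * ?d r u * ?e u * ((Z ^ u * x) ^ j / (Z ^ q * x) ^ j) else 0)"
      by (intro sum.cong HOL.refl) (auto simp: m sum_divide_distrib mult_ac intro!: sum.cong)
    also have "\<dots> = (\<Sum>r<p. \<Sum>u<p. \<Sum>j<p. if (r + u) mod p = q then
        to_ac a ^ ((r + u) div p) * ?d r u * ?e u * ((Z ^ u * x) ^ j / (Z ^ q * x) ^ j) else 0)"
      by (rule HOL.trans[OF sum.swap], rule sum.cong[OF HOL.refl], rule sum.swap)
    also have "\<dots> = (\<Sum>r<p. \<Sum>u<p. if (r + u) mod p = q then
        to_ac a ^ ((r + u) div p) * ?d r u * ?e u * (\<Sum>j<p. (Z ^ u * x) ^ j / (Z ^ q * x) ^ j) else 0)"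
      by (intro sum.cong HOL.refl) (simp add: sum_distrib_left)
    also have "\<dots> = (\<Sum>r<p. \<Sum>u<p. if u = q then (if r = 0 then of_nat p * ?d 0 q * ?e q else 0) else 0)"
    proof (intro sum.cong HOL.refl)
      fix r u assume ru: "r \<in> {..<p}" "u \<in> {..<p}"
      have "r = 0" if "(r + q) mod p = q"
      proof (rule ccontr)
        assume "r \<noteq> 0"
        have "(r + q) mod p = (if r + q < p then r + q else r + q - p)"
          using ru q by (auto simp: le_mod_geq)
        then show False using that ru \<open>r \<noteq> 0\<close> by (auto split: if_splits)
      qed
      then show "(if (r + u) mod p = q then
        to_ac a ^ ((r + u) div p) * ?d r u * ?e u * (\<Sum>j<p. (Z ^ u * x) ^ j / (Z ^ q * x) ^ j) else 0) =
        (if u = q then (if r = 0 then of_nat p * ?d 0 q * ?e q else 0) else 0)"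
        using ru q primitive_root_sum_quotient[OF Z x(2), of u q] by auto
    qed
    also have "\<dots> = of_nat p * ?d 0 q * ?e q" using q p0 by (simp add: sum.delta)
    finally show ?thesis ..
  qed
  define Hp where "Hp = (\<Sum>j<p. Polynomial.monom (\<mu> j / b) (p - j))"
  define Dp where "Dp = (\<Sum>s<p. Polynomial.monom (of_nat p * d (0, s)) s)"
  have hom_sum: "map_poly to_ac (\<Sum>j<p. Polynomial.monom (f j) (g j)) = (\<Sum>j<p. Polynomial.monom (to_ac (f j)) (g j))"
    for f :: "nat \<Rightarrow> 'k" and g
    by (rule poly_eqI) (simp add: coeff_map_poly coeff_sum to_ac_sum to_ac_if)
  have Hp: "ac_poly Hp x = H x" if x: "x ^ p = to_ac b" "x \<noteq> 0" for x
  proof -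
    have "to_ac (\<mu> j / b) * x ^ (p - j) = to_ac (\<mu> j) / x ^ j" if "j < p" for j
    proof -
      have "x ^ (p - j) * x ^ j = to_ac b" using that x by (simp flip: power_add)
      then show ?thesis using x b by (simp add: field_simps)
    qed
    then show ?thesis by (simp add: Hp_def hom_sum poly_sum poly_monom H_def)
  qed
  have Dp: "ac_poly Dp x = of_nat p * cyclic_comp p d 0 x" for x
    by (simp add: Dp_def hom_sum poly_sum poly_monom cyclic_comp_def sum_distrib_left mult.assoc)
  define D V G where "D q = ac_poly Dp (Z ^ q * \<beta>)" and "V q = W q \<beta>" and "G q = ac_poly Hp (Z ^ q * \<beta>)" for q
  have "of_nat p \<noteq> (0 :: 'k alg_closure)" using char by (metis to_ac_of_nat to_ac_eq_0_iff)
  then have D0: "D q \<noteq> 0" for q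
    using ne[of w r0 "u0 + q"] r0(2) a by (simp add: D_def Dp d0[OF root] W_def power_add mult.assoc)
  have step: "D q * cyclic_comp p e q \<beta> = G q * V q" if "q < p" for q
    using key[OF \<beta> nz(2) that] Hp[OF root] nz by (simp add: D_def G_def V_def Dp)
  have stepS: "D (Suc i) * V i = G (Suc i) * V (Suc i)" if "Suc i < p" for i
    using step[OF that] ecomp[OF \<beta> that] by (simp add: V_def)
  have step0: "D 0 * (to_ac a * V (p - 1)) = G 0 * V 0"
    using step[OF p0] ecomp[OF \<beta> p0] by (simp add: V_def)
  have V: "V (p - 1) \<noteq> 0"
  proof
    assume 0: "V (p - 1) = 0"
    have "V r0 = 0" if "r0 \<le> p - 1"
      using that
    proof (induction rule: inc_induct)
      case (step n)
      then show ?case using stepS[of n] D0[of "Suc n"] by simp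
    qed (rule 0)
    moreover have "r0 \<le> p - 1" using r0(1) by simp
    ultimately show False using r0(2) by (simp add: V_def)
  qed
  have tele: "(\<Prod>i<n. D (Suc i)) * V 0 = (\<Prod>i<n. G (Suc i)) * V n" if "n < p" for n
    using that
  proof (induction n)
    case (Suc n)
    have "(\<Prod>i<Suc n. D (Suc i)) * V 0 = D (Suc n) * ((\<Prod>i<n. D (Suc i)) * V 0)" by (simp add: mult_ac)
    also have "\<dots> = (\<Prod>i<n. G (Suc i)) * (D (Suc n) * V n)" using Suc by (simp add: mult_ac)
    also have "\<dots> = (\<Prod>i<Suc n. G (Suc i)) * V (Suc n)" unfolding stepS[OF Suc.prems] by simp
    finally show ?case .
  qed simp
  have split_prod: "(\<Prod>q<p. f q) = f 0 * (\<Prod>i<p - 1. f (Suc i))" for f :: "nat \<Rightarrow> 'k alg_closure"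
    using prod.lessThan_Suc_shift[of f "p - 1"] p0 by simp
  have "(\<Prod>q<p. G q) * V (p - 1) = G 0 * ((\<Prod>i<p - 1. G (Suc i)) * V (p - 1))"
    by (simp add: split_prod mult.assoc)
  also have "\<dots> = G 0 * V 0 * (\<Prod>i<p - 1. D (Suc i))" using tele[of "p - 1"] p0 by (simp add: mult.commute)
  also have "\<dots> = to_ac a * (\<Prod>q<p. D q) * V (p - 1)"
    unfolding step0[symmetric] split_prod by (simp add: mult_ac)
  finally have "(\<Prod>q<p. G q) = to_ac a * (\<Prod>q<p. D q)" using V by simp
  then show ?thesis using that[of Dp Hp] D0[of 0] by (simp add: D_def G_def Z_def)
qed

lemma bij_betw_roots:
  assumes \<omega>: "primitive_root n \<omega>" and x: "x \<noteq> 0"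
  shows "bij_betw (\<lambda>i. \<omega> ^ i * x) {..<n} {y. y ^ n = (x :: 'a::field) ^ n}"
proof (rule bij_betw_imageI)
  show "inj_on (\<lambda>i. \<omega> ^ i * x) {..<n}"
    using x by (auto intro!: inj_onI primitive_root_eq_iff[OF \<omega>])
  show "(\<lambda>i. \<omega> ^ i * x) ` {..<n} = {y. y ^ n = x ^ n}"
  proof (intro equalityI subsetI)
    fix y assume "y \<in> {y. y ^ n = x ^ n}"
    then have "(y / x) ^ n = 1" using x by (simp add: power_divide)
    then obtain i where "i < n" "y / x = \<omega> ^ i" using primitive_root_exhaust[OF \<omega>] by metis
    then show "y \<in> (\<lambda>i. \<omega> ^ i * x) ` {..<n}" using x by (intro image_eqI[of _ _ i]) (auto simp: field_simps)
  qed (use \<omega> in \<open>auto simp: power_mult_distrib primitive_root_def simp flip: power_mult\<close>)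
qed

lemma finsum_base_algebra:
  assumes "finite I"
  shows "(\<Oplus>\<^bsub>base_algebra\<^esub>i\<in>I. f i) = (\<Sum>i\<in>I. f i :: 'k::field)"
  using assms
proof induction
  interpret K: ring "base_algebra :: ('k, 'k) module" by (rule ring_base_algebra)
  {
    case empty
    have "(\<Oplus>\<^bsub>base_algebra\<^esub>i\<in>{}. f i) = \<zero>\<^bsub>base_algebra\<^esub>" by (rule K.finsum_empty)
    then show ?case by (simp add: base_algebra_def)
  next
    case (insert i I)
    then have "(\<Oplus>\<^bsub>base_algebra\<^esub>i\<in>insert i I. f i) = f i \<oplus>\<^bsub>base_algebra\<^esub> (\<Oplus>\<^bsub>base_algebra\<^esub>i\<in>I. f i)"
      by (intro K.finsum_insert) (auto simp: base_algebra_def)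
    then show ?case using insert by (simp add: base_algebra_def)
  }
qed

text \<open>If \<open>a\<close> is the norm of \<open>\<xi> = \<Sum> c\<^sub>i \<beta>\<^sup>i\<close>, then \<open>i\<^sub>1\<close> and \<open>i\<^sub>2\<close> act on \<open>k(\<beta>)\<close> as multiplication by \<open>\<beta>\<close> and as
  \<open>v \<mapsto> \<xi> \<sigma>\<^sup>-\<^sup>1(v)\<close>. Elements of \<open>k(\<beta>)\<close> are treated as functions on the roots of \<open>X\<^sup>p = b\<close>.\<close>

locale cyclic_norm =
  fixes p :: nat and a b \<zeta> :: "'k::field" and \<beta> :: "'k alg_closure" and c :: "nat \<Rightarrow> 'k"
  assumes p: "Factorial_Ring.prime p" and char: "of_nat p \<noteq> (0 :: 'k)" and \<zeta>: "primitive_root p \<zeta>"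
    and a: "a \<noteq> 0" and b: "b \<noteq> 0" "\<And>c. b \<noteq> c ^ p" and \<beta>: "\<beta> ^ p = to_ac b"
    and norm: "(\<Prod>q<p. \<Sum>i<p. to_ac (c i) * (to_ac \<zeta> ^ q * \<beta>) ^ i) = to_ac a"
begin

abbreviation "A \<equiv> cyclic_algebra p a b \<zeta>"
abbreviation "kk \<equiv> base_algebra :: ('k, 'k) module"
abbreviation "MM \<equiv> matrix_algebra p kk"
definition "rt x \<longleftrightarrow> x ^ p = to_ac b"
definition "\<omega> = to_ac (inverse \<zeta>)"
definition "\<xi> x = (\<Sum>i<p. to_ac (c i) * x ^ i)"
definition "\<Xi> n x = (\<Prod>i<n. \<xi> (\<omega> ^ i * x))"
definition "act f j x = (\<Sum>r<p. \<Xi> r x * cyclic_comp p f r (\<omega> ^ r * x) * (\<omega> ^ r * x) ^ j)"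

lemma p0: "p > 0" and p1: "p > 1" using p prime_gt_1_nat prime_gt_0_nat by auto

lemma \<zeta>1: "\<zeta> ^ p = 1" using \<zeta> by (simp add: primitive_root_def)

sublocale A: algebra_ring A
  using cyclic_algebra_ring[OF p0 \<zeta>1] by (rule algebra_ring.intro)

lemma Z: "primitive_root p (to_ac \<zeta>)" by (simp add: to_ac_primitive_root \<zeta>)

lemma \<omega>: "primitive_root p \<omega>"
proof -
  have "primitive_root p (inverse \<zeta>)" using \<zeta> by (simp add: primitive_root_def power_inverse)
  then show ?thesis unfolding \<omega>_def to_ac_primitive_root .
qed

lemma Z\<omega>: "to_ac \<zeta> * \<omega> = 1" "to_ac \<zeta> \<noteq> 0" "\<omega> \<noteq> 0"
  using primitive_root_nonzero[OF Z] primitive_root_nonzero[OF \<omega>] by (auto simp: \<omega>_def)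

lemma rt: "rt \<beta>" "rt x \<Longrightarrow> rt (\<omega> ^ i * x)" "rt x \<Longrightarrow> rt (to_ac \<zeta> ^ i * x)" "rt x \<Longrightarrow> x \<noteq> 0"
  using \<beta> \<omega> Z b(1) p0
  by (auto simp: rt_def power_mult_distrib primitive_root_def power_0_left simp flip: power_mult)

lemma \<Xi>_add: "\<Xi> (m + n) x = \<Xi> m x * \<Xi> n (\<omega> ^ m * x)"
  by (induction n) (simp_all add: \<Xi>_def power_add mult_ac)

lemma \<Xi>_p: assumes "rt x" shows "\<Xi> p x = to_ac a"
proof -
  have x: "x ^ p = \<beta> ^ p" using assms \<beta> by (simp add: rt_def)
  have "\<Xi> p x = (\<Prod>y\<in>{y. y ^ p = x ^ p}. \<xi> y)"
    unfolding \<Xi>_def using prod.reindex_bij_betw[OF bij_betw_roots[OF \<omega> rt(4)[OF assms]], of \<xi>] .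
  also have "\<dots> = (\<Prod>q<p. \<xi> (to_ac \<zeta> ^ q * \<beta>))"
    unfolding x using prod.reindex_bij_betw[OF bij_betw_roots[OF Z rt(4)[OF rt(1)]], of \<xi>] by simp
  also have "\<dots> = to_ac a" unfolding \<xi>_def by (rule norm)
  finally show ?thesis .
qed

lemma \<omega>_mod: "\<omega> ^ (n mod p) = \<omega> ^ n" using power_mod_root[of \<omega> p n] \<omega> by (simp add: primitive_root_def)

lemma \<Xi>_mod: assumes x: "rt x" shows "\<Xi> n x = \<Xi> (n mod p) x * to_ac a ^ (n div p)"
proof -
  have *: "\<Xi> (m + p * k) x = \<Xi> m x * to_ac a ^ k" for m k
  proof (induction k)
    case (Suc k)
    have "\<Xi> (m + p * Suc k) x = \<Xi> ((m + p * k) + p) x" by (simp add: algebra_simps)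
    also have "\<dots> = \<Xi> m x * to_ac a ^ k * to_ac a" unfolding \<Xi>_add[of "m + p * k"] Suc using \<Xi>_p rt(2)[OF x] by simp
    finally show ?case by simp
  qed simp
  show ?thesis using *[of "n mod p" "n div p"] by simp
qed

lemma \<Xi>_nonzero: assumes "rt x" "n < p" shows "\<Xi> n x \<noteq> 0"
proof -
  have "\<Xi> n x * \<Xi> (p - n) (\<omega> ^ n * x) = to_ac a"
    using \<Xi>_add[of n "p - n" x] \<Xi>_p[OF assms(1)] assms(2) by simp
  then show ?thesis using a by auto
qed

definition "regular \<phi> \<longleftrightarrow> (\<exists>e. \<forall>x. rt x \<longrightarrow> \<phi> x = (\<Sum>i<p. to_ac (e i :: 'k) * x ^ i))"

lemma regular_cong: "(\<And>x. rt x \<Longrightarrow> \<phi> x = \<psi> x) \<Longrightarrow> regular \<phi> \<longleftrightarrow> regular \<psi>"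
  unfolding regular_def by metis

lemma regular_const: "regular (\<lambda>x. to_ac e)"
  unfolding regular_def
proof (intro exI allI impI)
  fix x
  have "(\<Sum>i<p. to_ac (if i = 0 then e else 0) * x ^ i) = (\<Sum>i<p. if i = 0 then to_ac e else 0)"
    by (intro sum.cong) auto
  then show "to_ac e = (\<Sum>i<p. to_ac (if i = 0 then e else 0) * x ^ i)" using p0 by (simp add: sum.delta)
qed

lemma regular_add: "regular \<phi> \<Longrightarrow> regular \<psi> \<Longrightarrow> regular (\<lambda>x. \<phi> x + \<psi> x)"
  unfolding regular_def
proof (elim exE)
  fix e e' assume *: "\<forall>x. rt x \<longrightarrow> \<phi> x = (\<Sum>i<p. to_ac (e i) * x ^ i)" "\<forall>x. rt x \<longrightarrow> \<psi> x = (\<Sum>i<p. to_ac (e' i) * x ^ i)"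
  show "\<exists>e. \<forall>x. rt x \<longrightarrow> \<phi> x + \<psi> x = (\<Sum>i<p. to_ac (e i) * x ^ i)"
    using * by (intro exI[of _ "\<lambda>i. e i + e' i"]) (simp add: distrib_right sum.distrib)
qed

lemma regular_scale: "regular \<phi> \<Longrightarrow> regular (\<lambda>x. to_ac r * \<phi> x)"
  unfolding regular_def
proof (elim exE)
  fix e assume *: "\<forall>x. rt x \<longrightarrow> \<phi> x = (\<Sum>i<p. to_ac (e i) * x ^ i)"
  show "\<exists>e. \<forall>x. rt x \<longrightarrow> to_ac r * \<phi> x = (\<Sum>i<p. to_ac (e i) * x ^ i)"
    using * by (intro exI[of _ "\<lambda>i. r * e i"]) (simp add: sum_distrib_left mult.assoc)
qed

lemma regular_shift: "regular \<phi> \<Longrightarrow> regular (\<lambda>x. x * \<phi> x)"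
  unfolding regular_def
proof (elim exE)
  fix e assume *: "\<forall>x. rt x \<longrightarrow> \<phi> x = (\<Sum>i<p. to_ac (e i) * x ^ i)"
  obtain n where n: "p = Suc n" using p0 gr0_implies_Suc by blast
  define e' where "e' i = (case i of 0 \<Rightarrow> b * e n | Suc j \<Rightarrow> e j)" for i
  show "\<exists>e. \<forall>x. rt x \<longrightarrow> x * \<phi> x = (\<Sum>i<p. to_ac (e i) * x ^ i)"
  proof (intro exI[of _ e'] allI impI)
    fix x assume x: "rt x"
    have "x * \<phi> x = (\<Sum>i<n. to_ac (e i) * x ^ Suc i) + to_ac (e n) * x ^ p"
      using * x by (simp add: n distrib_left sum_distrib_left mult_ac)
    also have "\<dots> = (\<Sum>i<Suc n. to_ac (e' i) * x ^ i)"
      unfolding sum.lessThan_Suc_shift using x by (simp add: e'_def rt_def)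
    finally show "x * \<phi> x = (\<Sum>i<p. to_ac (e' i) * x ^ i)" by (simp add: n)
  qed
qed

lemma regular_sum: "(\<And>i. i \<in> I \<Longrightarrow> regular (\<phi> i)) \<Longrightarrow> regular (\<lambda>x. \<Sum>i\<in>I. \<phi> i x)"
  using regular_const[of 0] by (induction I rule: infinite_finite_induct) (auto intro: regular_add)

lemma regular_mult:
  assumes "regular \<phi>" "regular \<psi>" shows "regular (\<lambda>x. \<phi> x * \<psi> x)"
proof -
  obtain e where e: "\<And>x. rt x \<Longrightarrow> \<phi> x = (\<Sum>i<p. to_ac (e i) * x ^ i)"
    using assms(1) unfolding regular_def by blast
  have "regular (\<lambda>x. x ^ i * \<psi> x)" for i
    by (induction i) (auto simp: assms(2) mult.assoc dest: regular_shift)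
  then have "regular (\<lambda>x. \<Sum>i<p. to_ac (e i) * (x ^ i * \<psi> x))"
    by (intro regular_sum regular_scale)
  then show ?thesis
    by (rule regular_cong[THEN iffD1, rotated]) (simp add: e sum_distrib_right mult.assoc)
qed

lemma regular_prod: "(\<And>i. i \<in> I \<Longrightarrow> regular (\<phi> i)) \<Longrightarrow> regular (\<lambda>x. \<Prod>i\<in>I. \<phi> i x)"
  using regular_const[of 1] by (induction I rule: infinite_finite_induct) (auto intro: regular_mult)

lemma regular_power: "regular \<phi> \<Longrightarrow> regular (\<lambda>x. \<phi> x ^ n)"
  using regular_const[of 1] by (induction n) (auto intro: regular_mult)

lemma regular_id: "regular (\<lambda>x. x)"
  using regular_shift[OF regular_const[of 1]] by simp

lemma regular_polynomial: "regular (\<lambda>x. \<Sum>i<n. to_ac (e i) * x ^ i)"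
  by (intro regular_sum regular_scale regular_power regular_id)

lemma regular_compose: "regular \<phi> \<Longrightarrow> r ^ p = 1 \<Longrightarrow> regular (\<lambda>x. \<phi> (to_ac r * x))"
  unfolding regular_def
proof (elim exE)
  fix e assume *: "\<forall>x. rt x \<longrightarrow> \<phi> x = (\<Sum>i<p. to_ac (e i) * x ^ i)" and r: "r ^ p = 1"
  have "rt (to_ac r * x)" if "rt x" for x
    using that r by (simp add: rt_def power_mult_distrib flip: to_ac_power)
  then show "\<exists>e. \<forall>x. rt x \<longrightarrow> \<phi> (to_ac r * x) = (\<Sum>i<p. to_ac (e i) * x ^ i)"
    using * by (intro exI[of _ "\<lambda>i. e i * r ^ i"]) (simp add: power_mult_distrib mult.assoc)
qed

lemma regular_rotate:
  assumes "regular \<phi>" shows "regular (\<lambda>x. \<phi> (\<omega> ^ i * x))" "regular (\<lambda>x. \<phi> (to_ac \<zeta> ^ i * x))"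
proof -
  have "(inverse \<zeta> ^ i) ^ p = 1" "(\<zeta> ^ i) ^ p = 1"
    using \<zeta> by (simp_all add: primitive_root_def power_inverse flip: power_mult)
  then show "regular (\<lambda>x. \<phi> (\<omega> ^ i * x))" "regular (\<lambda>x. \<phi> (to_ac \<zeta> ^ i * x))"
    using regular_compose[OF assms, of "inverse \<zeta> ^ i"] regular_compose[OF assms, of "\<zeta> ^ i"]
    by (simp_all add: \<omega>_def)
qed

lemma regular_\<Xi>: "regular (\<Xi> n)"
  unfolding \<Xi>_def \<xi>_def by (intro regular_prod regular_rotate regular_polynomial)

lemma regular_component: "regular (cyclic_comp p f r)"
  unfolding cyclic_comp_def by (rule regular_polynomial)

lemma regular_act: "regular (act f j)"
  unfolding act_def
  by (intro regular_sum regular_mult regular_\<Xi> regular_rotate(1)[OF regular_component]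
    regular_power regular_rotate(1)[OF regular_id])

lemma root_coeffs_unique:
  assumes "(\<Sum>i<p. to_ac (e i) * \<beta> ^ i) = (\<Sum>i<p. to_ac (e' i) * \<beta> ^ i)" "i < p"
  shows "e i = (e' i :: 'k)"
proof (rule ccontr)
  assume "e i \<noteq> e' i"
  moreover have "pure_over p (range to_ac) \<beta>"
    using pure_over_base[OF p \<zeta> b(2) \<beta>] .
  ultimately have "cyclic_comp p (\<lambda>(r, s). e s - e' s) 0 \<beta> \<noteq> 0"
    using assms(2) by (intro cyclic_comp_nonzero[of p \<beta> _ 0 i]) auto
  then show False
    using assms(1) by (simp add: cyclic_comp_def left_diff_distrib sum_subtractf)
qed

definition "root_coeffs \<phi> = (SOME e. \<forall>x. rt x \<longrightarrow> \<phi> x = (\<Sum>i<p. to_ac (e i :: 'k) * x ^ i))"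

lemma root_coeffs: "regular \<phi> \<Longrightarrow> rt x \<Longrightarrow> (\<Sum>i<p. to_ac (root_coeffs \<phi> i) * x ^ i) = \<phi> x"
  using someI_ex[of "\<lambda>e. \<forall>x. rt x \<longrightarrow> \<phi> x = (\<Sum>i<p. to_ac (e i :: 'k) * x ^ i)"]
  unfolding regular_def root_coeffs_def[symmetric] by simp

definition "mat f = (\<lambda>(i, j) \<in> {..<p} \<times> {..<p}. root_coeffs (act f j) i)"

lemma mat: "rt x \<Longrightarrow> j < p \<Longrightarrow> (\<Sum>i<p. to_ac (mat f (i, j)) * x ^ i) = act f j x"
  using root_coeffs[OF regular_act] by (simp add: mat_def)

lemma mat_closed: "mat f \<in> carrier (MM)"
  by (auto simp: mat_def matrix_algebra_def base_algebra_def)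

lemma mat_eqI:
  assumes "B \<in> carrier (MM)"
    and "\<And>j. j < p \<Longrightarrow> (\<Sum>i<p. to_ac (B (i, j)) * \<beta> ^ i) = act f j \<beta>"
  shows "mat f = B"
proof (rule extensionalityI)
  show "mat f \<in> extensional ({..<p} \<times> {..<p})" "B \<in> extensional ({..<p} \<times> {..<p})"
    using assms(1) mat_closed[of f] by (simp_all add: matrix_algebra_def PiE_iff)
  show "mat f t = B t" if "t \<in> {..<p} \<times> {..<p}" for t
  proof -
    obtain i j where t: "t = (i, j)" by (cases t)
    have ij: "i < p" "j < p" using that by (auto simp: t)
    show ?thesis unfolding t
      by (rule root_coeffs_unique[of "\<lambda>i. mat f (i, j)" "\<lambda>i. B (i, j)"]) (use ij assms(2) mat[OF rt(1)] in auto)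
  qed
qed

lemma act_mult:
  assumes x: "rt x" and j: "j < p"
  shows "act (f \<otimes>\<^bsub>A\<^esub> g) j x = (\<Sum>l<p. to_ac (mat g (l, j)) * act f l x)"
proof -
  have mult: "cyclic_comp p (f \<otimes>\<^bsub>A\<^esub> g) t y = (\<Sum>r<p. \<Sum>u<p. if (r + u) mod p = t then to_ac a ^ ((r + u) div p) *
       cyclic_comp p f r (to_ac \<zeta> ^ u * y) * cyclic_comp p g u y else 0)" if "rt y" for t y
    using cyclic_comp_mult[OF p0] that by (simp add: rt_def)
  let ?T = "\<lambda>r u. \<Xi> (r + u) x * cyclic_comp p f r (\<omega> ^ r * x) * cyclic_comp p g u (\<omega> ^ (r + u) * x) * (\<omega> ^ (r + u) * x) ^ j"
  have "act (f \<otimes>\<^bsub>A\<^esub> g) j x = (\<Sum>t<p. \<Sum>r<p. \<Sum>u<p. if (r + u) mod p = t then ?T r u else 0)"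
    unfolding act_def
  proof (intro sum.cong HOL.refl)
    fix t
    have "\<Xi> t x * (if (r + u) mod p = t then to_ac a ^ ((r + u) div p) *
       cyclic_comp p f r (to_ac \<zeta> ^ u * (\<omega> ^ t * x)) * cyclic_comp p g u (\<omega> ^ t * x) else 0) * (\<omega> ^ t * x) ^ j =
       (if (r + u) mod p = t then ?T r u else 0)" for r u
    proof (cases "(r + u) mod p = t")
      case True
      have t: "\<omega> ^ t = \<omega> ^ (r + u)" using \<omega>_mod[of "r + u"] True by simp
      have "to_ac \<zeta> ^ u * (\<omega> ^ t * x) = (to_ac \<zeta> * \<omega>) ^ u * (\<omega> ^ r * x)"
        unfolding t by (simp add: power_add power_mult_distrib mult_ac)
      then have tx: "to_ac \<zeta> ^ u * (\<omega> ^ t * x) = \<omega> ^ r * x" using Z\<omega>(1) by simp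
      show ?thesis unfolding tx using True \<Xi>_mod[OF x, of "r + u"] by (simp add: t mult_ac)
    qed simp
    then show "\<Xi> t x * cyclic_comp p (f \<otimes>\<^bsub>A\<^esub> g) t (\<omega> ^ t * x) * (\<omega> ^ t * x) ^ j =
      (\<Sum>r<p. \<Sum>u<p. if (r + u) mod p = t then ?T r u else 0)"
      unfolding mult[OF rt(2)[OF x]] by (simp only: sum_distrib_left sum_distrib_right)
  qed
  also have "\<dots> = (\<Sum>r<p. \<Sum>u<p. \<Sum>t<p. if (r + u) mod p = t then ?T r u else 0)"
    by (rule HOL.trans[OF sum.swap], rule sum.cong[OF HOL.refl], rule sum.swap)
  also have "\<dots> = (\<Sum>r<p. \<Sum>u<p. ?T r u)"
    using p0 by (simp add: sum.delta')
  also have "\<dots> = (\<Sum>r<p. \<Xi> r x * cyclic_comp p f r (\<omega> ^ r * x) * act g j (\<omega> ^ r * x))"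
    unfolding act_def by (intro sum.cong HOL.refl) (simp add: \<Xi>_add sum_distrib_left power_add mult_ac)
  also have "\<dots> = (\<Sum>r<p. \<Sum>l<p. to_ac (mat g (l, j)) * (\<Xi> r x * cyclic_comp p f r (\<omega> ^ r * x) * (\<omega> ^ r * x) ^ l))"
    unfolding mat[OF rt(2)[OF x] j, symmetric] by (simp add: sum_distrib_left mult_ac)
  also have "\<dots> = (\<Sum>l<p. to_ac (mat g (l, j)) * act f l x)"
    unfolding act_def by (subst sum.swap) (simp add: sum_distrib_left)
  finally show ?thesis .
qed

lemma matrix_mult:
  "B \<in> carrier (MM) \<Longrightarrow> C \<in> carrier (MM) \<Longrightarrow>
    B \<otimes>\<^bsub>MM\<^esub> C = (\<lambda>(i, j) \<in> {..<p} \<times> {..<p}. \<Sum>l<p. B (i, l) * C (l, j))"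
  by (simp add: matrix_algebra_def finsum_base_algebra) (simp add: base_algebra_def)

lemma mat_mult: "mat (f \<otimes>\<^bsub>A\<^esub> g) = mat f \<otimes>\<^bsub>MM\<^esub> mat g"
proof (rule mat_eqI)
  fix j assume j: "j < p"
  have "(\<Sum>i<p. to_ac ((mat f \<otimes>\<^bsub>MM\<^esub> mat g) (i, j)) * \<beta> ^ i) =
    (\<Sum>i<p. \<Sum>l<p. to_ac (mat g (l, j)) * (to_ac (mat f (i, l)) * \<beta> ^ i))"
    using j by (simp add: matrix_mult mat_closed to_ac_sum sum_distrib_right sum_distrib_left mult_ac)
  also have "\<dots> = (\<Sum>l<p. to_ac (mat g (l, j)) * (\<Sum>i<p. to_ac (mat f (i, l)) * \<beta> ^ i))"
    by (subst sum.swap) (simp add: sum_distrib_left)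
  also have "\<dots> = act (f \<otimes>\<^bsub>A\<^esub> g) j \<beta>"
    by (simp add: act_mult[OF rt(1) j] mat[OF rt(1)])
  finally show "(\<Sum>i<p. to_ac ((mat f \<otimes>\<^bsub>MM\<^esub> mat g) (i, j)) * \<beta> ^ i) = act (f \<otimes>\<^bsub>A\<^esub> g) j \<beta>" .
next
  interpret K: algebra_ring kk using ring_base_algebra by (rule algebra_ring.intro)
  show "mat f \<otimes>\<^bsub>MM\<^esub> mat g \<in> carrier (MM)"
    by (intro K.matrix_algebra_mult_closed mat_closed)
qed

lemma mat_add: "mat (f \<oplus>\<^bsub>A\<^esub> g) = mat f \<oplus>\<^bsub>MM\<^esub> mat g"
proof (rule mat_eqI)
  show "mat f \<oplus>\<^bsub>MM\<^esub> mat g \<in> carrier (MM)"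
    by (auto simp: matrix_algebra_def base_algebra_def)
  fix j assume j: "j < p"
  have "act (f \<oplus>\<^bsub>A\<^esub> g) j \<beta> = act f j \<beta> + act g j \<beta>"
    by (simp add: act_def cyclic_comp_def cyclic_algebra_def distrib_left distrib_right sum.distrib)
  then show "(\<Sum>i<p. to_ac ((mat f \<oplus>\<^bsub>MM\<^esub> mat g) (i, j)) * \<beta> ^ i) = act (f \<oplus>\<^bsub>A\<^esub> g) j \<beta>"
    using j by (simp add: mat[OF rt(1), symmetric] matrix_algebra_def base_algebra_def distrib_right sum.distrib)
qed

lemma mat_smult: "mat (r \<odot>\<^bsub>A\<^esub> f) = r \<odot>\<^bsub>MM\<^esub> mat f"
proof (rule mat_eqI)
  show "r \<odot>\<^bsub>MM\<^esub> mat f \<in> carrier (MM)"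
    by (auto simp: matrix_algebra_def base_algebra_def)
  fix j assume j: "j < p"
  have "act (r \<odot>\<^bsub>A\<^esub> f) j \<beta> = to_ac r * act f j \<beta>"
    by (simp add: act_def cyclic_comp_def cyclic_algebra_def sum_distrib_left mult_ac)
  then show "(\<Sum>i<p. to_ac ((r \<odot>\<^bsub>MM\<^esub> mat f) (i, j)) * \<beta> ^ i) = act (r \<odot>\<^bsub>A\<^esub> f) j \<beta>"
    using j by (simp add: mat[OF rt(1), symmetric] matrix_algebra_def base_algebra_def sum_distrib_left mult_ac)
qed

lemma mat_one: "mat \<one>\<^bsub>A\<^esub> = \<one>\<^bsub>MM\<^esub>"
proof (rule mat_eqI)
  show "\<one>\<^bsub>MM\<^esub> \<in> carrier (MM)"
    by (auto simp: matrix_algebra_def base_algebra_def)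
  fix j assume j: "j < p"
  have comp: "cyclic_comp p \<one>\<^bsub>A\<^esub> r x = (if r = 0 then 1 else 0)" for r x
  proof -
    have "cyclic_comp p \<one>\<^bsub>A\<^esub> r x = (\<Sum>s<p. if s = 0 then (if r = 0 then 1 else 0) else 0)"
      unfolding cyclic_comp_def by (intro sum.cong HOL.refl) (simp add: cyclic_algebra_def)
    then show ?thesis using p0 by (simp add: sum.delta)
  qed
  have "act \<one>\<^bsub>A\<^esub> j \<beta> = (\<Sum>r<p. if r = 0 then \<beta> ^ j else 0)"
    unfolding act_def comp by (intro sum.cong HOL.refl) (simp add: \<Xi>_def)
  then have "act \<one>\<^bsub>A\<^esub> j \<beta> = \<beta> ^ j" using p0 by (simp add: sum.delta)
  moreover have "(\<Sum>i<p. to_ac (\<one>\<^bsub>MM\<^esub> (i, j)) * \<beta> ^ i) = (\<Sum>i<p. if i = j then \<beta> ^ j else 0)"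
    using j by (intro sum.cong HOL.refl) (simp add: matrix_algebra_def base_algebra_def)
  ultimately show "(\<Sum>i<p. to_ac (\<one>\<^bsub>MM\<^esub> (i, j)) * \<beta> ^ i) = act \<one>\<^bsub>A\<^esub> j \<beta>"
    using j by (simp add: sum.delta)
qed

lemma p_nz: "of_nat p \<noteq> (0 :: 'k alg_closure)"
  using char by (metis to_ac_of_nat to_ac_eq_0_iff)

text \<open>Fourier inversion over the powers of \<open>\<omega>\<close>.\<close>

lemma recover:
  assumes x: "rt x" and q: "q < p"
  shows "(\<Sum>j<p. act f j x / (\<omega> ^ q * x) ^ j) = of_nat p * \<Xi> q x * cyclic_comp p f q (\<omega> ^ q * x)"
proof -
  have "(\<Sum>j<p. act f j x / (\<omega> ^ q * x) ^ j) =
    (\<Sum>r<p. \<Sum>j<p. \<Xi> r x * cyclic_comp p f r (\<omega> ^ r * x) * ((\<omega> ^ r * x) ^ j / (\<omega> ^ q * x) ^ j))"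
    unfolding act_def by (subst sum.swap) (simp add: sum_divide_distrib)
  also have "\<dots> = (\<Sum>r<p. if r = q then of_nat p * \<Xi> q x * cyclic_comp p f q (\<omega> ^ q * x) else 0)"
  proof (intro sum.cong HOL.refl)
    fix r assume "r \<in> {..<p}"
    then have "(\<Sum>j<p. (\<omega> ^ r * x) ^ j / (\<omega> ^ q * x) ^ j) = (if r = q then of_nat p else 0)"
      using primitive_root_sum_quotient[OF \<omega> rt(4)[OF x] _ q] by simp
    then show "(\<Sum>j<p. \<Xi> r x * cyclic_comp p f r (\<omega> ^ r * x) * ((\<omega> ^ r * x) ^ j / (\<omega> ^ q * x) ^ j)) =
      (if r = q then of_nat p * \<Xi> q x * cyclic_comp p f q (\<omega> ^ q * x) else 0)"
      unfolding sum_distrib_left[symmetric] by simp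
  qed
  finally show ?thesis using q by (simp add: sum.delta)
qed

lemma component_zero:
  assumes "x = \<omega> ^ q * \<beta>" "cyclic_comp p f r x = 0" "s < p" shows "f (r, s) = 0"
proof (rule ccontr)
  have "x ^ p = to_ac b" using rt(2)[OF rt(1), of q] assms(1) by (simp add: rt_def)
  from pure_over_base[OF p \<zeta> b(2) this] have "pure_over p (range to_ac) x" .
  moreover assume "f (r, s) \<noteq> 0"
  ultimately show False using cyclic_comp_nonzero assms(2,3) by blast
qed

lemma mat_inj: "inj_on mat (carrier A)"
proof (rule inj_onI)
  fix f g assume fg: "f \<in> carrier A" "g \<in> carrier A" "mat f = mat g"
  have act: "act f j \<beta> = act g j \<beta>" if "j < p" for j
    using mat[OF rt(1) that, of f] mat[OF rt(1) that, of g] fg(3) by simp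
  have "f (q, s) = g (q, s)" if "q < p" "s < p" for q s
  proof -
    have "of_nat p * \<Xi> q \<beta> * cyclic_comp p f q (\<omega> ^ q * \<beta>) = of_nat p * \<Xi> q \<beta> * cyclic_comp p g q (\<omega> ^ q * \<beta>)"
      unfolding recover[OF rt(1) that(1), symmetric] using act by simp
    then have "cyclic_comp p f q (\<omega> ^ q * \<beta>) = cyclic_comp p g q (\<omega> ^ q * \<beta>)"
      using \<Xi>_nonzero[OF rt(1) that(1)] p_nz by simp
    then have "cyclic_comp p (\<lambda>t. f t - g t) q (\<omega> ^ q * \<beta>) = 0"
      by (simp add: cyclic_comp_def left_diff_distrib sum_subtractf)
    from component_zero[OF HOL.refl this that(2)] show ?thesis by simp
  qed
  moreover have "f t = g t" if "t \<notin> {..<p} \<times> {..<p}" for t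
    using fg(1,2) that by (cases t) (auto simp: cyclic_algebra_def)
  ultimately show "f = g" by (intro ext) (metis SigmaE lessThan_iff)
qed

lemma mat_surj:
  assumes B: "B \<in> carrier (MM)"
  obtains f where "f \<in> carrier A" "mat f = B"
proof -
  define R where "R j x = (\<Sum>i<p. to_ac (B (i, j)) * x ^ i)" for j x
  define \<phi> where "\<phi> q x = to_ac (inverse (of_nat p * a)) * (\<Prod>i<p - q. \<xi> (\<omega> ^ i * x)) *
    (\<Sum>j<p. R j (to_ac \<zeta> ^ q * x) * (to_ac (inverse b) * x ^ (p - j)))" for q x
  have "regular (\<phi> q)" for q
    unfolding \<phi>_def R_def \<xi>_def
    by (intro regular_mult regular_const regular_prod regular_rotate regular_sum regular_polynomial
      regular_scale regular_power regular_id)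
  note reg = root_coeffs[OF this]
  define f where "f t = (if t \<in> {..<p} \<times> {..<p} then root_coeffs (\<phi> (fst t)) (snd t) else 0)" for t
  have f: "f \<in> carrier A" by (auto simp: f_def cyclic_algebra_def)
  have comp: "cyclic_comp p f q x = \<phi> q x" if "q < p" "rt x" for q x
    using that reg[of x q] by (simp add: cyclic_comp_def f_def)
  have \<phi>: "\<Xi> q x * \<phi> q (\<omega> ^ q * x) = (\<Sum>j<p. R j x / (\<omega> ^ q * x) ^ j) / of_nat p" if x: "rt x" and q: "q < p" for q x
  proof -
    have "to_ac \<zeta> ^ q * (\<omega> ^ q * x) = (to_ac \<zeta> * \<omega>) ^ q * x" by (simp add: power_mult_distrib)
    then have Zx: "to_ac \<zeta> ^ q * (\<omega> ^ q * x) = x" using Z\<omega> by simp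
    have pw: "to_ac (inverse b) * (\<omega> ^ q * x) ^ (p - j) = 1 / (\<omega> ^ q * x) ^ j" if "j < p" for j
    proof -
      have "(\<omega> ^ q * x) ^ (p - j) * (\<omega> ^ q * x) ^ j = to_ac b"
        using rt(2)[OF x, of q] that by (simp add: rt_def flip: power_add)
      then show ?thesis using rt(4)[OF rt(2)[OF x]] b(1) by (simp add: field_simps)
    qed
    have "\<Xi> q x * (\<Prod>i<p - q. \<xi> (\<omega> ^ i * (\<omega> ^ q * x))) = to_ac a"
      using \<Xi>_add[of q "p - q" x] \<Xi>_p[OF x] q by (simp add: \<Xi>_def)
    then have "\<Xi> q x * \<phi> q (\<omega> ^ q * x) = to_ac a * to_ac (inverse (of_nat p * a)) * (\<Sum>j<p. R j x * (to_ac (inverse b) * (\<omega> ^ q * x) ^ (p - j)))"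
      unfolding \<phi>_def Zx by (simp add: mult_ac)
    also have "(\<Sum>j<p. R j x * (to_ac (inverse b) * (\<omega> ^ q * x) ^ (p - j))) = (\<Sum>j<p. R j x / (\<omega> ^ q * x) ^ j)"
      by (intro sum.cong HOL.refl) (simp only: lessThan_iff pw times_divide_eq_right mult_1_right)
    finally show ?thesis using a by (simp add: field_simps)
  qed
  have "act f j \<beta> = R j \<beta>" if j: "j < p" for j
  proof -
    have b0: "\<beta> \<noteq> 0" using rt(4)[OF rt(1)] .
    have "act f j \<beta> = (\<Sum>q<p. \<Sum>l<p. R l \<beta> / of_nat p * ((\<omega> ^ q * \<beta>) ^ j / (\<omega> ^ q * \<beta>) ^ l))"
      unfolding act_def
    proof (intro sum.cong HOL.refl)
      fix q assume "q \<in> {..<p}"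
      then have q: "q < p" by simp
      show "\<Xi> q \<beta> * cyclic_comp p f q (\<omega> ^ q * \<beta>) * (\<omega> ^ q * \<beta>) ^ j =
        (\<Sum>l<p. R l \<beta> / of_nat p * ((\<omega> ^ q * \<beta>) ^ j / (\<omega> ^ q * \<beta>) ^ l))"
        unfolding comp[OF q rt(2)[OF rt(1)]] \<phi>[OF rt(1) q]
        by (simp add: sum_divide_distrib sum_distrib_left mult_ac)
    qed
    also have "\<dots> = (\<Sum>l<p. R l \<beta> / of_nat p * (\<Sum>q<p. (\<omega> ^ q * \<beta>) ^ j / (\<omega> ^ q * \<beta>) ^ l))"
      by (subst sum.swap) (simp add: sum_distrib_left)
    also have "\<dots> = (\<Sum>l<p. if l = j then R j \<beta> else 0)"
    proof (intro sum.cong HOL.refl)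
      fix l assume "l \<in> {..<p}"
      then have l: "l < p" by simp
      have "(\<omega> ^ q * \<beta>) ^ j / (\<omega> ^ q * \<beta>) ^ l = \<beta> ^ j / \<beta> ^ l * ((\<omega> ^ j * 1) ^ q / (\<omega> ^ l * 1) ^ q)" for q
        by (simp add: power_mult_distrib mult.commute flip: power_mult)
      then have "(\<Sum>q<p. (\<omega> ^ q * \<beta>) ^ j / (\<omega> ^ q * \<beta>) ^ l) = \<beta> ^ j / \<beta> ^ l * (if j = l then of_nat p else 0)"
        by (simp only: sum_distrib_left[symmetric] primitive_root_sum_quotient[OF \<omega> one_neq_zero j l])
      then show "R l \<beta> / of_nat p * (\<Sum>q<p. (\<omega> ^ q * \<beta>) ^ j / (\<omega> ^ q * \<beta>) ^ l) = (if l = j then R j \<beta> else 0)"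
        using p_nz b0 by auto
    qed
    finally show ?thesis using j by (simp add: sum.delta)
  qed
  then have "mat f = B" by (intro mat_eqI B) (simp add: R_def)
  then show ?thesis using that f by blast
qed

theorem split: "brauer_trivial A"
proof -
  let ?A1 = "matrix_algebra 1 A"
  define h where "h B = mat (B (0 :: nat, 0 :: nat))" for B
  have ent: "B (0, 0) \<in> carrier A" if "B \<in> carrier ?A1" for B using that by (auto simp: matrix_algebra_def)
  have "h \<in> ring_iso ?A1 MM"
    unfolding ring_iso_def
  proof (intro CollectI conjI ring_hom_memI)
    show "h B \<in> carrier MM" for B by (simp add: h_def mat_closed)
    show "h \<one>\<^bsub>?A1\<^esub> = \<one>\<^bsub>MM\<^esub>"
      unfolding h_def mat_one[symmetric] by (simp add: matrix_algebra_def)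
    fix B C assume BC: "B \<in> carrier ?A1" "C \<in> carrier ?A1"
    have "(\<Oplus>\<^bsub>A\<^esub>l\<in>{0}. B (0, l) \<otimes>\<^bsub>A\<^esub> C (l, 0)) = B (0, 0) \<otimes>\<^bsub>A\<^esub> C (0, 0)"
      using ent[OF BC(1)] ent[OF BC(2)] by (subst A.finsum_insert) auto
    then have "(B \<otimes>\<^bsub>?A1\<^esub> C) (0, 0) = B (0, 0) \<otimes>\<^bsub>A\<^esub> C (0, 0)"
      by (simp add: matrix_algebra_def lessThan_Suc)
    then show "h (B \<otimes>\<^bsub>?A1\<^esub> C) = h B \<otimes>\<^bsub>MM\<^esub> h C" by (simp add: h_def mat_mult)
    have "(B \<oplus>\<^bsub>?A1\<^esub> C) (0, 0) = B (0, 0) \<oplus>\<^bsub>A\<^esub> C (0, 0)" by (simp add: matrix_algebra_def)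
    then show "h (B \<oplus>\<^bsub>?A1\<^esub> C) = h B \<oplus>\<^bsub>MM\<^esub> h C" by (simp add: h_def mat_add)
  next
    show "bij_betw h (carrier ?A1) (carrier MM)"
    proof (rule bij_betw_imageI)
      show "inj_on h (carrier ?A1)"
      proof (rule inj_onI)
        fix B C assume BC: "B \<in> carrier ?A1" "C \<in> carrier ?A1" "h B = h C"
        then have "B (0, 0) = C (0, 0)"
          using mat_inj ent by (auto simp: h_def dest: inj_onD)
        moreover have "B \<in> extensional {(0, 0)}" "C \<in> extensional {(0, 0)}"
          using BC(1,2) by (simp_all add: matrix_algebra_def PiE_iff lessThan_Suc)
        ultimately show "B = C" by (intro extensionalityI[of B "{(0, 0)}"]) simp_all
      qed
      show "h ` carrier ?A1 = carrier MM"
      proof (intro equalityI subsetI)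
        fix N assume "N \<in> carrier MM"
        then obtain f where f: "f \<in> carrier A" "mat f = N" using mat_surj by blast
        then have "(\<lambda>_ \<in> {..<1} \<times> {..<1}. f) \<in> carrier ?A1" by (auto simp: matrix_algebra_def)
        moreover have "h (\<lambda>_ \<in> {..<1} \<times> {..<1}. f) = N" using f by (simp add: h_def)
        ultimately show "N \<in> h ` carrier ?A1" by blast
      qed (auto simp: h_def mat_closed)
    qed
  qed
  moreover have "h (r \<odot>\<^bsub>?A1\<^esub> B) = r \<odot>\<^bsub>MM\<^esub> h B" for r B
  proof -
    have "(r \<odot>\<^bsub>?A1\<^esub> B) (0, 0) = r \<odot>\<^bsub>A\<^esub> B (0, 0)" by (simp add: matrix_algebra_def)
    then show ?thesis by (simp add: h_def mat_smult)
  qed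
  ultimately show ?thesis
    unfolding brauer_trivial_def brauer_equivalent_def algebra_iso_def using p0
    by (intro exI[of _ 1] exI[of _ p]) auto
qed

end

section \<open>From the extension to the norm equation\<close>

lemma dedekind_independence:
  assumes M: "is_subfield M" and I: "finite I" and hom: "\<And>i. i \<in> I \<Longrightarrow> field_hom_on M (\<chi> i)"
    and distinct: "\<And>i j. i \<in> I \<Longrightarrow> j \<in> I \<Longrightarrow> i \<noteq> j \<Longrightarrow> \<exists>x\<in>M. \<chi> i x \<noteq> \<chi> j x"
    and rel: "\<And>x. x \<in> M \<Longrightarrow> (\<Sum>i\<in>I. c i * \<chi> i x) = 0" and i: "i \<in> I"
  shows "c i = (0 :: 'a::field)"
  using I hom distinct rel i
proof (induction I arbitrary: c i rule: finite_induct)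
  case (insert l I)
  have rel: "(\<Sum>i\<in>I. c i * \<chi> i x) = - (c l * \<chi> l x)" if "x \<in> M" for x
    using insert.prems(3)[OF that] insert.hyps by (simp add: eq_neg_iff_add_eq_0 add.commute)
  have zero: "c j = 0" if j: "j \<in> I" for j
  proof -
    have "j \<noteq> l" using j insert.hyps by auto
    then obtain u where u: "u \<in> M" "\<chi> j u \<noteq> \<chi> l u"
      using insert.prems(2)[of j l] j by auto
    have "(\<Sum>i\<in>I. c i * (\<chi> i u - \<chi> l u) * \<chi> i x) = 0" if x: "x \<in> M" for x
    proof -
      have "(\<Sum>i\<in>I. c i * (\<chi> i u - \<chi> l u) * \<chi> i x) = (\<Sum>i\<in>I. c i * \<chi> i (u * x)) - \<chi> l u * (\<Sum>i\<in>I. c i * \<chi> i x)"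
        using insert.prems(1) u x
        by (simp add: field_hom_on_mult[OF M] sum_distrib_left sum_subtractf algebra_simps)
      also have "\<dots> = 0"
        using rel[OF x] rel[OF is_subfield_mult[OF M u(1) x]] insert.prems(1)[of l] u x
        by (simp add: field_hom_on_mult[OF M])
      finally show ?thesis .
    qed
    then have "c j * (\<chi> j u - \<chi> l u) = 0"
      using insert.IH[of "\<lambda>i. c i * (\<chi> i u - \<chi> l u)" j] insert.prems(1,2) j by blast
    then show ?thesis using u by simp
  qed
  have "c l * \<chi> l 1 = 0" using rel[OF is_subfield_one[OF M]] zero by simp
  then have "c l = 0" using insert.prems(1)[of l] by (simp add: field_hom_on_def)
  then show ?case using zero insert.prems(4) by auto
qed simp

lemma sum_cyclic_shift: "f n = f 0 \<Longrightarrow> (\<Sum>i<n. f (Suc i)) = (\<Sum>i<n. f i :: 'a::ab_group_add)"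
  using sum.lessThan_Suc_shift[of f n] by simp

lemma prod_cyclic_shift:
  "f n = c * f 0 \<Longrightarrow> f 0 \<noteq> 0 \<Longrightarrow> (\<Prod>i<n. f (Suc i)) = c * (\<Prod>i<n. f i :: 'a::field)"
  using prod.lessThan_Suc_shift[of f n] by (simp add: mult.commute)

lemma primitive_root_power_int:
  assumes "primitive_root n \<zeta>" "\<zeta> powi m = 1" shows "int n dvd m"
proof (cases "m \<ge> 0")
  case True
  then have "\<zeta> ^ nat m = 1" using assms(2) by (simp add: power_int_def)
  then have "n dvd nat m" using assms(1) by (simp add: primitive_root_def)
  then have "int n dvd int (nat m)" by (simp only: int_dvd_int_iff)
  then show ?thesis using True by (simp only: nat_0_le)
next
  case False
  then have "\<zeta> ^ nat (- m) = 1" using assms(2) by (simp add: power_int_def power_inverse)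
  then have "n dvd nat (- m)" using assms(1) by (simp add: primitive_root_def)
  then have "int n dvd int (nat (- m))" by (simp only: int_dvd_int_iff)
  moreover have "int (nat (- m)) = - m" using False by simp
  ultimately show ?thesis by (metis dvd_minus_iff)
qed

lemma to_ac_power_int: "to_ac (a powi m) = to_ac a powi m"
  by (simp add: power_int_def)

lemma field_hom_on_power_int:
  assumes "is_subfield F" "field_hom_on F \<phi>" "x \<in> F" shows "\<phi> (x powi m) = \<phi> x powi m"
  using assms by (simp add: power_int_def field_hom_on_power field_hom_on_inverse is_subfield_inverse)

lemma is_subfield_power_int: "is_subfield F \<Longrightarrow> x \<in> F \<Longrightarrow> x powi m \<in> F"
  by (simp add: power_int_def is_subfield_power is_subfield_inverse)

theorem realizable_imp_norm_equation:
  fixes z :: "'k::field"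
  assumes p: "Factorial_Ring.prime p" "odd p" and char: "of_nat p \<noteq> (0 :: 'k)"
    and z: "primitive_root (p ^ 3) z" and real: "realizable_as_galois_group TYPE('k) (Phi2_41 p)"
  obtains a1 a2 :: 'k and \<beta> c where "independent_mod_powers p [a1, a2]" "\<beta> ^ p = to_ac a2"
    "(\<Prod>q<p. \<Sum>i<p. to_ac (c i) * (to_ac (z ^ p\<^sup>2) ^ q * \<beta>) ^ i) = to_ac (inverse z * a1)"
proof -
  have p0: "p > 0" and p1: "p > 1" using p(1) prime_gt_0_nat prime_gt_1_nat by auto
  define Z \<zeta> where "Z = to_ac z" and "\<zeta> = Z ^ p\<^sup>2"
  have Z: "primitive_root (p ^ 3) Z" using z by (simp add: Z_def to_ac_primitive_root)
  have \<zeta>: "primitive_root p \<zeta>"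
    using primitive_root_power[of "p\<^sup>2" p Z] Z unfolding \<zeta>_def by (simp add: power2_eq_square power3_eq_cube)
  have nz: "Z \<noteq> 0" "\<zeta> \<noteq> 0" using primitive_root_nonzero[OF Z] primitive_root_nonzero[OF \<zeta>] by auto
  have roots: "Z ^ p ^ 3 = 1" "\<zeta> ^ p = 1" using Z \<zeta> by (auto simp: primitive_root_def)
  have pL: "of_nat p \<noteq> (0 :: 'k alg_closure)" using char by (metis to_ac_of_nat to_ac_eq_0_iff)
  define k where "k = range (to_ac :: 'k \<Rightarrow> _)"
  have k: "is_subfield k" unfolding k_def by (rule is_subfield_range_to_ac)
  obtain M where M: "galois_extension k M" "galois_group k M \<cong> Phi2_41 p"
    using real unfolding realizable_as_galois_group_def k_def by blast
  have MF: "is_subfield M" "k \<subseteq> M" and fixed: "{x \<in> M. \<forall>\<sigma>\<in>galois_aut k M. \<sigma> x = x} = k"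
    using M(1) by (auto simp: galois_extension_def subfield_iff_is_subfield)
  have in_k: "Z ^ i \<in> k" "\<zeta> ^ i \<in> k" "inverse Z ^ i \<in> k" "inverse \<zeta> ^ i \<in> k" "Z \<in> k" "\<zeta> \<in> k" "inverse \<zeta> \<in> k" for i
  proof -
    show 1: "Z \<in> k" by (simp add: k_def Z_def)
    then show 2: "\<zeta> \<in> k" unfolding \<zeta>_def by (rule is_subfield_power[OF k])
    show 3: "inverse \<zeta> \<in> k" using 2 by (rule is_subfield_inverse[OF k])
    show "Z ^ i \<in> k" "\<zeta> ^ i \<in> k" "inverse Z ^ i \<in> k" "inverse \<zeta> ^ i \<in> k"
      using 1 2 3 is_subfield_inverse[OF k 1] by (auto intro: is_subfield_power[OF k])
  qed
  let ?\<Gamma> = "galois_group k M" and ?G = "Phi2_41 p"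
  interpret \<Gamma>: group ?\<Gamma> using MF by (intro group_galois_group) (simp_all add: subfield_iff_is_subfield)
  interpret G: group ?G by (rule Phi2_41_group)
  obtain \<psi> where \<psi>: "\<psi> \<in> iso ?G ?\<Gamma>"
    using \<Gamma>.iso_sym[OF M(2)] by (auto simp: is_iso_def)
  interpret \<psi>: group_hom ?G ?\<Gamma> \<psi> using \<psi> by unfold_locales (simp add: iso_def)
  define a b c where "a = pres_class (Phi2_41_relations p) (gen_word gen_\<alpha>)"
    and "b = pres_class (Phi2_41_relations p) (gen_word gen_\<alpha>1)"
    and "c = pres_class (Phi2_41_relations p) (gen_word gen_\<alpha>2)"
  note facts = Phi2_41_facts[of p, folded a_def b_def c_def]
  define s t where "s = \<psi> a" and "t = \<psi> b"
  have st: "s \<in> carrier ?\<Gamma>" "t \<in> carrier ?\<Gamma>" unfolding s_def t_def using facts by auto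
  then have aut: "s \<in> galois_aut k M" "t \<in> galois_aut k M" by (simp_all add: galois_group_simps)
  have endo: "field_endo k M (s ^^ n)" "field_endo k M (t ^^ n)" for n
    using aut k by (auto intro!: field_endo_funpow field_endo_galois_aut)
  have hom: "field_hom_on M (s ^^ n)" "field_hom_on M (t ^^ n)"
    and closed: "x \<in> M \<Longrightarrow> (s ^^ n) x \<in> M" "x \<in> M \<Longrightarrow> (t ^^ n) x \<in> M"
    and fix_k: "x \<in> k \<Longrightarrow> (s ^^ n) x = x" "x \<in> k \<Longrightarrow> (t ^^ n) x = x" for n x
    using endo[of n] by (auto simp: field_endo_def)
  note hom1 = hom(1)[of 1, simplified] hom(2)[of 1, simplified]
  note closed1 = closed(1)[where n = 1, simplified] closed(2)[where n = 1, simplified]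
  note fix1 = fix_k(1)[where n = 1, simplified] fix_k(2)[where n = 1, simplified]
  have scal: "(s ^^ n) (e * x) = e * (s ^^ n) x" "(t ^^ n) (e * x) = e * (t ^^ n) x" if "e \<in> k" "x \<in> M" for e x n
    using that MF(2) fix_k field_hom_on_mult[OF MF(1) hom(1)[of n], of e x] field_hom_on_mult[OF MF(1) hom(2)[of n], of e x]
    by auto
  note scal1 = scal(1)[where n = 1, simplified] scal(2)[where n = 1, simplified]
  have pow: "(s [^]\<^bsub>?\<Gamma>\<^esub> (n::nat)) x = (s ^^ n) x" "(t [^]\<^bsub>?\<Gamma>\<^esub> (n::nat)) x = (t ^^ n) x" if "x \<in> M" for n x
    using galois_group_pow[OF MF aut(1) that] galois_group_pow[OF MF aut(2) that] by auto
  have powc: "s [^]\<^bsub>?\<Gamma>\<^esub> (n::nat) \<in> galois_aut k M" "t [^]\<^bsub>?\<Gamma>\<^esub> (n::nat) \<in> galois_aut k M" for n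
    using \<Gamma>.nat_pow_closed[OF st(1), of n] \<Gamma>.nat_pow_closed[OF st(2), of n] by (simp_all add: galois_group_simps)
  have \<psi>c: "\<psi> c = s [^]\<^bsub>?\<Gamma>\<^esub> (p ^ 3)"
    unfolding facts(5)[symmetric] s_def using facts(1) by (simp add: \<psi>.hom_nat_pow)
  have comm: "t (s x) = s (t ((s ^^ (p ^ 3)) x))" if x: "x \<in> M" for x
  proof -
    have "t \<otimes>\<^bsub>?\<Gamma>\<^esub> s = s \<otimes>\<^bsub>?\<Gamma>\<^esub> (t \<otimes>\<^bsub>?\<Gamma>\<^esub> s [^]\<^bsub>?\<Gamma>\<^esub> (p ^ 3))"
      using arg_cong[OF facts(4), of \<psi>] facts(1-3) unfolding s_def t_def by (simp add: \<psi>c s_def)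
    then have "(t \<otimes>\<^bsub>?\<Gamma>\<^esub> s) x = (s \<otimes>\<^bsub>?\<Gamma>\<^esub> (t \<otimes>\<^bsub>?\<Gamma>\<^esub> s [^]\<^bsub>?\<Gamma>\<^esub> (p ^ 3))) x" by simp
    moreover have "t \<otimes>\<^bsub>?\<Gamma>\<^esub> s [^]\<^bsub>?\<Gamma>\<^esub> (p ^ 3) \<in> galois_aut k M"
      using \<Gamma>.m_closed[OF st(2) \<Gamma>.nat_pow_closed[OF st(1), of "p ^ 3"]] by (simp add: galois_group_simps)
    ultimately show ?thesis using x by (simp add: galois_group_mult aut powc pow)
  qed
  have t_order: "(t ^^ p) x = x" if x: "x \<in> M" for x
  proof -
    have "t [^]\<^bsub>?\<Gamma>\<^esub> p = \<one>\<^bsub>?\<Gamma>\<^esub>"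
      using arg_cong[OF facts(6), of \<psi>] facts(2) by (simp add: t_def \<psi>.hom_nat_pow)
    then show ?thesis using pow(2)[OF x, of p] x by (simp add: galois_group_simps)
  qed
  have p4: "p ^ 3 * p = p ^ 4" by (simp add: eval_nat_numeral)
  have s_order: "(s ^^ (p ^ 4)) x = x" if x: "x \<in> M" for x
  proof -
    have "(s [^]\<^bsub>?\<Gamma>\<^esub> (p ^ 3)) [^]\<^bsub>?\<Gamma>\<^esub> p = \<one>\<^bsub>?\<Gamma>\<^esub>"
      using arg_cong[OF facts(7), of \<psi>] facts(3) by (simp add: \<psi>c[symmetric] \<psi>.hom_nat_pow)
    then have "s [^]\<^bsub>?\<Gamma>\<^esub> (p ^ 4) = \<one>\<^bsub>?\<Gamma>\<^esub>" using st(1) by (simp add: \<Gamma>.nat_pow_pow p4)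
    then show ?thesis using pow(1)[OF x, of "p ^ 4"] x by (simp add: galois_group_simps)
  qed
  have gen: "\<exists>i j. \<sigma> = s [^]\<^bsub>?\<Gamma>\<^esub> (i::nat) \<otimes>\<^bsub>?\<Gamma>\<^esub> t [^]\<^bsub>?\<Gamma>\<^esub> (j::nat)" if "\<sigma> \<in> galois_aut k M" for \<sigma>
  proof -
    have "\<sigma> \<in> \<psi> ` carrier ?G" using \<psi> that by (simp add: iso_def bij_betw_def galois_group_simps)
    then obtain i j where "\<sigma> = \<psi> (a [^]\<^bsub>?G\<^esub> (i::nat) \<otimes>\<^bsub>?G\<^esub> b [^]\<^bsub>?G\<^esub> (j::nat))"
      using Phi2_41_normal_form[OF p0] by (auto simp: a_def b_def)
    then show ?thesis using facts(1,2) by (auto simp: s_def t_def \<psi>.hom_nat_pow)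
  qed
  have in_kI: "x \<in> k" if x: "x \<in> M" "s x = x" "t x = x" for x
  proof -
    have "(s ^^ n) x = x" "(t ^^ n) x = x" for n by (induction n) (auto simp: x)
    then have "\<sigma> x = x" if "\<sigma> \<in> galois_aut k M" for \<sigma>
      using gen[OF that] x(1) powc by (auto simp: galois_group_mult pow)
    then show ?thesis using fixed x(1) by blast
  qed
  have inj: "inj_on (\<lambda>(i :: nat, j :: nat). s [^]\<^bsub>?\<Gamma>\<^esub> i \<otimes>\<^bsub>?\<Gamma>\<^esub> t [^]\<^bsub>?\<Gamma>\<^esub> j) ({..<p ^ 4} \<times> {..<p})"
  proof -
    have G: "carrier ?G = (\<lambda>(i :: nat, j :: nat). a [^]\<^bsub>?G\<^esub> i \<otimes>\<^bsub>?G\<^esub> b [^]\<^bsub>?G\<^esub> j) ` ({..<p ^ 4} \<times> {..<p})"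
      using Phi2_41_normal_form[OF p0] by (simp add: a_def b_def)
    have "card (carrier ?G) = card ({..<p ^ 4} \<times> {..<p})"
      using order_Phi2_41[OF p1] by (simp add: Coset.order_def card_cartesian_product eval_nat_numeral)
    then have 1: "inj_on (\<lambda>(i :: nat, j :: nat). a [^]\<^bsub>?G\<^esub> i \<otimes>\<^bsub>?G\<^esub> b [^]\<^bsub>?G\<^esub> j) ({..<p ^ 4} \<times> {..<p})"
      unfolding G by (intro eq_card_imp_inj_on) simp_all
    have "inj_on \<psi> (carrier ?G)" using \<psi> by (simp add: iso_def bij_betw_def)
    then have "inj_on (\<psi> \<circ> (\<lambda>(i :: nat, j :: nat). a [^]\<^bsub>?G\<^esub> i \<otimes>\<^bsub>?G\<^esub> b [^]\<^bsub>?G\<^esub> j)) ({..<p ^ 4} \<times> {..<p})"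
      using 1 G by (intro comp_inj_on) simp_all
    moreover have "\<psi> \<circ> (\<lambda>(i :: nat, j :: nat). a [^]\<^bsub>?G\<^esub> i \<otimes>\<^bsub>?G\<^esub> b [^]\<^bsub>?G\<^esub> j) = (\<lambda>(i :: nat, j :: nat). s [^]\<^bsub>?\<Gamma>\<^esub> i \<otimes>\<^bsub>?\<Gamma>\<^esub> t [^]\<^bsub>?\<Gamma>\<^esub> j)"
      using facts(1,2) by (auto simp: fun_eq_iff s_def t_def \<psi>.hom_nat_pow)
    ultimately show ?thesis by simp
  qed
  have comm_pow: "t ((s ^^ n) x) = (s ^^ n) (t ((s ^^ (p ^ 3 * n)) x))" if x: "x \<in> M" for n x
    using x
  proof (induction n arbitrary: x)
    case (Suc n)
    have "t ((s ^^ Suc n) x) = s (t ((s ^^ (p ^ 3)) ((s ^^ n) x)))" using comm[OF closed(1)[OF Suc.prems]] by simp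
    also have "(s ^^ (p ^ 3)) ((s ^^ n) x) = (s ^^ n) ((s ^^ (p ^ 3)) x)"
      by (metis add.commute comp_apply funpow_add)
    also have "t \<dots> = (s ^^ n) (t ((s ^^ (p ^ 3 * n)) ((s ^^ (p ^ 3)) x)))"
      by (rule Suc.IH[OF closed(1)[OF Suc.prems]])
    also have "(s ^^ (p ^ 3 * n)) ((s ^^ (p ^ 3)) x) = (s ^^ (p ^ 3 * Suc n)) x"
      by (metis add.commute comp_apply funpow_add mult_Suc_right)
    finally show ?case by simp
  qed simp
  have s_period: "(s ^^ (p ^ 4 * n)) x = x" if "x \<in> M" for n x
    using s_order[OF that] by (induction n) (simp_all add: funpow_add)
  have comm_p: "t ((s ^^ (p * n)) x) = (s ^^ (p * n)) (t x)" if x: "x \<in> M" for n x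
  proof -
    have "p ^ 3 * (p * n) = p ^ 4 * n" by (simp add: eval_nat_numeral)
    then show ?thesis using comm_pow[OF x, of "p * n"] s_period[OF x, of n] by metis
  qed

  define \<chi> where "\<chi> = (\<lambda>(i, j) x. (s ^^ (p * i)) ((t ^^ j) x))"
  obtain u where u: "u \<in> M" "(\<Sum>ij\<in>{..<p ^ 3} \<times> {..<p}. inverse Z ^ fst ij * \<chi> ij u) \<noteq> 0"
  proof (rule ccontr)
    assume "\<not> thesis"
    with that have ex: "\<not> (\<exists>u\<in>M. (\<Sum>ij\<in>{..<p ^ 3} \<times> {..<p}. inverse Z ^ fst ij * \<chi> ij u) \<noteq> 0)"
      by blast
    have "inverse Z ^ fst (0 :: nat, 0 :: nat) = 0"
    proof (rule dedekind_independence[OF MF(1), of "{..<p ^ 3} \<times> {..<p}" \<chi> "\<lambda>ij. inverse Z ^ fst ij" "(0, 0)"])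
      show "field_hom_on M (\<chi> ij)" for ij
        using field_endo_comp[OF endo(1)[of "p * fst ij"] endo(2)[of "snd ij"]]
        by (simp add: \<chi>_def field_endo_def case_prod_beta comp_def)
      show "\<exists>x\<in>M. \<chi> ij x \<noteq> \<chi> ij' x" if ij: "ij \<in> {..<p ^ 3} \<times> {..<p}" "ij' \<in> {..<p ^ 3} \<times> {..<p}" "ij \<noteq> ij'" for ij ij'
      proof (rule ccontr)
        assume eq: "\<not> ?thesis"
        obtain i j i' j' where [simp]: "ij = (i, j)" "ij' = (i', j')" by fastforce
        have "s [^]\<^bsub>?\<Gamma>\<^esub> (p * i) \<otimes>\<^bsub>?\<Gamma>\<^esub> t [^]\<^bsub>?\<Gamma>\<^esub> j = s [^]\<^bsub>?\<Gamma>\<^esub> (p * i') \<otimes>\<^bsub>?\<Gamma>\<^esub> t [^]\<^bsub>?\<Gamma>\<^esub> j'"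
        proof (rule galois_aut_ext[of _ k M])
          show "s [^]\<^bsub>?\<Gamma>\<^esub> (p * i) \<otimes>\<^bsub>?\<Gamma>\<^esub> t [^]\<^bsub>?\<Gamma>\<^esub> j \<in> galois_aut k M" for i j :: nat
            using \<Gamma>.m_closed[OF \<Gamma>.nat_pow_closed[OF st(1), of "p * i"] \<Gamma>.nat_pow_closed[OF st(2), of j]]
            by (simp add: galois_group_simps)
          then show "s [^]\<^bsub>?\<Gamma>\<^esub> (p * i') \<otimes>\<^bsub>?\<Gamma>\<^esub> t [^]\<^bsub>?\<Gamma>\<^esub> j' \<in> galois_aut k M" .
          show "(s [^]\<^bsub>?\<Gamma>\<^esub> (p * i) \<otimes>\<^bsub>?\<Gamma>\<^esub> t [^]\<^bsub>?\<Gamma>\<^esub> j) x = (s [^]\<^bsub>?\<Gamma>\<^esub> (p * i') \<otimes>\<^bsub>?\<Gamma>\<^esub> t [^]\<^bsub>?\<Gamma>\<^esub> j') x" if "x \<in> M" for x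
            using eq that closed(2)[OF that] by (simp add: galois_group_mult powc pow \<chi>_def)
        qed
        moreover have "p * i < p ^ 4" "p * i' < p ^ 4"
          using ij p0 by (simp_all flip: p4 add: mult.commute)
        ultimately have "(p * i, j) = (p * i', j')"
          using ij inj_onD[OF inj, of "(p * i, j)" "(p * i', j')"] by simp
        then show False using ij(3) p0 by simp
      qed
      show "(\<Sum>ij\<in>{..<p ^ 3} \<times> {..<p}. inverse Z ^ fst ij * \<chi> ij x) = 0" if "x \<in> M" for x
        using ex that by blast
    qed (use p0 in auto)
    then show False by simp
  qed
  define y where "y = (\<Sum>i<p ^ 3. \<Sum>j<p. inverse Z ^ i * (s ^^ (p * i)) ((t ^^ j) u))"
  have y0: "y \<noteq> 0" using u(2) by (simp add: y_def \<chi>_def sum.cartesian_product case_prod_beta)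
  have term_M: "inverse Z ^ i * (s ^^ n) ((t ^^ j) u) \<in> M" for i n j
    using in_k(3)[of i] MF u closed by (intro is_subfield_mult[OF MF(1)]) auto
  have yM: "y \<in> M" unfolding y_def by (intro is_subfield_sum[OF MF(1)] term_M)
  have sy: "(s ^^ p) y = Z * y"
  proof -
    let ?f = "\<lambda>i. \<Sum>j<p. inverse Z ^ i * (s ^^ (p * i)) ((t ^^ j) u)"
    have "(s ^^ p) y = (\<Sum>i<p ^ 3. \<Sum>j<p. inverse Z ^ i * (s ^^ p) ((s ^^ (p * i)) ((t ^^ j) u)))"
      unfolding y_def using u(1)
      by (simp add: field_hom_on_sum[OF MF(1) hom(1)] is_subfield_sum[OF MF(1)] term_M scal in_k closed)
    also have "\<dots> = (\<Sum>i<p ^ 3. Z * ?f (Suc i))"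
      using nz by (simp add: sum_distrib_left funpow_add field_simps power_inverse)
    also have "\<dots> = Z * (\<Sum>i<p ^ 3. ?f i)"
    proof -
      have "?f (p ^ 3) = ?f 0"
        using s_order closed(2)[OF u(1)] roots(1) p4 by (simp add: mult.commute power_inverse)
      from sum_cyclic_shift[of ?f, OF this] show ?thesis by (simp flip: sum_distrib_left)
    qed
    finally show ?thesis by (simp add: y_def)
  qed
  have ty: "t y = y"
  proof -
    have "t y = (\<Sum>i<p ^ 3. \<Sum>j<p. inverse Z ^ i * t ((s ^^ (p * i)) ((t ^^ j) u)))"
      unfolding y_def using u(1)
      by (simp add: field_hom_on_sum[OF MF(1) hom1(2)] is_subfield_sum[OF MF(1)] term_M scal1 in_k closed)
    also have "\<dots> = (\<Sum>i<p ^ 3. \<Sum>j<p. inverse Z ^ i * (s ^^ (p * i)) ((t ^^ Suc j) u))"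
      using comm_p[OF closed(2)[OF u(1)]] by simp
    also have "\<dots> = y"
      unfolding y_def using t_order[OF u(1)] by (intro sum.cong HOL.refl sum_cyclic_shift) simp
    finally show ?thesis .
  qed
  have siy: "(s ^^ i) y \<in> M" "(s ^^ i) y \<noteq> 0" for i
    using closed yM field_hom_on_nonzero[OF MF(1) hom(1) yM y0] by auto
  have spy: "(s ^^ (p * i)) y = Z ^ i * y" for i
  proof (induction i)
    case (Suc i)
    have "(s ^^ (p * Suc i)) y = (s ^^ p) ((s ^^ (p * i)) y)" by (simp add: funpow_add)
    also have "\<dots> = Z ^ i * (s ^^ p) y" unfolding Suc by (rule scal(1)[OF in_k(1) yM])
    finally show ?case by (simp add: sy)
  qed simp
  have s3y: "(s ^^ (p ^ 3 * i)) y = \<zeta> ^ i * y" for i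
  proof -
    have "p ^ 3 * i = p * (p\<^sup>2 * i)" by (simp add: eval_nat_numeral)
    then show ?thesis by (simp only: spy \<zeta>_def power_mult)
  qed
  have tsy: "t ((s ^^ i) y) = \<zeta> ^ i * (s ^^ i) y" for i
    using comm_pow[OF yM, of i] by (simp add: s3y scal scal1 in_k yM ty)

  define Y where "Y = (\<Prod>i<p. (s ^^ i) y)"
  have Y: "Y \<in> M" "Y \<noteq> 0" unfolding Y_def using siy by (auto intro: is_subfield_prod[OF MF(1)])
  have sY: "s Y = Z * Y"
  proof -
    have "s Y = (\<Prod>i<p. (s ^^ Suc i) y)"
      unfolding Y_def using siy by (simp add: field_hom_on_prod[OF MF(1) hom1(1)])
    also have "\<dots> = Z * Y" unfolding Y_def using sy y0 by (intro prod_cyclic_shift) auto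
    finally show ?thesis .
  qed
  have tY: "t Y = Y"
  proof -
    have "t Y = (\<Prod>i<p. \<zeta> ^ i) * Y"
      unfolding Y_def using siy by (simp add: field_hom_on_prod[OF MF(1) hom1(2)] tsy prod.distrib)
    also have "(\<Prod>i<p. \<zeta> ^ i) = \<zeta> ^ (\<Sum>i<p. i)" by (simp add: power_sum)
    also have "p dvd (\<Sum>i<p. i)"
    proof -
      obtain m where m: "p = 2 * m + 1" using p(2) by (auto elim: oddE)
      have "2 * (\<Sum>i<p. i) = p * (2 * m)" using Sum_Ico_nat[of 0 p] m by (simp add: lessThan_atLeast0)
      then show ?thesis by (metis dvd_triv_left mult.left_commute nat_mult_eq_cancel_disj zero_neq_numeral)
    qed
    then have "\<zeta> ^ (\<Sum>i<p. i) = 1" using \<zeta> by (simp add: primitive_root_def)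
    finally show ?thesis by simp
  qed
  define \<beta> where "\<beta> = Y ^ p\<^sup>2"
  have \<beta>M: "\<beta> \<in> M" "\<beta> \<noteq> 0" unfolding \<beta>_def using Y by (auto intro: is_subfield_power[OF MF(1)])
  have s\<beta>: "s \<beta> = \<zeta> * \<beta>" and t\<beta>: "t \<beta> = \<beta>"
    unfolding \<beta>_def \<zeta>_def using Y
    by (simp_all add: field_hom_on_power[OF MF(1)] hom1 sY tY power_mult_distrib)

  define \<delta> where "\<delta> = y / s y"
  have sy1: "s y \<in> M" "s y \<noteq> 0" using siy[of 1] by simp_all
  have \<delta>: "\<delta> \<in> M" "\<delta> \<noteq> 0" unfolding \<delta>_def using yM sy1 y0 by (auto intro: is_subfield_divide[OF MF(1)])
  have s\<delta>: "(s ^^ i) \<delta> = (s ^^ i) y / (s ^^ Suc i) y" for i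
    unfolding \<delta>_def by (simp add: field_hom_on_divide[OF MF(1) hom(1)] yM sy1 funpow_swap1)
  have spn\<delta>: "(s ^^ (p * i)) \<delta> = \<delta>" for i
  proof -
    have "(s ^^ Suc (p * i)) y = Z ^ i * s y" by (simp add: spy scal1 in_k yM)
    then show ?thesis unfolding s\<delta> spy using nz by (simp add: \<delta>_def)
  qed
  have t\<delta>: "t \<delta> = inverse \<zeta> * \<delta>"
    unfolding \<delta>_def using tsy[of 1]
    by (simp add: field_hom_on_divide[OF MF(1) hom1(2)] yM sy1 ty field_simps)
  have ts\<delta>: "t ((s ^^ i) \<delta>) = inverse \<zeta> * (s ^^ i) \<delta>" for i
  proof -
    have "p ^ 3 * i = p * (p\<^sup>2 * i)" by (simp add: eval_nat_numeral)
    then have "(s ^^ (p ^ 3 * i)) \<delta> = \<delta>" by (simp only: spn\<delta>)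
    then show ?thesis using comm_pow[OF \<delta>(1), of i] by (simp add: t\<delta> scal in_k \<delta>)
  qed
  define D where "D r = (\<Sum>i<p. inverse \<zeta> ^ (r * i) * (s ^^ i) \<delta>)" for r
  have termD: "inverse \<zeta> ^ n * (s ^^ i) \<delta> \<in> M" for n i
    using in_k(4)[of n] MF \<delta> closed by (intro is_subfield_mult[OF MF(1)]) auto
  have DM: "D r \<in> M" for r unfolding D_def by (intro is_subfield_sum[OF MF(1)] termD)
  have sD: "s (D r) = \<zeta> ^ r * D r" for r
  proof -
    let ?f = "\<lambda>i. inverse \<zeta> ^ (r * i) * (s ^^ i) \<delta>"
    have "s (D r) = (\<Sum>i<p. inverse \<zeta> ^ (r * i) * (s ^^ Suc i) \<delta>)"
      unfolding D_def using \<delta>(1) by (simp add: field_hom_on_sum[OF MF(1) hom1(1)] termD scal1 in_k closed)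
    also have "\<dots> = (\<Sum>i<p. \<zeta> ^ r * ?f (Suc i))"
      using nz by (intro sum.cong HOL.refl) (simp add: power_add power_inverse field_simps)
    also have "\<dots> = \<zeta> ^ r * (\<Sum>i<p. ?f (Suc i))" by (rule sum_distrib_left[symmetric])
    also have "(\<Sum>i<p. ?f (Suc i)) = D r"
      unfolding D_def using spn\<delta>[of 1] roots(2)
      by (intro sum_cyclic_shift) (simp add: mult.commute[of r] power_mult power_inverse)
    finally show ?thesis .
  qed
  have tD: "t (D r) = inverse \<zeta> * D r" for r
  proof -
    have "t (D r) = (\<Sum>i<p. inverse \<zeta> ^ (r * i) * (inverse \<zeta> * (s ^^ i) \<delta>))"
      unfolding D_def using \<delta>(1)
      by (simp add: field_hom_on_sum[OF MF(1) hom1(2)] termD scal1 in_k closed ts\<delta>)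
    then show ?thesis by (simp add: D_def sum_distrib_left mult_ac)
  qed
  have sumD: "(\<Sum>r<p. D r) = of_nat p * \<delta>"
  proof -
    have inv\<zeta>: "primitive_root p (inverse \<zeta>)" using \<zeta> by (simp add: primitive_root_def power_inverse)
    have "(\<Sum>r<p. D r) = (\<Sum>i<p. (\<Sum>r<p. inverse \<zeta> ^ (r * i)) * (s ^^ i) \<delta>)"
      unfolding D_def by (subst sum.swap) (simp add: sum_distrib_right)
    also have "\<dots> = (\<Sum>i<p. if i = 0 then of_nat p * \<delta> else 0)"
      by (intro sum.cong HOL.refl) (auto simp: primitive_root_sum[OF inv\<zeta>] dest: dvd_imp_le)
    finally show ?thesis using p0 by (simp add: sum.delta)
  qed
  obtain r0 where r0: "D r0 \<noteq> 0"
  proof (rule ccontr)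
    assume "\<not> thesis"
    then have "D r = 0" for r using that by blast
    then show False using sumD pL \<delta> by simp
  qed
  define \<gamma> where "\<gamma> = \<beta> ^ r0 / D r0"
  have \<beta>r: "\<beta> ^ r \<in> M" for r using \<beta>M by (intro is_subfield_power[OF MF(1)])
  have s\<beta>r: "s (\<beta> ^ r) = \<zeta> ^ r * \<beta> ^ r" and t\<beta>r: "t (\<beta> ^ r) = \<beta> ^ r" for r
    using \<beta>M by (simp_all add: field_hom_on_power[OF MF(1)] hom1 s\<beta> t\<beta> power_mult_distrib)
  have \<gamma>M: "\<gamma> \<in> M" "\<gamma> \<noteq> 0" unfolding \<gamma>_def using \<beta>M \<beta>r DM r0 by (auto intro: is_subfield_divide[OF MF(1)])
  have s\<gamma>: "s \<gamma> = \<gamma>" and t\<gamma>: "t \<gamma> = \<zeta> * \<gamma>"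
  proof -
    have "s \<gamma> = s (\<beta> ^ r0) / s (D r0)" "t \<gamma> = t (\<beta> ^ r0) / t (D r0)"
      unfolding \<gamma>_def using \<beta>r DM by (simp_all only: field_hom_on_divide[OF MF(1)] hom1)
    then show "s \<gamma> = \<gamma>" "t \<gamma> = \<zeta> * \<gamma>"
      using nz unfolding s\<beta>r t\<beta>r sD tD by (simp_all add: \<gamma>_def field_simps)
  qed
  have "\<exists>e. D r * \<gamma> / \<beta> ^ r = to_ac e" for r
  proof -
    have M: "D r * \<gamma> \<in> M" "D r * \<gamma> / \<beta> ^ r \<in> M"
      using DM \<gamma>M \<beta>r by (auto intro: is_subfield_divide[OF MF(1)] is_subfield_mult[OF MF(1)])
    have "s (D r * \<gamma> / \<beta> ^ r) = s (D r) * s \<gamma> / s (\<beta> ^ r)" "t (D r * \<gamma> / \<beta> ^ r) = t (D r) * t \<gamma> / t (\<beta> ^ r)"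
      using M(1) \<beta>r DM \<gamma>M(1) by (simp_all only: field_hom_on_divide[OF MF(1)] field_hom_on_mult[OF MF(1)] hom1)
    then have "D r * \<gamma> / \<beta> ^ r \<in> k"
      using M(2) nz unfolding s\<beta>r t\<beta>r sD tD s\<gamma> t\<gamma> by (intro in_kI) (simp_all add: field_simps)
    then show ?thesis by (auto simp: k_def)
  qed
  then obtain e where e: "\<And>r. D r * \<gamma> / \<beta> ^ r = to_ac (e r)" by metis
  define cc where "cc r = e r / of_nat p" for r
  define x where "x = \<delta> * \<gamma>"
  have x: "x = (\<Sum>r<p. to_ac (cc r) * \<beta> ^ r)"
  proof -
    have "of_nat p * x = (\<Sum>r<p. D r * \<gamma>)" by (simp add: x_def sumD flip: sum_distrib_right)
    also have "\<dots> = (\<Sum>r<p. to_ac (e r) * \<beta> ^ r)"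
      using \<beta>M by (intro sum.cong HOL.refl) (simp add: field_simps flip: e)
    finally have "x = (\<Sum>r<p. to_ac (e r) * \<beta> ^ r) / of_nat p" using pL by (simp add: field_simps)
    then show ?thesis by (simp add: cc_def sum_divide_distrib)
  qed
  have s\<gamma>i: "(s ^^ i) \<gamma> = \<gamma>" for i by (induction i) (simp_all add: s\<gamma>)
  have s\<beta>i: "(s ^^ i) \<beta> = \<zeta> ^ i * \<beta>" for i
    by (induction i) (simp_all add: scal1 in_k \<beta>M s\<beta>)
  have sx: "(s ^^ q) x = (\<Sum>r<p. to_ac (cc r) * (\<zeta> ^ q * \<beta>) ^ r)" for q
  proof -
    have "to_ac (cc r) \<in> k" for r by (simp add: k_def)
    moreover have "to_ac (cc r) * \<beta> ^ r \<in> M" for r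
      using calculation MF(2) \<beta>r by (intro is_subfield_mult[OF MF(1)]) auto
    ultimately show ?thesis
      unfolding x using \<beta>M(1)
      by (simp add: field_hom_on_sum[OF MF(1) hom(1)] scal \<beta>r field_hom_on_power[OF MF(1) hom(1)] s\<beta>i)
  qed
  have Nx: "(\<Prod>q<p. (s ^^ q) x) = inverse Z * \<gamma> ^ p"
  proof -
    have "(s ^^ q) x = (s ^^ q) y / (s ^^ Suc q) y * \<gamma>" for q
      unfolding x_def using \<delta> \<gamma>M by (simp add: field_hom_on_mult[OF MF(1) hom(1)] s\<gamma>i s\<delta> del: funpow.simps)
    then have "(\<Prod>q<p. (s ^^ q) x) = (\<Prod>q<p. (s ^^ q) y) / (\<Prod>q<p. (s ^^ Suc q) y) * \<gamma> ^ p"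
      by (simp add: prod.distrib prod_dividef del: funpow.simps)
    also have "(\<Prod>q<p. (s ^^ Suc q) y) = Z * (\<Prod>q<p. (s ^^ q) y)"
      using sy y0 by (intro prod_cyclic_shift) auto
    finally show ?thesis using Y nz by (simp add: Y_def[symmetric] field_simps)
  qed
  have pow_in_k: "\<gamma> ^ p \<in> k" "\<beta> ^ p \<in> k"
    using \<gamma>M \<beta>M roots(2)
    by (auto intro!: in_kI is_subfield_power[OF MF(1)]
      simp: field_hom_on_power[OF MF(1)] hom1 s\<gamma> t\<gamma> s\<beta> t\<beta> power_mult_distrib)
  then obtain a1 a2 where a12: "\<gamma> ^ p = to_ac a1" "\<beta> ^ p = to_ac a2" by (auto simp: k_def)
  have "independent_mod_powers p [a1, a2]"
    unfolding independent_mod_powers_pair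
  proof (intro conjI allI impI)
    show "a1 \<noteq> 0" "a2 \<noteq> 0" using a12 \<gamma>M \<beta>M by (auto simp: power_0_left)
    fix m n c assume c: "c \<noteq> 0" "a1 powi m * a2 powi n = c ^ p"
    define v where "v = \<gamma> powi m * \<beta> powi n"
    have "to_ac a1 powi m * to_ac a2 powi n = to_ac c ^ p"
      using arg_cong[OF c(2), of to_ac] by (simp add: to_ac_power_int)
    then have "v ^ p = to_ac c ^ p"
      unfolding v_def a12[symmetric] by (simp add: power_mult_distrib power_int_power power_int_power' mult.commute)
    then have "(v / to_ac c) ^ p = 1" using c(1) by (simp add: power_divide)
    then obtain i where "v / to_ac c = \<zeta> ^ i" using primitive_root_exhaust[OF \<zeta>] by metis
    then have "v = \<zeta> ^ i * to_ac c" using c(1) by (simp add: field_simps)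
    moreover have "\<zeta> ^ i * to_ac c \<in> k" using in_k(2)[of i] by (intro is_subfield_mult[OF k]) (auto simp: k_def)
    ultimately have v: "s v = v" "t v = v" using fix1 by auto
    have v0: "v \<noteq> 0" using \<gamma>M \<beta>M by (simp add: v_def)
    have gb: "\<gamma> powi m \<in> M" "\<beta> powi n \<in> M" using \<gamma>M \<beta>M by (auto intro: is_subfield_power_int[OF MF(1)])
    have "s v = \<zeta> powi n * v" "t v = \<zeta> powi m * v"
      unfolding v_def using gb \<gamma>M \<beta>M
      by (simp_all add: field_hom_on_mult[OF MF(1)] field_hom_on_power_int[OF MF(1)] hom1 s\<gamma> t\<gamma> s\<beta> t\<beta> power_int_mult_distrib)
    then show "int p dvd m" "int p dvd n"
      using v v0 by (auto intro!: primitive_root_power_int[OF \<zeta>])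
  qed
  moreover have "(\<Prod>q<p. \<Sum>i<p. to_ac (cc i) * (to_ac (z ^ p\<^sup>2) ^ q * \<beta>) ^ i) = to_ac (inverse z * a1)"
    using Nx unfolding sx a12 by (simp add: \<zeta>_def Z_def)
  ultimately show ?thesis using that[of a1 a2 \<beta> cc] a12 by blast
qed

theorem theorem4p1:
  fixes p :: nat and z \<zeta> :: "'k::field"
  assumes "Factorial_Ring.prime p" and "odd p" and "CHAR('k) \<noteq> p"
    and "primitive_root_of_unity (p ^ 3) z"
    and "\<zeta> = z ^ (p ^ 2)"
  shows "realizable_as_galois_group TYPE('k) (Phi2_41 p) \<longleftrightarrow>
    (\<exists>a1 a2 :: 'k. independent_mod_powers p [a1, a2] \<and>
       brauer_trivial (cyclic_algebra p (inverse z * a1) a2 \<zeta>))"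
proof -
  note p = assms(1,2)
  have p0: "p > 0" using p(1) by (rule prime_gt_0_nat)
  have z: "primitive_root (p ^ 3) z" using assms(4) by (rule primitive_root_of_unity_imp_primitive_root)
  have \<zeta>: "primitive_root p \<zeta>"
    using primitive_root_power[of "p\<^sup>2" p z] z unfolding assms(5) by (simp add: power2_eq_square power3_eq_cube)
  have char: "of_nat p \<noteq> (0 :: 'k)"
  proof
    assume "of_nat p = (0 :: 'k)"
    then have "CHAR('k) dvd p" by (simp add: of_nat_eq_0_iff_char_dvd)
    then have "CHAR('k) = 1" using assms(1,3) by (metis prime_nat_iff)
    then show False by simp
  qed
  have a2: "a2 \<noteq> 0" "a2 \<noteq> c ^ p" "inverse z * a1 \<noteq> 0" if ind: "independent_mod_powers p [a1, a2]" for a1 a2 c :: 'k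
  proof -
    have nz: "a1 \<noteq> 0" "a2 \<noteq> 0" using ind by (auto simp: independent_mod_powers_pair)
    then show "a2 \<noteq> 0" "inverse z * a1 \<noteq> 0" using primitive_root_nonzero[OF z] by auto
    show "a2 \<noteq> c ^ p"
    proof
      assume eq: "a2 = c ^ p"
      then have "c \<noteq> 0" using nz p0 by (auto simp: power_0_left)
      moreover have "a1 powi 0 * a2 powi 1 = c ^ p" using eq by simp
      ultimately have "int p dvd 1" using ind unfolding independent_mod_powers_pair by blast
      then show False using prime_gt_1_nat[OF p(1)] by simp
    qed
  qed
  show ?thesis
  proof
    assume real: "realizable_as_galois_group TYPE('k) (Phi2_41 p)"
    obtain a1 a2 :: 'k and \<beta> c where ind: "independent_mod_powers p [a1, a2]" and "\<beta> ^ p = to_ac a2"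
      "(\<Prod>q<p. \<Sum>i<p. to_ac (c i) * (to_ac \<zeta> ^ q * \<beta>) ^ i) = to_ac (inverse z * a1)"
      by (rule realizable_imp_norm_equation[OF p char z real, folded assms(5)])
    then interpret cyclic_norm p "inverse z * a1" a2 \<zeta> \<beta> c
      using p(1) char \<zeta> a2[OF ind] by unfold_locales auto
    show "\<exists>a1 a2. independent_mod_powers p [a1, a2] \<and> brauer_trivial (cyclic_algebra p (inverse z * a1) a2 \<zeta>)"
      using ind split by blast
  next
    assume "\<exists>a1 a2. independent_mod_powers p [a1, a2] \<and> brauer_trivial (cyclic_algebra p (inverse z * a1) a2 \<zeta>)"
    then obtain a1 a2 where ind: "independent_mod_powers p [a1, a2]"
      and triv: "brauer_trivial (cyclic_algebra p (inverse z * a1) a2 \<zeta>)" by blast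
    obtain \<beta> where \<beta>: "\<beta> ^ p = to_ac a2" using nth_root_exists[OF p0] by blast
    obtain h d where "ac_poly d \<beta> \<noteq> 0"
      "(\<Prod>q<p. ac_poly h (to_ac \<zeta> ^ q * \<beta>)) = to_ac (inverse z * a1) * (\<Prod>q<p. ac_poly d (to_ac \<zeta> ^ q * \<beta>))"
      using split_imp_norm_equation[OF p(1) char \<zeta> a2(3)[OF ind] a2(1)[OF ind] a2(2)[OF ind] \<beta> triv] by blast
    then show "realizable_as_galois_group TYPE('k) (Phi2_41 p)"
      unfolding assms(5) by (intro norm_equation_imp_realizable[OF p char z ind \<beta>])
  qed
qed

end
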